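(* Let $d\geqslant2$ and $L\geqslant1$ be integers. There exists a sufficiently small constant $\varepsilon_0=\varepsilon_0(d)<1/2$ such that the following holds. Assume that $A>0$, $\tilde\mu>0$, $\tilde\lambda_u\geqslant1$, $0<\varepsilon\leqslant\varepsilon_0$, and consider a smooth deformation $y(t,x)=x+u(t,x)\in C^\infty(\mathcal{I}^{q,i}\times\mathbb{R}^d;\mathbb{R}^d)$ with $F=\nabla_xy$ satisfying $$\|u\|_0\leqslant2\varepsilon,\qquad \|\nabla u\|_0,\ \|\partial_tu\|_0\leqslant\varepsilon,\qquad \|\partial_t^ru\|_N\leqslant\varepsilon\tilde\lambda_u^{N+r-1},\quad 2\leqslant N+r\leqslant L+2,\ N,r\geqslant0.$$ Let $U\in C^\infty(\mathcal{I}^{q,i}\times\mathbb{R}^d;\mathbb{R}^d)$ be a smooth vector field with $$\operatorname{supp}_xU(t,\cdot)\subseteq B(x_0,\tilde\mu),\qquad t\in\mathcal{I}^{q,i},$$ for some $x_0\in\mathbb{R}^d$, and with vanishing linear and angular moments in Lagrangian coordinates, i.e. for $j,l=1,\dots,d$ and all $t$, $$\int_{\mathbb{R}^d}U_l(t,x)\,dx=0,\qquad \int_{\mathbb{R}^d}(y_jU_l-y_lU_j)(t,x)\,dx=0.$$ Assume moreover that, for some constant $\tilde\lambda_U>0$ and for $r=0,1,2$, $$\|\partial_t^rU\|_N\leqslant A\tilde\lambda_U^{N+r},\qquad 0\leqslant N+r\leqslant L.$$ Then there exists a symmetric tensor field $\tilde R^{(u)}[U]=(\tilde R^{(u)}_{lj}[U])_{1\leqslant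 l,j\leqslant d}$ solving the asymmetric divergence equation $$\operatorname{div}\big(F\,\tilde R^{(u)}[U]\big)=U.$$ The solution depends linearly on $U$ for fixed $y$ and has the following properties: 1. There exists a constant $C_d>0$, depending only on $d$, such that $\operatorname{supp}_x\tilde R^{(u)}_{lj}[U](t,\cdot)\subseteq B(x_0,(1+C_d\varepsilon)\tilde\mu)$ for all $t\in\mathcal{I}^{q,i}$. 2. $\operatorname{supp}_t\tilde R^{(u)}_{lj}[U]\subseteq\operatorname{supp}_tU$. 3. There exists a constant $C^*_{d,L}>0$, depending only on $d$ and $L$, such that for $r=0,1,2$, $$\|\partial_t^r\tilde R^{(u)}_{lj}[U]\|_N\leqslant C^*_{d,L}A\tilde\mu\,\big(\max\{\varepsilon\tilde\mu^{-1},\tilde\lambda_U,\tilde\lambda_u\}\big)^r\big(\max\{\tilde\mu^{-1},\tilde\lambda_U,\tilde\lambda_u\}\big)^N,\qquad 0\leqslant N\leqslant L-r.$$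
   Context: Time interval: $\mathcal{I}^{q,i}=[-\tau_{q,i},T+\tau_{q,i}]$, where $T>0$, $q\in\mathbb{N}$, $0\leqslant i\leqslant2$, and $\tau_{q,i}=(\lambda_{q,i}\lambda_{q,i+1})^{-1/2}\delta_q^{-1/4}>0$ with $\lambda_q=\lceil\varepsilon_*^{-b(q+3)^2/3}\rceil^3$, $\lambda_{q,i}=\lambda_q^{1-i/3}\lambda_{q+1}^{i/3}$, $\delta_q=\varepsilon_*^{2(q+3)/3}$ for fixed parameters $b>0$ and small $\varepsilon_*>0$ (only the fact that it is a compact interval matters for the statement). Norms: $\|\cdot\|_N=\|\cdot\|_{C^0(\mathcal{I}^{q,i};C^N(\mathbb{R}^d))}$, i.e. the sum over $0\leqslant j\leqslant N$ of the maxima over multi-indices $|k|=j$ of $\sup_{t,x}|D_x^kf(t,x)|$ (spatial derivatives only). $\operatorname{supp}_x$ is the closed spatial support at fixed time; $\operatorname{supp}_tf$ is the closure of $\{t\in\mathcal{I}^{q,i}:\exists x,\ f(t,x)\neq0\}$. $B(x,r)=\{x':|x'-x|<r\}$. Matrix conventions: $F_{lj}=\partial_{x_j}y_l$ and $(\operatorname{div}P)_l=\sum_j\partial_{x_j}P_{lj}$. *)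

theory Defs
  imports "HOL-Analysis.Analysis"
begin

section \<open>The time interval\<close>

text \<open>In the usual notation of convex integration, \<open>freq\<close>, \<open>freq_sub\<close>, \<open>amp\<close> and
  \<open>time_margin\<close> are \<open>\<lambda>\<^sub>q\<close>, its geometric interpolation \<open>\<lambda>\<close> with indices \<open>q, i\<close> (equal to the next
  frequency for \<open>i = 3\<close>), \<open>\<delta>\<^sub>q\<close>, and \<open>\<tau>\<close> with indices \<open>q, i\<close>.\<close>

definition freq :: "real \<Rightarrow> real \<Rightarrow> nat \<Rightarrow> real" where
  "freq b \<epsilon>s q = real_of_int \<lceil>\<epsilon>s powr (- b * (real q + 3)\<^sup>2 / 3)\<rceil> ^ 3"

definition freq_sub :: "real \<Rightarrow> real \<Rightarrow> nat \<Rightarrow> nat \<Rightarrow> real" where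
  "freq_sub b \<epsilon>s q i =
     freq b \<epsilon>s q powr (1 - real i / 3) * freq b \<epsilon>s (q + 1) powr (real i / 3)"

definition amp :: "real \<Rightarrow> nat \<Rightarrow> real" where
  "amp \<epsilon>s q = \<epsilon>s powr (2 * (real q + 3) / 3)"

definition time_margin :: "real \<Rightarrow> real \<Rightarrow> nat \<Rightarrow> nat \<Rightarrow> real" where
  "time_margin b \<epsilon>s q i =
     (freq_sub b \<epsilon>s q i * freq_sub b \<epsilon>s q (i + 1)) powr (- 1 / 2) * amp \<epsilon>s q powr (- 1 / 4)"

definition time_interval :: "real \<Rightarrow> real \<Rightarrow> real \<Rightarrow> nat \<Rightarrow> nat \<Rightarrow> real set" where
  "time_interval T b \<epsilon>s q i = {- time_margin b \<epsilon>s q i .. T + time_margin b \<epsilon>s q i}"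


section \<open>Smooth functions of time and space\<close>

text \<open>The derivatives are Frechet derivatives relative to \<open>S\<close>, hence one-sided at boundary points
  of \<open>S\<close>. They are unique when \<open>S\<close> is a product of a nondegenerate interval with the whole space,
  which is the only case used below.\<close>

fun Ck_on :: "nat \<Rightarrow> 'a::real_normed_vector set \<Rightarrow> ('a \<Rightarrow> 'b::real_normed_vector) \<Rightarrow> bool" where
  "Ck_on 0 S f \<longleftrightarrow> continuous_on S f"
| "Ck_on (Suc k) S f \<longleftrightarrow>
     (\<exists>f'. (\<forall>x\<in>S. (f has_derivative f' x) (at x within S)) \<and> (\<forall>v. Ck_on k S (\<lambda>x. f' x v)))"

definition smooth_field ::
  "real set \<Rightarrow> (real \<Rightarrow> 'a::real_normed_vector \<Rightarrow> 'b::real_normed_vector) \<Rightarrow> bool" where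
  "smooth_field I f \<longleftrightarrow> (\<forall>k. Ck_on k (I \<times> UNIV) (\<lambda>(t, x). f t x))"

definition dt :: "real set \<Rightarrow> (real \<Rightarrow> 'a \<Rightarrow> 'b::real_normed_vector) \<Rightarrow> real \<Rightarrow> 'a \<Rightarrow> 'b" where
  "dt I f = (\<lambda>t x. vector_derivative (\<lambda>s. f s x) (at t within I))"

definition dx :: "'n::finite \<Rightarrow> (real \<Rightarrow> real ^ 'n \<Rightarrow> 'b::real_normed_vector)
    \<Rightarrow> real \<Rightarrow> real ^ 'n \<Rightarrow> 'b" where
  "dx j f = (\<lambda>t x. frechet_derivative (f t) (at x) (axis j 1))"

definition grad :: "(real \<Rightarrow> real ^ 'n \<Rightarrow> real ^ 'n) \<Rightarrow> real \<Rightarrow> real ^ 'n \<Rightarrow> real ^ 'n ^ 'n::finite" where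
  "grad y = (\<lambda>t x. jacobian (y t) (at x))"

definition divergence :: "(real \<Rightarrow> real ^ 'n \<Rightarrow> real ^ 'n ^ 'n) \<Rightarrow> real \<Rightarrow> real ^ 'n \<Rightarrow> real ^ 'n::finite" where
  "divergence P = (\<lambda>t x. \<chi> l. \<Sum>j\<in>UNIV. dx j (\<lambda>t x. P t x $ l $ j) t x)"

text \<open>The norm of \<open>C\<^sup>0(I; C\<^sup>N)\<close>, with values in the extended nonnegative reals, so that an
  unbounded derivative has norm \<open>\<infinity>\<close>. A multi-index of order \<open>j\<close> is represented by a list of \<open>j\<close>
  coordinate directions; the order of the list is immaterial for smooth functions. The pointwise
  norm is the Euclidean one, i.e. the Frobenius norm for matrix-valued functions.\<close>

definition norm_CN :: "real set \<Rightarrow> nat \<Rightarrow> (real \<Rightarrow> real ^ 'n::finite \<Rightarrow> 'b::real_normed_vector)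
    \<Rightarrow> ennreal" where
  "norm_CN I N f =
     (\<Sum>j\<le>N. SUP ks\<in>{ks. length ks = j}. SUP t\<in>I. SUP x. ennreal (norm (foldr dx ks f t x)))"

definition supp_x :: "('a::topological_space \<Rightarrow> 'b::zero) \<Rightarrow> 'a set" where
  "supp_x g = closure {x. g x \<noteq> 0}"

definition supp_t :: "real set \<Rightarrow> (real \<Rightarrow> 'a \<Rightarrow> 'b::zero) \<Rightarrow> real set" where
  "supp_t I f = closure {t \<in> I. \<exists>x. f t x \<noteq> 0}"


section \<open>Hypotheses on the deformation and on the right-hand side\<close>

definition deformation_bounds ::
  "real set \<Rightarrow> nat \<Rightarrow> real \<Rightarrow> real \<Rightarrow> (real \<Rightarrow> real ^ 'n::finite \<Rightarrow> real ^ 'n) \<Rightarrow> bool" where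
  "deformation_bounds I L \<epsilon> \<Lambda>u u \<longleftrightarrow>
     norm_CN I 0 u \<le> ennreal (2 * \<epsilon>) \<and>
     norm_CN I 0 (grad u) \<le> ennreal \<epsilon> \<and>
     norm_CN I 0 (dt I u) \<le> ennreal \<epsilon> \<and>
     (\<forall>N r. 2 \<le> N + r \<and> N + r \<le> L + 2 \<longrightarrow>
        norm_CN I N ((dt I ^^ r) u) \<le> ennreal (\<epsilon> * \<Lambda>u ^ (N + r - 1)))"

text \<open>The linear space of right-hand sides: smooth fields supported in the ball, with vanishing
  linear and angular moments in Lagrangian coordinates.\<close>

definition admissible ::
  "real set \<Rightarrow> (real \<Rightarrow> real ^ 'n::finite \<Rightarrow> real ^ 'n) \<Rightarrow> real ^ 'n \<Rightarrow> real
     \<Rightarrow> (real \<Rightarrow> real ^ 'n \<Rightarrow> real ^ 'n) \<Rightarrow> bool" where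
  "admissible I y x0 \<mu> U \<longleftrightarrow>
     smooth_field I U \<and>
     (\<forall>t\<in>I. supp_x (U t) \<subseteq> ball x0 \<mu>) \<and>
     (\<forall>t\<in>I. \<forall>l. (LINT x|lborel. U t x $ l) = 0) \<and>
     (\<forall>t\<in>I. \<forall>j l. (LINT x|lborel. y t x $ j * U t x $ l - y t x $ l * U t x $ j) = 0)"

definition linear_on_admissible ::
  "real set \<Rightarrow> (real \<Rightarrow> real ^ 'n::finite \<Rightarrow> real ^ 'n) \<Rightarrow> real ^ 'n \<Rightarrow> real
     \<Rightarrow> ((real \<Rightarrow> real ^ 'n \<Rightarrow> real ^ 'n) \<Rightarrow> (real \<Rightarrow> real ^ 'n \<Rightarrow> real ^ 'n ^ 'n)) \<Rightarrow> bool" where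
  "linear_on_admissible I y x0 \<mu> R \<longleftrightarrow>
     (\<forall>U V a b. admissible I y x0 \<mu> U \<and> admissible I y x0 \<mu> V \<longrightarrow>
        (\<forall>t\<in>I. \<forall>x. R (\<lambda>t x. a *\<^sub>R U t x + b *\<^sub>R V t x) t x
                      = a *\<^sub>R R U t x + b *\<^sub>R R V t x))"

end

theory Submission
  imports Defs
begin

text \<open>If \<open>\<sigma>\<close> is a symmetric solution of \<open>div \<sigma> = (U / J) \<circ> y\<^sup>-\<^sup>1\<close> in the coordinates \<open>y\<close>, where
  \<open>J = det F\<close>, then by the Piola identity \<open>R = J F\<^sup>-\<^sup>1 (\<sigma> \<circ> y) F\<^sup>-\<^sup>T\<close> is symmetric and \<open>div (F R) = U\<close>;
  the moments of \<open>U\<close> are exactly the solvability conditions in the coordinates \<open>y\<close>. For \<open>\<sigma>\<close> there is an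
  explicit formula, an integral over segments whose base points are averaged with a bump function.
  In it the end points of the segments are parametrised by \<open>x\<close> instead of \<open>y\<close>: this removes the
  inverse of \<open>y\<close>, so that \<open>R\<close> is an integral over a fixed compact set of a smooth expression in
  \<open>u\<close>, \<open>F\<close> and \<open>U\<close>. Smoothness and linearity are then immediate, the support consists of segments
  between the support of \<open>U\<close> and the base points, and the estimates follow from the Leibniz rule,
  each derivative costing one of the factors in the maxima.\<close>

subsection \<open>Functions of class \<open>C\<^sup>k\<close> on a set\<close>

text \<open>The factors in the maxima come from the way the variables enter the final formula. The
  end points of the segments are translates \<open>x + c\<close> with \<open>c\<close> free of
  \<open>t\<close> and \<open>x\<close>, so \<open>U\<close> and \<open>F\<close> are differentiated
  there without a chain rule and cost only their own frequencies. The base points are weighted in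
  the coordinates \<open>y\<close>, where the moment conditions annihilate rigid motions; the weight
  sees \<open>x\<close> through \<open>(y t x - y t x0) / \<mu>\<close> and through averages of
  \<open>F\<close>. A space derivative of that quotient is \<open>F / \<mu>\<close>, whence
  \<open>1 / \<mu>\<close>; a time derivative is the difference of \<open>dt u\<close> at
  \<open>x\<close> and at \<open>x0\<close> over \<open>\<mu>\<close>, whence only
  \<open>\<epsilon> / \<mu>\<close>. Thus one object has two descriptions: in the coordinates
  \<open>y\<close>, with the inverse map, it satisfies the divergence equation; in the coordinates
  \<open>x\<close> it is smooth and can be estimated. The change of variables between them is proved
  by deforming the map linearly to the identity: by the Piola identity the derivative along this
  path is the integral of a divergence.\<close>

declare Ck_on.simps(2)[simp del]

lemma Ck_on_SucI:
  assumes "\<And>x. x \<in> S \<Longrightarrow> (f has_derivative f' x) (at x within S)" "\<And>v. Ck_on k S (\<lambda>x. f' x v)"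
  shows "Ck_on (Suc k) S f"
  unfolding Ck_on.simps(2) using assms by (intro exI[of _ f']) simp

lemma Ck_on_SucE:
  assumes "Ck_on (Suc k) S f"
  obtains f' where "\<And>x. x \<in> S \<Longrightarrow> (f has_derivative f' x) (at x within S)" "\<And>v. Ck_on k S (\<lambda>x. f' x v)"
  using assms unfolding Ck_on.simps(2) by blast

lemma Ck_on_cong:
  assumes "Ck_on k S f" "\<And>x. x \<in> S \<Longrightarrow> f x = g x"
  shows "Ck_on k S g"
proof (cases k)
  case 0
  then show ?thesis using assms continuous_on_eq by auto
next
  case (Suc k')
  then obtain f' where f': "\<And>x. x \<in> S \<Longrightarrow> (f has_derivative f' x) (at x within S)" "\<And>v. Ck_on k' S (\<lambda>x. f' x v)"
    using Ck_on_SucE[of k' S f] assms(1) by metis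
  have "(g has_derivative f' x) (at x within S)" if "x \<in> S" for x
    using has_derivative_transform[OF that _ f'(1)[OF that]] assms(2) by auto
  then show ?thesis unfolding Suc using f'(2) by (rule Ck_on_SucI)
qed

lemma Ck_on_SucD: "Ck_on (Suc k) S f \<Longrightarrow> Ck_on k S f"
proof (induction k arbitrary: f)
  case 0
  then show ?case
    by (auto simp: continuous_on_eq_continuous_within elim!: Ck_on_SucE intro: has_derivative_continuous)
next
  case (Suc k)
  from Suc.prems obtain f' where f': "\<And>x. x \<in> S \<Longrightarrow> (f has_derivative f' x) (at x within S)" "\<And>v. Ck_on (Suc k) S (\<lambda>x. f' x v)"
    by (rule Ck_on_SucE) (rule that)
  show ?case by (rule Ck_on_SucI[OF f'(1) Suc.IH[OF f'(2)]])
qed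

lemma Ck_on_mono: "Ck_on k S f \<Longrightarrow> j \<le> k \<Longrightarrow> Ck_on j S f"
proof (induction k)
  case (Suc k)
  then show ?case using Ck_on_SucD by (cases "j = Suc k") auto
qed simp

lemma Ck_on_continuous: "Ck_on k S f \<Longrightarrow> continuous_on S f"
  using Ck_on_mono[of k S f 0] by simp

lemma Ck_on_const: "Ck_on k S (\<lambda>x. c)"
proof (induction k arbitrary: c)
  case (Suc k)
  show ?case by (rule Ck_on_SucI[where f'="\<lambda>x v. 0"]) (auto intro: Suc)
qed simp

lemma Ck_on_linear: "bounded_linear f \<Longrightarrow> Ck_on k S f"
proof (cases k)
  case (Suc k')
  assume "bounded_linear f"
  then show ?thesis unfolding Suc
    by (intro Ck_on_SucI[where f'="\<lambda>x. f"] Ck_on_const bounded_linear_imp_has_derivative)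
qed (simp add: linear_continuous_on)

lemma Ck_on_add: "Ck_on k S f \<Longrightarrow> Ck_on k S g \<Longrightarrow> Ck_on k S (\<lambda>x. f x + g x)"
proof (induction k arbitrary: f g)
  case (Suc k)
  from Suc.prems(1) obtain f' where f: "\<And>x. x \<in> S \<Longrightarrow> (f has_derivative f' x) (at x within S)" "\<And>v. Ck_on k S (\<lambda>x. f' x v)"
    by (rule Ck_on_SucE) (rule that)
  from Suc.prems(2) obtain g' where g: "\<And>x. x \<in> S \<Longrightarrow> (g has_derivative g' x) (at x within S)" "\<And>v. Ck_on k S (\<lambda>x. g' x v)"
    by (rule Ck_on_SucE) (rule that)
  show ?case
    by (rule Ck_on_SucI[OF has_derivative_add[OF f(1) g(1)] Suc.IH[OF f(2) g(2)]])
qed (simp add: continuous_on_add)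

lemma Ck_on_bilinear:
  assumes "bounded_bilinear B"
  shows "Ck_on k S f \<Longrightarrow> Ck_on k S g \<Longrightarrow> Ck_on k S (\<lambda>x. B (f x) (g x))"
proof (induction k arbitrary: f g)
  case 0
  then show ?case using bounded_bilinear.continuous_on[OF assms] by auto
next
  case (Suc k)
  from Suc.prems(1) obtain f' where f: "\<And>x. x \<in> S \<Longrightarrow> (f has_derivative f' x) (at x within S)" "\<And>v. Ck_on k S (\<lambda>x. f' x v)"
    by (rule Ck_on_SucE) (rule that)
  from Suc.prems(2) obtain g' where g: "\<And>x. x \<in> S \<Longrightarrow> (g has_derivative g' x) (at x within S)" "\<And>v. Ck_on k S (\<lambda>x. g' x v)"
    by (rule Ck_on_SucE) (rule that)
  have "Ck_on k S f" "Ck_on k S g" using Suc.prems Ck_on_SucD by auto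
  then have "Ck_on k S (\<lambda>x. B (f x) (g' x v) + B (f' x v) (g x))" for v
    by (intro Ck_on_add Suc.IH f g)
  with bounded_bilinear.FDERIV[OF assms f(1) g(1)] show ?case
    by (rule Ck_on_SucI)
qed

lemmas Ck_on_scaleR = Ck_on_bilinear[OF bounded_bilinear_scaleR]
  and Ck_on_mult = Ck_on_bilinear[OF bounded_bilinear_mult]
  and Ck_on_inner = Ck_on_bilinear[OF bounded_bilinear_inner]

lemma Ck_on_linear_compose: "bounded_linear L \<Longrightarrow> Ck_on k S f \<Longrightarrow> Ck_on k S (\<lambda>x. L (f x))"
proof (induction k arbitrary: f)
  case 0
  then show ?case using bounded_linear.continuous_on by auto
next
  case (Suc k)
  from Suc.prems(2) obtain f' where f: "\<And>x. x \<in> S \<Longrightarrow> (f has_derivative f' x) (at x within S)" "\<And>v. Ck_on k S (\<lambda>x. f' x v)"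
    by (rule Ck_on_SucE) (rule that)
  show ?case
    by (rule Ck_on_SucI[OF bounded_linear.has_derivative[OF Suc.prems(1) f(1)] Suc.IH[OF Suc.prems(1) f(2)]])
qed

lemmas Ck_on_minus = Ck_on_linear_compose[OF bounded_linear_minus[OF bounded_linear_ident]]
  and Ck_on_fst = Ck_on_linear_compose[OF bounded_linear_fst]
  and Ck_on_snd = Ck_on_linear_compose[OF bounded_linear_snd]
  and Ck_on_nth = Ck_on_linear_compose[OF bounded_linear_vec_nth]
  and Ck_on_ident = Ck_on_linear[OF bounded_linear_ident]

lemma Ck_on_diff: "Ck_on k S f \<Longrightarrow> Ck_on k S g \<Longrightarrow> Ck_on k S (\<lambda>x. f x - g x :: 'b::real_normed_vector)"
  using Ck_on_add[of k S f "\<lambda>x. - g x"] Ck_on_minus[of k S g] by simp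

lemma Ck_on_sum: "(\<And>i. i \<in> A \<Longrightarrow> Ck_on k S (f i)) \<Longrightarrow> Ck_on k S (\<lambda>x. \<Sum>i\<in>A. f i x)"
  by (induction A rule: infinite_finite_induct) (auto intro: Ck_on_const Ck_on_add)

lemma Ck_on_prod:
  fixes f :: "'i \<Rightarrow> 'a::real_normed_vector \<Rightarrow> real"
  shows "(\<And>i. i \<in> A \<Longrightarrow> Ck_on k S (f i)) \<Longrightarrow> Ck_on k S (\<lambda>x. \<Prod>i\<in>A. f i x)"
  by (induction A rule: infinite_finite_induct) (auto intro: Ck_on_const Ck_on_mult)

lemma Ck_on_Pair: "Ck_on k S f \<Longrightarrow> Ck_on k S g \<Longrightarrow> Ck_on k S (\<lambda>x. (f x, g x))"
  using Ck_on_add[OF Ck_on_linear_compose[of "\<lambda>y. (y, 0)" k S f] Ck_on_linear_compose[of "\<lambda>y. (0, y)" k S g]]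
  by (simp add: bounded_linear_Pair bounded_linear_ident bounded_linear_zero)

lemma Ck_on_vec:
  fixes f :: "'a::real_normed_vector \<Rightarrow> 'b::real_normed_vector ^ 'n::finite"
  assumes "\<And>i. Ck_on k S (\<lambda>x. f x $ i)"
  shows "Ck_on k S f"
proof -
  have bl: "bounded_linear (axis i :: 'b \<Rightarrow> 'b ^ 'n)" for i
  proof (rule bounded_linear_intro[where K=1])
    show "norm (axis i x :: 'b^'n) \<le> norm x * 1" for x
      by (simp add: norm_vec_def L2_set_def axis_def if_distrib[of norm] if_distrib[of "\<lambda>u. u\<^sup>2"] cong: if_cong)
  qed (auto simp: axis_def vec_eq_iff)
  have "f x = (\<Sum>i\<in>UNIV. axis i (f x $ i))" for x
    by (auto simp: vec_eq_iff axis_def if_distrib[of "\<lambda>u. u $ _"] cong: if_cong)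
  then show ?thesis
    using Ck_on_sum[of UNIV k S "\<lambda>i x. axis i (f x $ i)"] Ck_on_linear_compose[OF bl assms] by simp
qed

text \<open>The chain rule yields \<open>g' (f x) (f' x v)\<close>, where the direction fed to
  \<open>g'\<close> varies with \<open>x\<close>, whereas \<open>Ck_on\<close> speaks of fixed
  directions. Expanding \<open>f' x v\<close> in the basis repairs this, hence the Euclidean
  codomain of \<open>f\<close>.\<close>

lemma Ck_on_compose:
  fixes f :: "'a::real_normed_vector \<Rightarrow> 'b::euclidean_space"
  shows "Ck_on k T g \<Longrightarrow> Ck_on k S f \<Longrightarrow> f ` S \<subseteq> T \<Longrightarrow> Ck_on k S (\<lambda>x. g (f x))"
proof (induction k arbitrary: f g)
  case 0
  then show ?case using continuous_on_compose2[of T g S f] by auto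
next
  case (Suc k)
  from Suc.prems(2) obtain f' where f': "\<And>x. x \<in> S \<Longrightarrow> (f has_derivative f' x) (at x within S)" "\<And>v. Ck_on k S (\<lambda>x. f' x v)"
    by (rule Ck_on_SucE) (rule that)
  from Suc.prems(1) obtain g' where g': "\<And>x. x \<in> T \<Longrightarrow> (g has_derivative g' x) (at x within T)" "\<And>v. Ck_on k T (\<lambda>x. g' x v)"
    by (rule Ck_on_SucE) (rule that)
  have k: "Ck_on k S f" using Suc.prems(2) by (rule Ck_on_SucD)
  let ?h = "\<lambda>x v. \<Sum>b\<in>Basis. (f' x v \<bullet> b) *\<^sub>R g' (f x) b"
  have "((\<lambda>x. g (f x)) has_derivative ?h x) (at x within S)" if "x \<in> S" for x
  proof -
    have "f x \<in> T" using that Suc.prems by auto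
    then have lin: "linear (g' (f x))" using g' has_derivative_bounded_linear bounded_linear.linear by blast
    have "((\<lambda>x. g (f x)) has_derivative (\<lambda>v. g' (f x) (f' x v))) (at x within S)"
      using f' g' that Suc.prems(3) \<open>f x \<in> T\<close>
      by (intro has_derivative_in_compose[of f "f' x" x S g "g' (f x)"]) (auto intro: has_derivative_subset)
    moreover have "g' (f x) (f' x v) = ?h x v" for v
      by (subst euclidean_representation[of "f' x v", symmetric])
         (simp add: linear_sum[OF lin] linear_cmul[OF lin])
    ultimately show ?thesis by simp
  qed
  moreover have "Ck_on k S (\<lambda>x. ?h x v)" for v
    by (intro Ck_on_sum Ck_on_scaleR Ck_on_inner Ck_on_const f'(2) Suc.IH[OF g'(2) k Suc.prems(3)])
  ultimately show ?case by (rule Ck_on_SucI)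
qed

text \<open>For functions presented together with all their derivatives
  \<open>g 0, g 1, ...\<close>; the instances are \<open>inverse_tower\<close> and
  \<open>bump\<close>.\<close>

lemma Ck_on_tower:
  fixes g :: "nat \<Rightarrow> real \<Rightarrow> real"
  assumes "\<And>m x. x \<in> T \<Longrightarrow> (g m has_real_derivative g (Suc m) x) (at x within T)"
  shows "Ck_on k T (g m)"
proof (induction k arbitrary: m)
  case 0
  show ?case unfolding Ck_on.simps using assms by (rule DERIV_continuous_on)
next
  case (Suc k)
  have "Ck_on k T (\<lambda>x. g (Suc m) x * v)" for v by (intro Ck_on_mult Suc Ck_on_const)
  then show ?case using assms
    by (intro Ck_on_SucI[where f'="\<lambda>x v. g (Suc m) x * v"]) (auto simp: has_field_derivative_def mult_commute_abs)
qed

section \<open>Integrals depending on a parameter\<close>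

lemma has_derivative_partial:
  assumes "(\<Phi> has_derivative \<Phi>') (at (z, p) within S \<times> P)" "p \<in> P"
  shows "((\<lambda>z. \<Phi> (z, p)) has_derivative (\<lambda>v. \<Phi>' (v, 0))) (at z within S)"
proof -
  have "(\<lambda>z. (z, p)) ` S \<subseteq> S \<times> P" using assms(2) by auto
  then show ?thesis
    by (intro has_derivative_in_compose[of "\<lambda>z. (z, p)" "\<lambda>v. (v, 0)" z S \<Phi> \<Phi>']
        has_derivative_Pair has_derivative_const has_derivative_ident has_derivative_subset[OF assms(1)])
qed

text \<open>\<open>leibniz_rule\<close> wants a derivative that is continuous as a bounded linear
  map, while \<open>Ck_on\<close> provides continuity in each direction. On a Euclidean domain the
  two agree, by testing on basis vectors.\<close>

lemma has_derivative_integral_param: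
  fixes \<Phi> :: "'a::euclidean_space \<times> 'p::euclidean_space \<Rightarrow> 'b::euclidean_space"
  assumes d: "\<And>q. q \<in> S \<times> cbox a b \<Longrightarrow> (\<Phi> has_derivative \<Phi>' q) (at q within S \<times> cbox a b)"
    and c: "\<And>v. continuous_on (S \<times> cbox a b) (\<lambda>q. \<Phi>' q v)"
    and S: "convex S" "z \<in> S"
  shows "((\<lambda>z. integral (cbox a b) (\<lambda>p. \<Phi> (z, p))) has_derivative
          (\<lambda>v. integral (cbox a b) (\<lambda>p. \<Phi>' (z, p) (v, 0)))) (at z within S)"
proof -
  have bl: "bounded_linear (\<lambda>v. \<Phi>' q (v, 0))" if "q \<in> S \<times> cbox a b" for q
    using d[OF that] has_derivative_bounded_linear
    by (auto intro!: bounded_linear_compose[of "\<Phi>' q" "\<lambda>v. (v, 0)"] bounded_linear_Pair bounded_linear_ident bounded_linear_zero)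
  define fx where "fx x p = Blinfun (\<lambda>v. \<Phi>' (x, p) (v, 0))" for x p
  have ap: "blinfun_apply (fx x p) v = \<Phi>' (x, p) (v, 0)" if "x \<in> S" "p \<in> cbox a b" for x p v
    unfolding fx_def using bounded_linear_Blinfun_apply[OF bl] that by auto
  have cont: "continuous_on S' \<Phi>" if "S' \<subseteq> S \<times> cbox a b" for S'
    using continuous_on_subset[OF _ that] d has_derivative_continuous_on by blast
  have int: "(\<lambda>p. \<Phi> (x, p)) integrable_on cbox a b" if "x \<in> S" for x
    using that by (intro integrable_continuous continuous_on_compose2[OF cont[OF order_refl]] continuous_intros) auto
  have cf: "continuous_on (S \<times> cbox a b) (\<lambda>(x, t). fx x t)"
  proof (rule continuous_on_blinfun_componentwise)
    fix i :: 'a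
    have "continuous_on (S \<times> cbox a b) (\<lambda>q. \<Phi>' q (i, 0))" by (rule c)
    then show "continuous_on (S \<times> cbox a b) (\<lambda>x. blinfun_apply (case x of (x, t) \<Rightarrow> fx x t) i)"
      by (rule continuous_on_eq) (auto simp: ap)
  qed
  have "((\<lambda>z. integral (cbox a b) (\<lambda>p. \<Phi> (z, p))) has_derivative blinfun_apply (integral (cbox a b) (fx z))) (at z within S)"
  proof (rule leibniz_rule[OF _ int cf S(2,1)])
    show "((\<lambda>x. \<Phi> (x, t)) has_derivative blinfun_apply (fx x t)) (at x within S)"
      if "x \<in> S" "t \<in> cbox a b" for x t
    proof -
      have "blinfun_apply (fx x t) = (\<lambda>v. \<Phi>' (x, t) (v, 0))" using ap that by auto
      then show ?thesis using has_derivative_partial[OF d] that by auto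
    qed
  qed
  moreover have "blinfun_apply (integral (cbox a b) (fx z)) v = integral (cbox a b) (\<lambda>p. \<Phi>' (z, p) (v, 0))" for v
  proof -
    have "(\<lambda>p. case (z, p) of (x, t) \<Rightarrow> fx x t) integrable_on cbox a b"
      using S by (intro integrable_continuous continuous_on_compose2[OF cf] continuous_intros) auto
    then have "blinfun_apply (integral (cbox a b) (fx z)) v = integral (cbox a b) (\<lambda>p. blinfun_apply (fx z p) v)"
      using integral_linear[of "fx z" "cbox a b" "\<lambda>f. blinfun_apply f v"]
      by (simp add: o_def blinfun.bounded_linear_left)
    also have "\<dots> = integral (cbox a b) (\<lambda>p. \<Phi>' (z, p) (v, 0))"
      using S by (intro integral_cong) (auto simp: ap)
    finally show ?thesis .
  qed
  then have "blinfun_apply (integral (cbox a b) (fx z)) = (\<lambda>v. integral (cbox a b) (\<lambda>p. \<Phi>' (z, p) (v, 0)))"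
    by (rule ext)
  ultimately show ?thesis by simp
qed

lemma continuous_on_integral_param:
  fixes \<Phi> :: "'a::euclidean_space \<times> 'p::euclidean_space \<Rightarrow> 'b::euclidean_space"
  assumes "continuous_on (S \<times> cbox a b) \<Phi>"
  shows "continuous_on S (\<lambda>z. integral (cbox a b) (\<lambda>p. \<Phi> (z, p)))"
  using integral_continuous_on_param[of S a b "\<lambda>z p. \<Phi> (z, p)"] assms by simp

lemma Ck_on_integral:
  fixes \<Phi> :: "'a::euclidean_space \<times> 'p::euclidean_space \<Rightarrow> 'b::euclidean_space"
  assumes "convex S"
  shows "Ck_on k (S \<times> cbox a b) \<Phi> \<Longrightarrow> Ck_on k S (\<lambda>z. integral (cbox a b) (\<lambda>p. \<Phi> (z, p)))"
proof (induction k arbitrary: \<Phi>)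
  case 0
  then show ?case by (simp add: continuous_on_integral_param)
next
  case (Suc k)
  from Suc.prems obtain \<Phi>' where p: "\<And>q. q \<in> S \<times> cbox a b \<Longrightarrow> (\<Phi> has_derivative \<Phi>' q) (at q within S \<times> cbox a b)"
    "\<And>v. Ck_on k (S \<times> cbox a b) (\<lambda>q. \<Phi>' q v)"
    by (rule Ck_on_SucE) (rule that)
  have "Ck_on k S (\<lambda>z. integral (cbox a b) (\<lambda>p. \<Phi>' (z, p) (v, 0)))" for v
    by (rule Suc.IH[OF p(2)])
  moreover have "((\<lambda>z. integral (cbox a b) (\<lambda>p. \<Phi> (z, p))) has_derivative
          (\<lambda>v. integral (cbox a b) (\<lambda>p. \<Phi>' (z, p) (v, 0)))) (at z within S)" if "z \<in> S" for z
    by (rule has_derivative_integral_param[OF p(1) Ck_on_continuous[OF p(2)] assms that])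
  ultimately show ?case by (intro Ck_on_SucI)
qed

text \<open>The first difference quotient is written as an integral, so that only one of the two mixed
  derivatives needs to be continuous and one-sided derivatives at the end points are covered.\<close>

lemma mixed_derivatives_eq:
  fixes G :: "real \<Rightarrow> real \<Rightarrow> 'c::euclidean_space"
  assumes Gb: "\<And>a b. a \<in> A \<Longrightarrow> b \<in> {0..1} \<Longrightarrow> (G a has_vector_derivative Gb a b) (at b within {0..1})"
    and Ga: "\<And>b. b \<in> {0..1} \<Longrightarrow> ((\<lambda>a. G a b) has_vector_derivative Ga b) (at a within A)"
    and Gba: "\<And>a b. a \<in> A \<Longrightarrow> b \<in> {0..1} \<Longrightarrow> ((\<lambda>a. Gb a b) has_vector_derivative Gba a b) (at a within A)"
    and c: "continuous_on (A \<times> {0..1}) (\<lambda>(a, b). Gba a b)"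
    and cb: "\<And>a. a \<in> A \<Longrightarrow> continuous_on {0..1} (Gb a)"
    and d: "(Ga has_vector_derivative d) (at 0 within {0..1})"
    and A: "convex A" "a \<in> A" "at a within A \<noteq> bot"
  shows "d = Gba a 0"
proof -
  have c1: "continuous_on {0..1} (Gba a)"
    using continuous_on_compose2[OF c, of "{0..1}" "Pair a"] A(2) by (simp add: image_subset_iff continuous_on_Pair)
  have eq: "Ga b - Ga 0 = integral {0..b} (Gba a)" if b: "b \<in> {0..1}" for b
  proof -
    have ftc: "integral {0..b} (Gb a') = G a' b - G a' 0" if "a' \<in> A" for a'
      using that b has_vector_derivative_within_subset[OF Gb[OF that], of _ "{0..b}"]
      by (intro integral_unique fundamental_theorem_of_calculus) auto
    have "((\<lambda>a. integral (cbox 0 b) (Gb a)) has_vector_derivative integral (cbox 0 b) (Gba a)) (at a within A)"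
    proof (rule leibniz_rule_vector_derivative)
      show "Gb x integrable_on cbox 0 b" if "x \<in> A" for x
        using that b continuous_on_subset[OF cb[OF that], of "{0..b}"] by (auto intro: integrable_continuous_real)
    qed (use A b Gba in \<open>auto intro: continuous_on_subset[OF c]\<close>)
    then have "((\<lambda>a. integral {0..b} (Gb a)) has_vector_derivative integral {0..b} (Gba a)) (at a within A)"
      by simp
    then have "((\<lambda>a. G a b - G a 0) has_vector_derivative integral {0..b} (Gba a)) (at a within A)"
      by (rule has_vector_derivative_transform[rotated 2]) (use A ftc in auto)
    moreover have "((\<lambda>a. G a b - G a 0) has_vector_derivative Ga b - Ga 0) (at a within A)"
      using Ga b by (intro has_vector_derivative_diff) auto
    ultimately show ?thesis using A(3)
      by (meson vector_derivative_unique_within)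
  qed
  have "((\<lambda>b. integral {0..b} (Gba a)) has_vector_derivative Gba a 0) (at 0 within {0..1})"
    by (rule integral_has_vector_derivative[OF c1]) auto
  then have "((\<lambda>b. Ga b - Ga 0) has_vector_derivative Gba a 0) (at 0 within {0..1})"
    by (rule has_vector_derivative_transform[rotated 2]) (use eq in auto)
  moreover have "((\<lambda>b. Ga b - Ga 0) has_vector_derivative d - 0) (at 0 within {0..1})"
    using d by (intro has_vector_derivative_diff has_vector_derivative_const)
  moreover have "at (0::real) within {0..1} \<noteq> bot"
    by (simp add: trivial_limit_within)
  ultimately show ?thesis
    using vector_derivative_unique_within by fastforce
qed

subsection \<open>Integration by parts\<close>

text \<open>A box instead of a ball because the rules for integrals with a parameter are stated for
  \<open>cbox\<close>. The integrands vanish outside a ball inside the cube, so the precise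
  \<open>k\<close> is immaterial once it is large.\<close>

definition cube :: "real \<Rightarrow> 'a::euclidean_space set" where
  "cube k = cbox (- (k *\<^sub>R One)) (k *\<^sub>R One)"

lemma mem_cube: "norm x \<le> k \<Longrightarrow> x \<in> cube k"
  unfolding cube_def mem_box
  by (auto simp: inner_simps abs_le_iff dest: order_trans[OF Basis_le_norm, of _ x k])

lemma integral_supported:
  fixes f :: "'a::euclidean_space \<Rightarrow> 'b::euclidean_space"
  assumes "\<And>x. x \<notin> S \<Longrightarrow> f x = 0"
  shows "integral S f = integral UNIV f"
proof -
  have "(\<lambda>x. if x \<in> S then f x else 0) = f" using assms by auto
  then show ?thesis using integral_restrict_UNIV[of S f] by simp
qed

lemma integral_cube_shift:
  fixes f :: "'a::euclidean_space \<Rightarrow> 'b::euclidean_space"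
  assumes "\<And>x. r < norm x \<Longrightarrow> f x = 0" "r + norm c \<le> k"
  shows "integral (cube k) (\<lambda>x. f (x + c)) = integral (cube k) f"
proof -
  have out: "r < norm x" if "x \<notin> cube k" "r \<le> k" for x :: 'a
    using mem_cube[of x k] that by force
  have "integral (cube k) (\<lambda>x. f (x + c)) = integral UNIV (\<lambda>x. f (x + c))"
  proof (rule integral_supported)
    fix x :: 'a assume "x \<notin> cube k"
    then have "k < norm x" using mem_cube[of x k] by force
    then have "r < norm (x + c)" using assms(2) norm_triangle_ineq4[of "x + c" c] by simp
    then show "f (x + c) = 0" by (rule assms(1))
  qed
  also have "\<dots> = integral (cbox (- (k *\<^sub>R One) - c) (k *\<^sub>R One - c)) (\<lambda>x. f (x + c))"
  proof (rule integral_supported[symmetric])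
    fix x :: 'a assume "x \<notin> cbox (- (k *\<^sub>R One) - c) (k *\<^sub>R One - c)"
    then have "x + c \<notin> cube k"
      unfolding cube_def mem_box by (auto simp: inner_simps algebra_simps)
    then show "f (x + c) = 0" using out[of "x + c"] assms norm_ge_zero[of c] by force
  qed
  also have "\<dots> = integral (cube k) f"
    unfolding cube_def by (rule integral_shift_cbox)
  finally show ?thesis .
qed

text \<open>\<open>Ck_on\<close> asserts that some derivative is continuous in each direction; on
  the whole space derivatives are unique, so the given \<open>f'\<close> is that one.\<close>

lemma derivative_continuous_of_C1:
  fixes f :: "'a::euclidean_space \<Rightarrow> 'b::real_normed_vector"
  assumes "Ck_on (Suc 0) UNIV f" "\<And>x. (f has_derivative f' x) (at x)"
  shows "continuous_on UNIV (\<lambda>x. f' x v)"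
proof -
  obtain g where g: "\<And>x. x \<in> UNIV \<Longrightarrow> (f has_derivative g x) (at x within UNIV)" "\<And>v. Ck_on 0 UNIV (\<lambda>x. g x v)"
    using assms(1) by (rule Ck_on_SucE) (rule that)
  have "f' x = g x" for x using has_derivative_unique[OF assms(2) g(1)[OF UNIV_I]] .
  then show ?thesis using g(2)[of v] by simp
qed

text \<open>Translation invariance: the integral of \<open>f (x + \<tau> *\<^sub>R v)\<close> does
  not depend on \<open>\<tau>\<close>, and its derivative at \<open>\<tau> = 0\<close> is the
  integral in question.\<close>

lemma integral_derivative_eq_0:
  fixes f :: "'a::euclidean_space \<Rightarrow> real"
  assumes C: "Ck_on (Suc 0) UNIV f" and d: "\<And>x. (f has_derivative f' x) (at x)"
    and s: "\<And>x. r < norm x \<Longrightarrow> f x = 0" and k: "r \<le> k"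
  shows "integral (cube k) (\<lambda>x. f' x v) = 0"
proof -
  have cont: "continuous_on UNIV (\<lambda>x. f' x v)" by (rule derivative_continuous_of_C1[OF C d])
  have contf: "continuous_on UNIV f" using C by (rule Ck_on_continuous)
  have s': "f' x v = 0" if "r < norm x" for x
  proof -
    have "open {x. r < norm (x::'a)}" by (intro open_Collect_less continuous_intros)
    then have "((\<lambda>x. 0) has_derivative f' x) (at x)"
      by (rule has_derivative_transform_within_open[OF d]) (use that s in auto)
    then show ?thesis using has_derivative_unique[of "\<lambda>x. 0" "f' x" x "\<lambda>v. 0"] by simp
  qed
  \<comment> \<open>This cube contains the supports of all translates with \<open>\<tau>\<close> in
    \<open>{0..1}\<close>.\<close>
  define m where "m = k + norm v"
  have fI: "(\<lambda>x. f (x + \<tau> *\<^sub>R v)) integrable_on cube m" for \<tau>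
    unfolding cube_def by (intro integrable_continuous continuous_on_compose2[OF contf] continuous_intros) auto
  have der: "((\<lambda>\<tau>. integral (cube m) (\<lambda>x. f (x + \<tau> *\<^sub>R v))) has_vector_derivative
      integral (cube m) (\<lambda>x. f' (x + 0 *\<^sub>R v) v)) (at 0 within {0..1})"
    unfolding cube_def
  proof (rule leibniz_rule_vector_derivative[of "{0..1}" _ _ "\<lambda>\<tau> x. f (x + \<tau> *\<^sub>R v)" "\<lambda>\<tau> x. f' (x + \<tau> *\<^sub>R v) v"])
    show "((\<lambda>\<tau>. f (x + \<tau> *\<^sub>R v)) has_vector_derivative f' (x + \<tau> *\<^sub>R v) v) (at \<tau> within {0..1})" for x \<tau>
    proof -
      have "((\<lambda>\<tau>. f (x + \<tau> *\<^sub>R v)) has_derivative (\<lambda>h. f' (x + \<tau> *\<^sub>R v) (h *\<^sub>R v))) (at \<tau> within {0..1})"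
        by (rule has_derivative_compose[of "\<lambda>\<tau>. x + \<tau> *\<^sub>R v" "\<lambda>h. h *\<^sub>R v", OF _ d]) (auto intro!: derivative_eq_intros)
      then show ?thesis
        unfolding has_vector_derivative_def by (simp add: linear_cmul[OF has_derivative_linear[OF d]])
    qed
    show "continuous_on ({0..1} \<times> cbox (- (m *\<^sub>R One)) (m *\<^sub>R One)) (\<lambda>(\<tau>, x). f' (x + \<tau> *\<^sub>R v) v)"
      unfolding split_beta' by (intro continuous_on_compose2[OF cont] continuous_intros) auto
  qed (use fI in \<open>auto simp: cube_def\<close>)
  have "integral (cube m) (\<lambda>x. f (x + \<tau> *\<^sub>R v)) = integral (cube m) f" if "\<tau> \<in> {0..1}" for \<tau>
  proof (rule integral_cube_shift[OF s])
    have "norm (\<tau> *\<^sub>R v) \<le> norm v" using that mult_right_mono[of "\<bar>\<tau>\<bar>" 1 "norm v"] by simp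
    then show "r + norm (\<tau> *\<^sub>R v) \<le> m" using k by (simp add: m_def)
  qed
  then have "((\<lambda>\<tau>. integral (cube m) (\<lambda>x. f (x + \<tau> *\<^sub>R v))) has_vector_derivative 0) (at 0 within {0..1})"
    by (intro has_vector_derivative_transform[OF _ _ has_vector_derivative_const]) auto
  moreover have "at (0::real) within {0..1} \<noteq> bot" by (simp add: trivial_limit_within)
  ultimately have "integral (cube m) (\<lambda>x. f' x v) = 0"
    using vector_derivative_unique_within[OF _ der] by auto
  moreover have "integral (cube l) (\<lambda>x. f' x v) = integral UNIV (\<lambda>x. f' x v)" if "r \<le> l" for l
  proof (rule integral_supported)
    fix x :: 'a assume "x \<notin> cube l"
    then show "f' x v = 0" using mem_cube[of x l] that s'[of x] by linarith
  qed
  moreover have "r \<le> m" unfolding m_def using k norm_ge_zero[of v] by linarith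
  ultimately show ?thesis using k by metis
qed

lemma integral_divergence_eq_0:
  fixes W :: "real ^ 'n::finite \<Rightarrow> real ^ 'n"
  assumes C: "Ck_on (Suc 0) UNIV W" and d: "\<And>x. (W has_derivative W' x) (at x)"
    and s: "\<And>x. r < norm x \<Longrightarrow> W x = 0" and k: "r \<le> k"
  shows "integral (cube k) (\<lambda>x. \<Sum>i\<in>UNIV. W' x (axis i 1) $ i) = 0"
proof -
  have dn: "((\<lambda>x. W x $ i) has_derivative (\<lambda>v. W' x v $ i)) (at x)" for i x
    by (rule bounded_linear.has_derivative[OF bounded_linear_vec_nth d])
  have c: "continuous_on UNIV (\<lambda>x. W' x v $ i)" for v i
    by (rule derivative_continuous_of_C1[OF Ck_on_nth[OF C] dn])
  have "integral (cube k) (\<lambda>x. \<Sum>i\<in>UNIV. W' x (axis i 1) $ i) = (\<Sum>i\<in>UNIV. integral (cube k) (\<lambda>x. W' x (axis i 1) $ i))"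
    unfolding cube_def by (intro Henstock_Kurzweil_Integration.integral_sum integrable_continuous continuous_on_subset[OF c]) auto
  also have "\<dots> = (\<Sum>i\<in>(UNIV :: 'n set). 0)"
  proof (rule sum.cong[OF refl])
    fix i :: 'n
    show "integral (cube k) (\<lambda>x. W' x (axis i 1) $ i) = 0"
      by (rule integral_derivative_eq_0[of "\<lambda>x. W x $ i" "\<lambda>x v. W' x v $ i", OF Ck_on_nth[OF C] dn _ k]) (simp add: s)
  qed
  finally show ?thesis by simp
qed

text \<open>The Leibniz rule followed by the fundamental theorem of calculus. \<open>D\<close> is
  given only as a pointwise derivative; uniqueness identifies it with the joint derivative in the
  direction \<open>(1, 0)\<close>, from which its continuity follows.\<close>

lemma integral_param_ftc:
  fixes \<Psi> :: "real \<Rightarrow> 'p::euclidean_space \<Rightarrow> real"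
  assumes C: "Ck_on (Suc 0) ({0..1} \<times> cbox a b) (\<lambda>q. \<Psi> (fst q) (snd q))"
    and D: "\<And>\<tau> x. \<tau> \<in> {0..1} \<Longrightarrow> x \<in> cbox a b \<Longrightarrow> ((\<lambda>\<tau>. \<Psi> \<tau> x) has_vector_derivative D \<tau> x) (at \<tau> within {0..1})"
  shows "((\<lambda>\<tau>. integral (cbox a b) (D \<tau>)) has_integral (integral (cbox a b) (\<Psi> 1) - integral (cbox a b) (\<Psi> 0))) {0..1}"
    and "continuous_on ({0..1} \<times> cbox a b) (\<lambda>q. D (fst q) (snd q))"
proof -
  obtain f' where f: "\<And>q. q \<in> {0..1} \<times> cbox a b \<Longrightarrow> ((\<lambda>q. \<Psi> (fst q) (snd q)) has_derivative f' q) (at q within {0..1} \<times> cbox a b)"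
    "\<And>v. Ck_on 0 ({0..1} \<times> cbox a b) (\<lambda>q. f' q v)"
    using C by (rule Ck_on_SucE) (rule that)
  have nb: "at \<tau> within {0..1::real} \<noteq> bot" if "\<tau> \<in> {0..1}" for \<tau>
    using that by (simp add: trivial_limit_within islimpt_Icc)
  have eq: "f' q (1, 0) = D (fst q) (snd q)" if q: "q \<in> {0..1} \<times> cbox a b" for q
  proof -
    have "((\<lambda>\<tau>. \<Psi> (fst (\<tau>, snd q)) (snd (\<tau>, snd q))) has_derivative (\<lambda>v. f' q (v, 0))) (at (fst q) within {0..1})"
      by (rule has_derivative_partial[where P = "cbox a b"]) (use q f(1)[OF q] in auto)
    moreover have "f' q (v, 0) = v *\<^sub>R f' q (1, 0)" for v
      using linear_cmul[OF has_derivative_linear[OF f(1)[OF q]], of v "(1, 0)"] by simp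
    then have "(\<lambda>v. f' q (v, 0)) = (\<lambda>v. v *\<^sub>R f' q (1, 0))" by (rule ext)
    ultimately have "((\<lambda>\<tau>. \<Psi> \<tau> (snd q)) has_vector_derivative f' q (1, 0)) (at (fst q) within {0..1})"
      unfolding has_vector_derivative_def by simp
    then show ?thesis
      using vector_derivative_unique_within[OF nb _ D] q by auto
  qed
  show cD: "continuous_on ({0..1} \<times> cbox a b) (\<lambda>q. D (fst q) (snd q))"
    using f(2)[of "(1, 0)"] eq by (simp cong: continuous_on_cong)
  have cP: "continuous_on ({0..1} \<times> cbox a b) (\<lambda>q. \<Psi> (fst q) (snd q))"
    using C by (rule Ck_on_continuous)
  have "((\<lambda>\<tau>. integral (cbox a b) (\<Psi> \<tau>)) has_vector_derivative integral (cbox a b) (D \<tau>)) (at \<tau> within {0..1})"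
    if "\<tau> \<in> {0..1}" for \<tau>
  proof (rule leibniz_rule_vector_derivative[OF D])
    show "\<Psi> x integrable_on cbox a b" if "x \<in> {0..1}" for x
      using continuous_on_compose2[OF cP, of "cbox a b" "\<lambda>p. (x, p)"] that
      by (intro integrable_continuous) (simp add: image_subset_iff continuous_on_Pair)
  qed (use that cD in \<open>auto simp: split_beta'\<close>)
  then show "((\<lambda>\<tau>. integral (cbox a b) (D \<tau>)) has_integral (integral (cbox a b) (\<Psi> 1) - integral (cbox a b) (\<Psi> 0))) {0..1}"
    by (intro fundamental_theorem_of_calculus) auto
qed

subsection \<open>Cofactors and the Piola identity\<close>

definition set_row :: "'n \<Rightarrow> real ^ 'n \<Rightarrow> real ^ 'n ^ 'n \<Rightarrow> real ^ 'n ^ 'n::finite" where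
  "set_row k v A = (\<chi> i. if i = k then v else A $ i)"

text \<open>The cofactor without minors and signs: with a unit vector as row \<open>k\<close>, the
  Laplace expansion becomes linearity of \<open>det\<close> in that row.\<close>

definition cof :: "real ^ 'n ^ 'n \<Rightarrow> 'n::finite \<Rightarrow> 'n \<Rightarrow> real" where
  "cof A k j = det (set_row k (axis j 1) A)"

lemma det_set_row: "det (set_row k v A) = (\<Sum>j\<in>UNIV. v $ j * cof A k j)"
proof -
  have "v = (\<Sum>j\<in>UNIV. v $ j *s axis j 1)" by (rule basis_expansion[symmetric])
  then have "set_row k v A = set_row k (\<Sum>j\<in>UNIV. v $ j *s axis j 1) A" by (rule arg_cong)
  then have "det (set_row k v A) = det (\<chi> i. if i = k then (\<Sum>j\<in>UNIV. v $ j *s axis j 1) else A $ i)"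
    unfolding set_row_def by (rule arg_cong)
  also have "\<dots> = (\<Sum>j\<in>UNIV. det (\<chi> i. if i = k then v $ j *s axis j 1 else A $ i))"
    by (rule det_linear_row_sum[of UNIV k "\<lambda>i j. v $ j *s axis j 1" "\<lambda>i. A $ i"]) simp
  also have "\<dots> = (\<Sum>j\<in>UNIV. v $ j * cof A k j)"
    by (simp add: det_row_mul cof_def set_row_def)
  finally show ?thesis .
qed

text \<open>The sum is the determinant of \<open>A\<close> with row \<open>k\<close> replaced by row
  \<open>m\<close>, which has two equal rows unless \<open>m = k\<close>.\<close>

lemma sum_row_cof: "(\<Sum>j\<in>UNIV. A $ m $ j * cof A k j) = (if m = k then det A else 0)"
proof -
  have "(\<Sum>j\<in>UNIV. A $ m $ j * cof A k j) = det (set_row k (A $ m) A)" by (rule det_set_row[symmetric])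
  also have "\<dots> = (if m = k then det A else 0)"
  proof (cases "m = k")
    case True
    then have "set_row k (A $ m) A = A" by (simp add: set_row_def vec_eq_iff)
    then show ?thesis using True by simp
  next
    case False
    then have "row m (set_row k (A $ m) A) = row k (set_row k (A $ m) A)"
      by (simp add: row_def set_row_def)
    then show ?thesis using False det_identical_rows by auto
  qed
  finally show ?thesis .
qed

text \<open>Both matrices differ by an interchange of rows \<open>i\<close> and \<open>k\<close>. In
  \<open>piola\<close> this antisymmetry meets the symmetry of second derivatives.\<close>

lemma det_set_row_swap:
  assumes "i \<noteq> k"
  shows "det (set_row i v (set_row k w A)) = - det (set_row i w (set_row k v A))"
proof -
  let ?p = "Transposition.transpose i k"
  have "det (\<chi> r. set_row i w (set_row k v A) $ ?p r) = of_int (sign ?p) * det (set_row i w (set_row k v A))"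
    by (rule det_permute_rows) (rule permutes_swap_id, auto)
  moreover have "(\<chi> r. set_row i w (set_row k v A) $ ?p r) = set_row i v (set_row k w A)"
    using assms by (auto simp: vec_eq_iff set_row_def Transposition.transpose_def)
  ultimately show ?thesis using assms by (simp add: sign_swap_id)
qed

text \<open>Jacobi's formula by rows: the product rule in the expansion over permutations
  differentiates one row at a time.\<close>

lemma has_derivative_det:
  assumes "\<And>i j. ((\<lambda>x. A x $ i $ j) has_derivative (\<lambda>v. A' v $ i $ j)) (at x within S)"
  shows "((\<lambda>x. det (A x :: real ^ 'n ^ 'n::finite)) has_derivative (\<lambda>v. \<Sum>i\<in>UNIV. det (set_row i (A' v $ i) (A x)))) (at x within S)"
proof -
  have "((\<lambda>x. det (A x)) has_derivative
    (\<lambda>v. \<Sum>p\<in>{p. p permutes UNIV}. of_int (sign p) * (\<Sum>i\<in>UNIV. A' v $ i $ p i * (\<Prod>j\<in>UNIV - {i}. A x $ j $ p j)))) (at x within S)"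
    unfolding det_def
    by (intro has_derivative_sum has_derivative_mult_right has_derivative_prod assms)
  moreover have "(\<Sum>p\<in>{p. p permutes UNIV}. of_int (sign p) * (\<Sum>i\<in>UNIV. A' v $ i $ p i * (\<Prod>j\<in>UNIV - {i}. A x $ j $ p j)))
    = (\<Sum>i\<in>UNIV. det (set_row i (A' v $ i) (A x)))" for v
  proof -
    have "A' v $ i $ p i * (\<Prod>j\<in>UNIV - {i}. A x $ j $ p j) = (\<Prod>j\<in>UNIV. set_row i (A' v $ i) (A x) $ j $ p j)" for i p
      by (subst prod.remove[of UNIV i]) (auto simp: set_row_def intro!: prod.cong)
    then show ?thesis
      unfolding det_def sum_distrib_left by (subst sum.swap) simp
  qed
  ultimately show ?thesis by simp
qed

lemma Ck_on_det:
  assumes "\<And>i j. Ck_on k S (\<lambda>x. A x $ i $ j)"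
  shows "Ck_on k S (\<lambda>x. det (A x :: real ^ 'n ^ 'n::finite))"
  unfolding det_def by (intro Ck_on_sum Ck_on_mult Ck_on_prod Ck_on_const assms)

lemma Ck_on_cof:
  assumes "\<And>i j. Ck_on k S (\<lambda>x. A x $ i $ j)"
  shows "Ck_on k S (\<lambda>x. cof (A x :: real ^ 'n ^ 'n::finite) l m)"
  unfolding cof_def
proof (rule Ck_on_det)
  fix i j
  show "Ck_on k S (\<lambda>x. set_row l (axis m 1) (A x) $ i $ j)"
    by (cases "i = l") (auto simp: set_row_def intro: assms Ck_on_const)
qed

lemma sum_antisym_eq_0:
  fixes c d :: "'i \<Rightarrow> 'i \<Rightarrow> real"
  assumes "\<And>i j. c i j = c j i" "\<And>i j. d i j = - d j i"
  shows "(\<Sum>i\<in>A. \<Sum>j\<in>A. c i j * d i j) = 0"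
proof -
  have "(\<Sum>i\<in>A. \<Sum>j\<in>A. c i j * d i j) = (\<Sum>j\<in>A. \<Sum>i\<in>A. c i j * d i j)" by (rule sum.swap)
  also have "\<dots> = (\<Sum>j\<in>A. \<Sum>i\<in>A. - (c j i * d j i))"
    using assms by (intro sum.cong refl) (metis mult_minus_right)
  finally show ?thesis by (simp add: sum_negf)
qed

subsection \<open>Deformations close to the identity\<close>

text \<open>The bound 1/4 makes \<open>g x - x\<close> a contraction; therefore \<open>g\<close> is
  bijective, \<open>det (G x)\<close> is nonzero and distances change by factors between 3/4 and
  5/4. \<open>dG\<close> is a parameter so that the symmetry of second derivatives can be stated in
  coordinates. The assumptions persist under interpolation with the identity and under rescaling,
  and both are used.\<close>

locale near_identity =
  fixes g :: "real ^ 'n::finite \<Rightarrow> real ^ 'n" and G :: "real ^ 'n \<Rightarrow> real ^ 'n ^ 'n"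
    and dG :: "real ^ 'n \<Rightarrow> 'n \<Rightarrow> 'n \<Rightarrow> real ^ 'n \<Rightarrow> real"
  assumes g0: "g 0 = 0"
    and der: "\<And>x. (g has_derivative (\<lambda>v. G x *v v)) (at x)"
    and derG: "\<And>x i j. ((\<lambda>x. G x $ i $ j) has_derivative dG x i j) (at x)"
    and dG_sym: "\<And>x i j k. dG x i j (axis k 1) = dG x i k (axis j 1)"
    and C1_g: "Ck_on (Suc 0) UNIV g"
    and C1_G: "\<And>i j. Ck_on (Suc 0) UNIV (\<lambda>x. G x $ i $ j)"
    and near: "\<And>x v. norm (G x *v v - v) \<le> norm v / 4"
begin

lemma C1_cof: "Ck_on (Suc 0) UNIV (\<lambda>x. cof (G x) i j)"
  by (rule Ck_on_cof[OF C1_G])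

text \<open>The derivative of \<open>cof (G x) k j\<close>. Row \<open>k\<close> of the matrix under
  \<open>det\<close> is the constant \<open>axis j 1\<close>, so only the other rows
  contribute.\<close>

definition dcof :: "real ^ 'n \<Rightarrow> 'n \<Rightarrow> 'n \<Rightarrow> real ^ 'n \<Rightarrow> real" where
  "dcof x k j v = (\<Sum>i\<in>UNIV - {k}. det (set_row i (\<chi> m. dG x i m v) (set_row k (axis j 1) (G x))))"

lemma det_zero_row_set: "det (set_row k 0 (A :: real ^ 'n ^ 'n)) = 0"
  by (simp add: det_set_row)

lemma has_derivative_cof: "((\<lambda>x. cof (G x) k j) has_derivative dcof x k j) (at x)"
proof -
  let ?A' = "\<lambda>v. \<chi> i m. if i = k then 0 else dG x i m v"
  have "((\<lambda>x. det (set_row k (axis j 1) (G x))) has_derivative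
      (\<lambda>v. \<Sum>i\<in>UNIV. det (set_row i (?A' v $ i) (set_row k (axis j 1) (G x))))) (at x)"
  proof (rule has_derivative_det)
    show "((\<lambda>x. set_row k (axis j 1) (G x) $ i $ m) has_derivative (\<lambda>v. ?A' v $ i $ m)) (at x)" for i m
      using derG[of i m x] by (cases "i = k") (auto simp: set_row_def)
  qed
  moreover have "(\<Sum>i\<in>UNIV. det (set_row i (?A' v $ i) (set_row k (axis j 1) (G x)))) = dcof x k j v" for v
  proof -
    have z: "?A' v $ k = 0" by (simp add: vec_eq_iff)
    have "?A' v $ i = (\<chi> m. dG x i m v)" if "i \<noteq> k" for i using that by (simp add: vec_eq_iff)
    then show ?thesis unfolding dcof_def
      by (subst sum.remove[of UNIV k]) (auto simp: z det_zero_row_set[unfolded zero_vec_def])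
  qed
  ultimately show ?thesis by (simp add: cof_def)
qed

text \<open>For each row \<open>i \<noteq> k\<close> the double sum over \<open>j\<close> and
  \<open>m\<close> pairs the second derivative of component \<open>i\<close>, symmetric in
  \<open>j\<close> and \<open>m\<close>, with a determinant that is antisymmetric in them.\<close>

lemma piola: "(\<Sum>j\<in>UNIV. dcof x k j (axis j 1)) = 0"
proof -
  have "(\<Sum>j\<in>UNIV. dcof x k j (axis j 1)) =
      (\<Sum>i\<in>UNIV - {k}. \<Sum>j\<in>UNIV. \<Sum>m\<in>UNIV. dG x i m (axis j 1) * det (set_row i (axis m 1) (set_row k (axis j 1) (G x))))"
    unfolding dcof_def by (subst sum.swap) (simp add: det_set_row[where v = "\<chi> m. dG x i m v" for i v] cof_def)
  also have "\<dots> = 0"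
  proof (rule sum.neutral, rule ballI)
    fix i assume "i \<in> UNIV - {k}"
    then have "i \<noteq> k" by simp
    then show "(\<Sum>j\<in>UNIV. \<Sum>m\<in>UNIV. dG x i m (axis j 1) * det (set_row i (axis m 1) (set_row k (axis j 1) (G x)))) = 0"
      by (intro sum_antisym_eq_0 dG_sym det_set_row_swap)
  qed
  finally show ?thesis .
qed

lemma displacement_lipschitz: "norm ((g x - x) - (g z - z)) \<le> norm (x - z) / 4"
proof -
  have "norm ((g x - x) - (g z - z)) \<le> 1 / 4 * norm (x - z)"
  proof (rule differentiable_bound[where S = UNIV and f = "\<lambda>x. g x - x" and f' = "\<lambda>x v. G x *v v - v"])
    show "((\<lambda>x. g x - x) has_derivative (\<lambda>v. G x *v v - v)) (at x within UNIV)" for x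
      by (intro has_derivative_diff der has_derivative_ident)
    show "onorm (\<lambda>v. G x *v v - v) \<le> 1 / 4" for x
      by (rule onorm_le) (use near[of x] in simp)
  qed auto
  then show ?thesis by simp
qed

lemma expand_bounds: "3 / 4 * norm (x - z) \<le> norm (g x - g z)" "norm (g x - g z) \<le> 5 / 4 * norm (x - z)"
proof -
  have e: "g x - g z = (x - z) + ((g x - x) - (g z - z))" by simp
  have "norm (x - z) - norm ((g x - x) - (g z - z)) \<le> norm (g x - g z)"
    unfolding e by (rule norm_diff_ineq)
  then show "3 / 4 * norm (x - z) \<le> norm (g x - g z)" using displacement_lipschitz[of x z] by linarith
  have "norm (g x - g z) \<le> norm (x - z) + norm ((g x - x) - (g z - z))"
    unfolding e by (rule norm_triangle_ineq)
  then show "norm (g x - g z) \<le> 5 / 4 * norm (x - z)" using displacement_lipschitz[of x z] by linarith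
qed

text \<open>Expand the columns of \<open>G x\<close> in the basis; \<open>sum_row_cof\<close> leaves
  only the direction \<open>i\<close>. With \<open>L\<close> a derivative at \<open>g x\<close>,
  this turns a divergence in \<open>x\<close> into one in the coordinates
  \<open>g x\<close>.\<close>

lemma sum_derivative_cof:
  fixes L :: "real ^ 'n \<Rightarrow> real"
  assumes L: "linear L"
  shows "(\<Sum>j\<in>UNIV. L (G x *v axis j 1) * cof (G x) i j) = L (axis i 1) * det (G x)"
proof -
  have col: "G x *v axis j 1 = (\<Sum>m\<in>UNIV. G x $ m $ j *\<^sub>R axis m 1)" for j
    unfolding matrix_vector_mult_basis by (simp add: vec_eq_iff column_def axis_def if_distrib cong: if_cong)
  have "(\<Sum>j\<in>UNIV. L (G x *v axis j 1) * cof (G x) i j)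
      = (\<Sum>j\<in>UNIV. \<Sum>m\<in>UNIV. L (axis m 1) * (G x $ m $ j * cof (G x) i j))"
    unfolding col by (simp add: linear_sum[OF L] linear_cmul[OF L] sum_distrib_left sum_distrib_right mult_ac)
  also have "\<dots> = (\<Sum>m\<in>UNIV. L (axis m 1) * (\<Sum>j\<in>UNIV. G x $ m $ j * cof (G x) i j))"
    by (subst sum.swap) (simp add: sum_distrib_left)
  also have "\<dots> = L (axis i 1) * det (G x)"
    by (simp add: sum_row_cof if_distrib cong: if_cong)
  finally show ?thesis .
qed

text \<open>By the Piola identity the following divergence is the \<open>\<tau>\<close>-derivative of \<open>f (g\<^sub>\<tau> x) det G\<^sub>\<tau>\<close> along a
  family of deformations with velocity \<open>u\<close>.\<close>

lemma integral_transport_eq_0: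
  fixes f :: "real ^ 'n \<Rightarrow> real" and u :: "real ^ 'n \<Rightarrow> real ^ 'n"
  assumes f: "Ck_on (Suc 0) UNIV f" "\<And>x. (f has_derivative f' x) (at x)" "\<And>x. r < norm x \<Longrightarrow> f x = 0"
    and u: "Ck_on (Suc 0) UNIV u" "\<And>x. (u has_derivative (\<lambda>v. U x *v v)) (at x)"
    and k: "4 / 3 * r \<le> k"
  shows "integral (cube k) (\<lambda>x. f' (g x) (u x) * det (G x) + f (g x) * (\<Sum>i\<in>UNIV. det (set_row i (U x $ i) (G x)))) = 0"
proof -
  \<comment> \<open>\<open>?c\<close> is the Piola transform of the velocity \<open>u\<close>; in
    the divergence of \<open>?W\<close> the derivatives of the cofactors sum to zero.\<close>
  let ?c = "\<lambda>x. \<chi> j. \<Sum>i\<in>UNIV. cof (G x) i j * u x $ i"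
  let ?W = "\<lambda>x. f (g x) *\<^sub>R ?c x"
  let ?c' = "\<lambda>x v. \<chi> j. \<Sum>i\<in>UNIV. cof (G x) i j * (U x *v v) $ i + dcof x i j v * u x $ i"
  let ?W' = "\<lambda>x v. f (g x) *\<^sub>R ?c' x v + f' (g x) (G x *v v) *\<^sub>R ?c x"
  have Cg: "Ck_on (Suc 0) UNIV (\<lambda>x. f (g x))"
    by (rule Ck_on_compose[OF f(1) C1_g]) simp
  have CW: "Ck_on (Suc 0) UNIV ?W"
    by (intro Ck_on_scaleR Cg Ck_on_vec)
       (auto simp del: Ck_on.simps intro!: Ck_on_sum Ck_on_mult C1_cof Ck_on_nth u)
  have dc: "(?c has_derivative ?c' x) (at x)" for x
  proof (subst has_derivative_componentwise_within, rule ballI)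
    fix b :: "real ^ 'n" assume "b \<in> Basis"
    then obtain j where b: "b = axis j 1" by (auto simp: Basis_vec_def)
    have "((\<lambda>x. \<Sum>i\<in>UNIV. cof (G x) i j * u x $ i) has_derivative (\<lambda>v. \<Sum>i\<in>UNIV. cof (G x) i j * (U x *v v) $ i + dcof x i j v * u x $ i)) (at x)"
      by (intro has_derivative_sum has_derivative_mult has_derivative_cof bounded_linear.has_derivative[OF bounded_linear_vec_nth u(2)])
    then show "((\<lambda>x. ?c x \<bullet> b) has_derivative (\<lambda>v. ?c' x v \<bullet> b)) (at x)"
      by (simp add: b inner_axis)
  qed
  have dW: "(?W has_derivative ?W' x) (at x)" for x
    by (rule has_derivative_scaleR[OF has_derivative_compose[OF der f(2)] dc])
  \<comment> \<open>The lower bound 3/4 of \<open>expand_bounds\<close> turns radius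
    \<open>r\<close> for \<open>f\<close> into radius \<open>4 / 3 * r\<close> for
    \<open>f (g x)\<close>.\<close>
  have sW: "?W x = 0" if "4 / 3 * r < norm x" for x
  proof -
    have "r < norm (g x)" using expand_bounds(1)[of x 0] that g0 by simp
    then show ?thesis using f(3) by simp
  qed
  have "(\<Sum>j\<in>UNIV. ?W' x (axis j 1) $ j) = f' (g x) (u x) * det (G x) + f (g x) * (\<Sum>i\<in>UNIV. det (set_row i (U x $ i) (G x)))" for x
  proof -
    have lf: "linear (f' (g x))" using f(2) has_derivative_linear by blast
    note 1 = sum_derivative_cof[OF lf]
    have 2: "(\<Sum>j\<in>UNIV. f' (g x) (G x *v axis j 1) * ?c x $ j) = f' (g x) (u x) * det (G x)"
    proof -
      have "(\<Sum>j\<in>UNIV. f' (g x) (G x *v axis j 1) * ?c x $ j)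
          = (\<Sum>i\<in>UNIV. u x $ i * (\<Sum>j\<in>UNIV. f' (g x) (G x *v axis j 1) * cof (G x) i j))"
        by (simp add: sum_distrib_left mult_ac) (rule sum.swap)
      also have "\<dots> = (\<Sum>i\<in>UNIV. u x $ i * f' (g x) (axis i 1)) * det (G x)"
        unfolding 1 by (simp add: sum_distrib_left sum_distrib_right mult_ac)
      also have "(\<Sum>i\<in>UNIV. u x $ i * f' (g x) (axis i 1)) = f' (g x) (\<Sum>i\<in>UNIV. u x $ i *\<^sub>R axis i 1)"
        by (simp add: linear_sum[OF lf] linear_cmul[OF lf])
      also have "(\<Sum>i\<in>UNIV. u x $ i *\<^sub>R axis i 1) = u x"
        using basis_expansion[of "u x"] by (simp add: scalar_mult_eq_scaleR)
      finally show ?thesis .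
    qed
    have 3: "(\<Sum>j\<in>UNIV. ?c' x (axis j 1) $ j) = (\<Sum>i\<in>UNIV. det (set_row i (U x $ i) (G x)))"
    proof -
      have "(\<Sum>j\<in>UNIV. ?c' x (axis j 1) $ j)
          = (\<Sum>i\<in>UNIV. (\<Sum>j\<in>UNIV. cof (G x) i j * (U x *v axis j 1) $ i) + (\<Sum>j\<in>UNIV. dcof x i j (axis j 1)) * u x $ i)"
        by (simp add: sum.distrib sum_distrib_right) (subst sum.swap, subst (2) sum.swap, simp)
      also have "\<dots> = (\<Sum>i\<in>UNIV. \<Sum>j\<in>UNIV. U x $ i $ j * cof (G x) i j)"
        by (simp add: piola matrix_vector_mult_basis column_def mult_ac)
      finally show ?thesis by (simp add: det_set_row)
    qed
    have "(\<Sum>j\<in>UNIV. ?W' x (axis j 1) $ j) = f (g x) * (\<Sum>j\<in>UNIV. ?c' x (axis j 1) $ j) + (\<Sum>j\<in>UNIV. f' (g x) (G x *v axis j 1) * ?c x $ j)"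
      by (simp only: vector_add_component vector_scaleR_component sum.distrib sum_distrib_left[symmetric] real_scaleR_def)
    then show ?thesis unfolding 2 3 by simp
  qed
  then show ?thesis using integral_divergence_eq_0[OF CW dW sW k] by simp
qed

end

section \<open>Change of variables and inverse for maps near the identity\<close>

lemma Ck_on_compose_UNIV:
  fixes f :: "'a::real_normed_vector \<Rightarrow> 'b::euclidean_space"
  shows "Ck_on k UNIV g \<Longrightarrow> Ck_on k S f \<Longrightarrow> Ck_on k S (\<lambda>x. g (f x))"
  by (rule Ck_on_compose[where T = UNIV]) auto

text \<open>The \<open>m\<close>-th derivative of the reciprocal.\<close>

definition inverse_tower :: "nat \<Rightarrow> real \<Rightarrow> real" where
  "inverse_tower m x = (- 1) ^ m * fact m / x ^ Suc m"

lemma inverse_tower_derivative: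
  assumes "x \<noteq> 0"
  shows "(inverse_tower m has_real_derivative inverse_tower (Suc m) x) (at x within S)"
proof -
  have "((\<lambda>x. (- 1) ^ m * fact m * inverse (x ^ Suc m)) has_real_derivative
      (- 1) ^ m * fact m * (- (inverse (x ^ Suc m) * (real (Suc m) * x ^ m) * inverse (x ^ Suc m)))) (at x within S)"
    using assms by (auto intro!: derivative_eq_intros simp del: power_Suc)
  moreover have "(- 1) ^ m * fact m * (- (inverse (x ^ Suc m) * (real (Suc m) * x ^ m) * inverse (x ^ Suc m))) = inverse_tower (Suc m) x"
    using assms by (simp add: inverse_tower_def field_simps)
  moreover have "(\<lambda>x. (- 1) ^ m * fact m * inverse (x ^ Suc m)) = inverse_tower m"
    by (simp add: inverse_tower_def fun_eq_iff divide_inverse)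
  ultimately show ?thesis by simp
qed

lemma inverse_tower_0: "inverse_tower 0 x = 1 / x"
  by (simp add: inverse_tower_def)

lemma Ck_on_divide:
  fixes f h :: "'a::real_normed_vector \<Rightarrow> real"
  assumes "Ck_on k S f" "Ck_on k S h" "\<And>x. x \<in> S \<Longrightarrow> h x \<noteq> 0"
  shows "Ck_on k S (\<lambda>x. f x / h x)"
proof -
  have "Ck_on k {x. x \<noteq> 0} (inverse_tower 0)"
    by (rule Ck_on_tower) (simp add: inverse_tower_derivative)
  then have "Ck_on k S (\<lambda>x. inverse_tower 0 (h x))"
    by (rule Ck_on_compose[OF _ assms(2)]) (use assms(3) in auto)
  from Ck_on_mult[OF assms(1) this] show ?thesis by (simp add: inverse_tower_0)
qed

lemma matrix_inverse_cof:
  fixes A :: "real ^ 'n ^ 'n::finite"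
  assumes "det A \<noteq> 0"
  shows "A ** (\<chi> j i. cof A i j / det A) = mat 1" "(\<chi> j i. cof A i j / det A) ** A = mat 1"
proof -
  have "(A ** (\<chi> j i. cof A i j / det A)) $ m $ k = (mat 1 :: real ^ 'n ^ 'n) $ m $ k" for m k
  proof -
    have "(A ** (\<chi> j i. cof A i j / det A)) $ m $ k = (\<Sum>j\<in>UNIV. A $ m $ j * cof A k j) / det A"
      by (simp add: matrix_matrix_mult_def sum_divide_distrib)
    then show ?thesis using assms by (simp add: sum_row_cof mat_def)
  qed
  then show "A ** (\<chi> j i. cof A i j / det A) = mat 1" by (simp add: vec_eq_iff)
  then show "(\<chi> j i. cof A i j / det A) ** A = mat 1" by (simp add: matrix_left_right_inverse)
qed

context near_identity
begin

lemma det_nonzero: "det (G x) \<noteq> 0"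
proof -
  have "v = 0" if "G x *v v = 0" for v
    using near[of x v] that by simp
  then have "\<exists>B. B ** G x = mat 1"
    by (simp add: matrix_left_invertible_ker)
  then show ?thesis
    by (metis invertible_det_nz invertible_left_inverse)
qed

text \<open>The identity satisfies all assumptions of the locale, and they survive convex
  combinations.\<close>

lemma interpolation:
  assumes t: "0 \<le> \<tau>" "\<tau> \<le> 1"
  shows "near_identity (\<lambda>x. x + \<tau> *\<^sub>R (g x - x)) (\<lambda>x. mat 1 + \<tau> *\<^sub>R (G x - mat 1)) (\<lambda>x i j v. \<tau> * dG x i j v)"
proof
  show "0 + \<tau> *\<^sub>R (g 0 - 0) = 0" by (simp add: g0)
  have mv: "(mat 1 + \<tau> *\<^sub>R (G x - mat 1)) *v v = v + \<tau> *\<^sub>R (G x *v v - v)" for x v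
    by (simp add: matrix_vector_mult_add_rdistrib matrix_vector_mult_diff_rdistrib scaleR_matrix_vector_assoc[symmetric])
  show "((\<lambda>x. x + \<tau> *\<^sub>R (g x - x)) has_derivative (*v) (mat 1 + \<tau> *\<^sub>R (G x - mat 1))) (at x)" for x
    unfolding mv[abs_def] by (intro has_derivative_add has_derivative_scaleR_right has_derivative_diff has_derivative_ident der)
  show "((\<lambda>x. (mat 1 + \<tau> *\<^sub>R (G x - mat 1)) $ i $ j) has_derivative (\<lambda>v. \<tau> * dG x i j v)) (at x)" for x i j
    using derG[of i j x] by (auto intro!: derivative_eq_intros)
  show "\<tau> * dG x i j (axis k 1) = \<tau> * dG x i k (axis j 1)" for x i j k
    using dG_sym by simp
  show "Ck_on (Suc 0) UNIV (\<lambda>x. x + \<tau> *\<^sub>R (g x - x))"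
    by (intro Ck_on_add Ck_on_scaleR Ck_on_const Ck_on_diff C1_g Ck_on_ident)
  show "Ck_on (Suc 0) UNIV (\<lambda>x. (mat 1 + \<tau> *\<^sub>R (G x - mat 1)) $ i $ j)" for i j
    unfolding vector_add_component vector_scaleR_component vector_minus_component real_scaleR_def
    by (intro Ck_on_add Ck_on_mult Ck_on_const Ck_on_diff C1_G)
  show "norm ((mat 1 + \<tau> *\<^sub>R (G x - mat 1)) *v v - v) \<le> norm v / 4" for x v
    unfolding mv using near[of x v] t mult_mono[of \<tau> 1 "norm (G x *v v - v)" "norm v / 4"] by simp
qed

text \<open>Replace \<open>g\<close> by its interpolation with the identity at parameter
  \<open>\<tau>\<close>. The left side then has \<open>\<tau>\<close>-derivative 0 by
  \<open>integral_transport_eq_0\<close> and equals the right side at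
  \<open>\<tau> = 0\<close>.\<close>

lemma integral_change_of_variables:
  fixes f :: "real ^ 'n \<Rightarrow> real"
  assumes f: "Ck_on (Suc 0) UNIV f" "\<And>x. r < norm x \<Longrightarrow> f x = 0" and k: "4 / 3 * r \<le> k"
  shows "integral (cube k) (\<lambda>x. f (g x) * det (G x)) = integral (cube k) f"
proof -
  obtain f' where f': "\<And>x. x \<in> UNIV \<Longrightarrow> (f has_derivative f' x) (at x within UNIV)"
    using f(1) by (rule Ck_on_SucE) (rule that)
  then have df: "(f has_derivative f' x) (at x)" for x by simp
  let ?g = "\<lambda>\<tau> x. x + \<tau> *\<^sub>R (g x - x)" and ?G = "\<lambda>\<tau> x. mat 1 + \<tau> *\<^sub>R (G x - mat 1)"
  let ?\<Psi> = "\<lambda>\<tau> x. f (?g \<tau> x) * det (?G \<tau> x)"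
  let ?D = "\<lambda>\<tau> x. f' (?g \<tau> x) (g x - x) * det (?G \<tau> x)
      + f (?g \<tau> x) * (\<Sum>i\<in>UNIV. det (set_row i ((G x - mat 1) $ i) (?G \<tau> x)))"
  have C: "Ck_on (Suc 0) ({0..1} \<times> cbox (- (k *\<^sub>R One)) (k *\<^sub>R One)) (\<lambda>q. ?\<Psi> (fst q) (snd q))"
  proof (intro Ck_on_mult Ck_on_det)
    show "Ck_on (Suc 0) ({0..1} \<times> cbox (- (k *\<^sub>R One)) (k *\<^sub>R One)) (\<lambda>q. f (?g (fst q) (snd q)))"
      by (intro Ck_on_compose_UNIV[OF f(1)] Ck_on_add Ck_on_scaleR Ck_on_diff Ck_on_compose_UNIV[OF C1_g] Ck_on_fst Ck_on_snd Ck_on_ident)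
    show "Ck_on (Suc 0) ({0..1} \<times> cbox (- (k *\<^sub>R One)) (k *\<^sub>R One)) (\<lambda>q. ?G (fst q) (snd q) $ i $ j)" for i j
      unfolding vector_add_component vector_scaleR_component vector_minus_component real_scaleR_def
      by (intro Ck_on_add Ck_on_mult Ck_on_diff Ck_on_compose_UNIV[OF C1_G] Ck_on_fst Ck_on_snd Ck_on_ident Ck_on_const)
  qed
  have D: "((\<lambda>\<tau>. ?\<Psi> \<tau> x) has_vector_derivative ?D \<tau> x) (at \<tau> within {0..1})" for \<tau> x
  proof -
    have 1: "((\<lambda>\<tau>. f (?g \<tau> x)) has_derivative (\<lambda>v. f' (?g \<tau> x) (v *\<^sub>R (g x - x)))) (at \<tau> within {0..1})"
      by (rule has_derivative_compose[OF _ df]) (auto intro!: derivative_eq_intros)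
    have 2: "((\<lambda>\<tau>. det (?G \<tau> x)) has_derivative (\<lambda>v. \<Sum>i\<in>UNIV. det (set_row i ((v *\<^sub>R (G x - mat 1)) $ i) (?G \<tau> x)))) (at \<tau> within {0..1})"
      by (rule has_derivative_det) (auto intro!: derivative_eq_intros)
    have 3: "f' (?g \<tau> x) (v *\<^sub>R w) = v * f' (?g \<tau> x) w" for v w
      using linear_cmul[OF has_derivative_linear[OF df]] by simp
    have 4: "det (set_row i ((v *\<^sub>R (G x - mat 1)) $ i) (?G \<tau> x)) = v * det (set_row i ((G x - mat 1) $ i) (?G \<tau> x))" for v i
      by (simp add: det_set_row sum_distrib_left mult.assoc)
    show ?thesis
      unfolding has_vector_derivative_def
    proof (rule has_derivative_eq_rhs[OF has_derivative_mult[OF 1 2]], rule ext)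
      have alg: "a * (v * s) + (v * c) * d = v * (c * d + a * s)" for a v s c d :: real
        by (simp add: algebra_simps)
      show "f (?g \<tau> x) * (\<Sum>i\<in>UNIV. det (set_row i ((v *\<^sub>R (G x - mat 1)) $ i) (?G \<tau> x)))
          + f' (?g \<tau> x) (v *\<^sub>R (g x - x)) * det (?G \<tau> x) = v *\<^sub>R ?D \<tau> x" for v
        unfolding 3 4 sum_distrib_left[symmetric] real_scaleR_def by (rule alg)
    qed
  qed
  have "integral (cbox (- (k *\<^sub>R One)) (k *\<^sub>R One)) (?D \<tau>) = 0" if "\<tau> \<in> {0..1}" for \<tau>
  proof -
    interpret \<tau>: near_identity "?g \<tau>" "?G \<tau>" "\<lambda>x i j v. \<tau> * dG x i j v"
      by (rule interpolation) (use that in auto)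
    \<comment> \<open>The path is linear, so its velocity is \<open>g x - x\<close> for every
      \<open>\<tau>\<close>.\<close>
    have "((\<lambda>x. g x - x) has_derivative (*v) (G x - mat 1)) (at x)" for x
      by (rule has_derivative_eq_rhs[OF has_derivative_diff[OF der has_derivative_ident]])
         (simp add: matrix_vector_mult_diff_rdistrib fun_eq_iff)
    from \<tau>.integral_transport_eq_0[OF f(1) df f(2) Ck_on_diff[OF C1_g Ck_on_ident] this k]
    show ?thesis by (simp add: cube_def)
  qed
  then have "((\<lambda>\<tau>. integral (cbox (- (k *\<^sub>R One)) (k *\<^sub>R One)) (?D \<tau>)) has_integral 0) {0..1}"
    by (intro has_integral_is_0) auto
  with integral_param_ftc(1)[OF C D]
  have "integral (cbox (- (k *\<^sub>R One)) (k *\<^sub>R One)) (?\<Psi> 1) - integral (cbox (- (k *\<^sub>R One)) (k *\<^sub>R One)) (?\<Psi> 0) = 0"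
    by (rule has_integral_unique)
  then show ?thesis by (simp add: cube_def)
qed

lemma inj_g: "inj g"
proof
  fix x z assume "g x = g z"
  then have "norm (x - z) \<le> 0" using expand_bounds(1)[of x z] by simp
  then show "x = z" by simp
qed

text \<open>A preimage of \<open>z\<close> is a fixed point of \<open>z - (g x - x)\<close>, a
  contraction in \<open>x\<close> with constant 1/4.\<close>

lemma surj_g: "surj g"
proof -
  have "\<exists>x. g x = z" for z
  proof -
    have "\<exists>!x. z - (g x - x) = x"
    proof (rule banach_fix_type[of "1 / 4"])
      show "\<forall>x y. dist (z - (g x - x)) (z - (g y - y)) \<le> 1 / 4 * dist x y"
      proof (intro allI)
        fix x y
        have "(z - (g x - x)) - (z - (g y - y)) = - ((g x - x) - (g y - y))" by simp
        then have "dist (z - (g x - x)) (z - (g y - y)) = norm ((g x - x) - (g y - y))"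
          unfolding dist_norm by (simp only: norm_minus_cancel)
        then show "dist (z - (g x - x)) (z - (g y - y)) \<le> 1 / 4 * dist x y"
          using displacement_lipschitz[of x y] by (simp add: dist_norm)
      qed
    qed auto
    then obtain x where "z - (g x - x) = x" by blast
    then have "g x = z" by (simp add: algebra_simps)
    then show ?thesis ..
  qed
  then show ?thesis unfolding surj_def by metis
qed

lemma inv_g: "g (inv g z) = z" "inv g (g x) = x"
  using surj_g inj_g by (auto simp: surj_f_inv_f)

text \<open>By \<open>expand_bounds\<close> the inverse has Lipschitz constant 4/3; being
  continuous, it has the derivative given by cofactors over determinant, again continuous.\<close>

lemma C1_inv: "Ck_on (Suc 0) UNIV (inv g)"
proof (rule Ck_on_SucI)
  have lip: "dist (inv g z) (inv g w) \<le> 4 / 3 * dist z w" for z w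
    using expand_bounds(1)[of "inv g z" "inv g w"] by (simp add: inv_g dist_norm)
  have cont: "continuous_on UNIV (inv g)"
    by (rule lipschitz_on_continuous_on[of "4 / 3"]) (auto intro!: lipschitz_onI lip)
  let ?A = "\<lambda>z. \<chi> j i. cof (G (inv g z)) i j / det (G (inv g z))"
  show "(inv g has_derivative (\<lambda>v. ?A z *v v)) (at z within UNIV)" for z
  proof -
    have "(inv g has_derivative (\<lambda>v. ?A z *v v)) (at (g (inv g z)))"
    proof (rule has_derivative_inverse_basic_x[OF der, where T = UNIV])
      show "(\<lambda>v. ?A z *v v) \<circ> (\<lambda>v. G (inv g z) *v v) = id"
        using matrix_inverse_cof(2)[OF det_nonzero] by (simp add: fun_eq_iff matrix_vector_mul_assoc)
      show "continuous (at (g (inv g z))) (inv g)"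
        using cont by (simp add: continuous_on_eq_continuous_at)
    qed (auto simp: inv_g)
    then show ?thesis by (simp add: inv_g)
  qed
  have 1: "continuous_on UNIV (\<lambda>z. cof (G (inv g z)) i j)" for i j
    by (rule continuous_on_compose2[OF Ck_on_continuous[OF C1_cof] cont]) auto
  have 2: "continuous_on UNIV (\<lambda>z. det (G (inv g z)))"
    by (rule continuous_on_compose2[OF Ck_on_continuous[OF Ck_on_det[OF C1_G]] cont]) auto
  show "Ck_on 0 UNIV (\<lambda>z. ?A z *v v)" for v
    unfolding matrix_vector_mult_def
    by (auto intro!: continuous_intros 1 2 simp: det_nonzero)
qed

end

subsection \<open>A symmetric right inverse of the divergence\<close>

text \<open>The inner integral is differentiated jointly in \<open>(w, s)\<close>, the outer one in
  \<open>w\<close>. Uniqueness identifies the pointwise \<open>D\<close> with the joint derivative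
  in the direction \<open>((v, 0), 0)\<close>, which supplies the continuity of
  \<open>D\<close>.\<close>

lemma has_derivative_integral2:
  fixes f :: "'a::euclidean_space \<Rightarrow> real \<Rightarrow> 'p::euclidean_space \<Rightarrow> real"
  assumes C: "Ck_on (Suc 0) ((UNIV \<times> cbox 0 1) \<times> cbox a b) (\<lambda>q. f (fst (fst q)) (snd (fst q)) (snd q))"
    and D: "\<And>w s h. s \<in> cbox 0 1 \<Longrightarrow> h \<in> cbox a b \<Longrightarrow> ((\<lambda>w. f w s h) has_derivative D w s h) (at w)"
  shows "((\<lambda>w. integral (cbox 0 1) (\<lambda>s. integral (cbox a b) (f w s))) has_derivative
      (\<lambda>v. integral (cbox 0 1) (\<lambda>s. integral (cbox a b) (\<lambda>h. D w s h v)))) (at w)"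
    and "continuous_on (cbox 0 1 \<times> cbox a b) (\<lambda>q. D w (fst q) (snd q) v)"
    and "continuous_on UNIV (\<lambda>w. integral (cbox 0 1) (\<lambda>s. integral (cbox a b) (\<lambda>h. D w s h v)))"
proof -
  let ?S = "(UNIV \<times> cbox 0 1) \<times> cbox a b" and ?f = "\<lambda>q. f (fst (fst q)) (snd (fst q)) (snd q)"
  obtain f' where f: "\<And>q. q \<in> ?S \<Longrightarrow> (?f has_derivative f' q) (at q within ?S)" "\<And>v. Ck_on 0 ?S (\<lambda>q. f' q v)"
    using C by (rule Ck_on_SucE) (rule that)
  have c: "continuous_on ?S (\<lambda>q. f' q v)" for v using f(2)[of v] by simp
  have eq: "f' ((w, s), h) ((v, 0), 0) = D w s h v" if "s \<in> cbox 0 1" "h \<in> cbox a b" for w s h v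
  proof -
    have "((\<lambda>p. ?f (p, h)) has_derivative (\<lambda>v. f' ((w, s), h) (v, 0))) (at (w, s) within UNIV \<times> cbox 0 1)"
      by (rule has_derivative_partial[where P = "cbox a b"]) (use f(1) that in auto)
    from has_derivative_partial[OF this]
    have "((\<lambda>w. f w s h) has_derivative (\<lambda>v. f' ((w, s), h) ((v, 0), 0))) (at w)"
      using that by simp
    from has_derivative_unique[OF this D[OF that]] show ?thesis by metis
  qed
  have conv: "convex ((UNIV :: 'a set) \<times> cbox (0::real) 1)" by (intro convex_Times convex_box) simp
  let ?F = "\<lambda>z. integral (cbox a b) (\<lambda>h. ?f (z, h))" and ?F' = "\<lambda>z v. integral (cbox a b) (\<lambda>h. f' (z, h) (v, 0))"
  have F: "(?F has_derivative ?F' z) (at z within UNIV \<times> cbox 0 1)" if "z \<in> UNIV \<times> cbox 0 1" for z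
    by (rule has_derivative_integral_param[OF f(1) c conv that])
  have F': "continuous_on (UNIV \<times> cbox 0 1) (\<lambda>z. ?F' z v)" for v
    by (rule continuous_on_integral_param[OF c])
  have e2: "integral (cbox 0 1) (\<lambda>s. ?F' (w, s) (v, 0)) = integral (cbox 0 1) (\<lambda>s. integral (cbox a b) (\<lambda>h. D w s h v))" for w v
    by (intro integral_cong eq) auto
  have "((\<lambda>w. integral (cbox 0 1) (\<lambda>s. ?F (w, s))) has_derivative (\<lambda>v. integral (cbox 0 1) (\<lambda>s. ?F' (w, s) (v, 0)))) (at w within UNIV)"
    by (rule has_derivative_integral_param[OF F F' convex_UNIV UNIV_I])
  then show "((\<lambda>w. integral (cbox 0 1) (\<lambda>s. integral (cbox a b) (f w s))) has_derivative
      (\<lambda>v. integral (cbox 0 1) (\<lambda>s. integral (cbox a b) (\<lambda>h. D w s h v)))) (at w)"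
    unfolding e2 by simp
  have "continuous_on UNIV (\<lambda>w. integral (cbox 0 1) (\<lambda>s. ?F' (w, s) (v, 0)))"
    by (rule continuous_on_integral_param[OF F'])
  then show "continuous_on UNIV (\<lambda>w. integral (cbox 0 1) (\<lambda>s. integral (cbox a b) (\<lambda>h. D w s h v)))"
    unfolding e2 .
  have "continuous_on (cbox 0 1 \<times> cbox a b) (\<lambda>q. f' ((w, fst q), snd q) ((v, 0), 0))"
    by (rule continuous_on_compose2[OF c]) (auto intro!: continuous_intros)
  then show "continuous_on (cbox 0 1 \<times> cbox a b) (\<lambda>q. D w (fst q) (snd q) v)"
    by (rule continuous_on_eq) (auto simp: eq)
qed

lemma axis_nth_if: "axis k 1 $ i = (if i = k then 1 else 0 :: real)"
  by (simp add: axis_def)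

text \<open>The moment conditions allow one to subtract an infinitesimal rigid motion from a test field
  \<open>\<phi>\<close>: for a weight \<open>\<rho>\<close> of mass 1, the integral of \<open>V \<bullet> \<phi>\<close> is that of
  \<open>\<rho> z * (V (z + h) \<bullet> (\<phi> (z + h) - \<phi> z - A z h))\<close> over \<open>z\<close> and \<open>h\<close>, with \<open>A\<close> the antisymmetric part of
  the gradient of \<open>\<phi>\<close>. Along the segment from \<open>z\<close> to \<open>z + h\<close> the difference is expressed by the symmetric
  gradient \<open>e\<close> and by the derivatives of \<open>A\<close>, which are derivatives of \<open>e\<close>. Integrating the latter by
  parts in \<open>z\<close>, with \<open>z + h\<close> fixed, leaves \<open>e\<close> at \<open>w = z + s *\<^sub>R h\<close> paired with minus the following kernel,
  where \<open>p\<close>, \<open>g\<close> and \<open>V\<close> stand for \<open>\<rho> z\<close>, its gradient and \<open>V (z + h)\<close>.\<close>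

definition kern :: "real \<Rightarrow> real ^ 'n \<Rightarrow> real ^ 'n \<Rightarrow> real ^ 'n \<Rightarrow> 'n \<Rightarrow> 'n::finite \<Rightarrow> real" where
  "kern p g V h j k = (g \<bullet> h - real CARD('n) * p) * (V $ j * h $ k + V $ k * h $ j) / 2 - (g \<bullet> V) * h $ j * h $ k"

lemma kern_commute: "kern p g V h j k = kern p g V h k j"
  by (simp add: kern_def algebra_simps)

lemma kern_0 [simp]: "kern p g 0 h j k = 0" "kern 0 0 V h j k = 0"
  by (simp_all add: kern_def)

text \<open>\<open>\<gamma>\<close> and \<open>\<eta>\<close> are the gradient and the Hessian of
  \<open>\<rho>\<close>, kept as data so that \<open>sym_\<eta>\<close> can be stated. The radius
  1/2 keeps the base points well inside the ball in which the solution has to be supported.\<close>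

locale weight =
  fixes \<rho> :: "real ^ 'n::finite \<Rightarrow> real" and \<gamma> :: "real ^ 'n \<Rightarrow> real ^ 'n" and \<eta> :: "real ^ 'n \<Rightarrow> real ^ 'n \<Rightarrow> real ^ 'n"
  assumes C1_\<rho>: "Ck_on (Suc 0) UNIV \<rho>" and C1_\<gamma>: "Ck_on (Suc 0) UNIV \<gamma>"
    and der_\<rho>: "\<And>z. (\<rho> has_derivative (\<lambda>v. \<gamma> z \<bullet> v)) (at z)"
    and der_\<gamma>: "\<And>z. (\<gamma> has_derivative \<eta> z) (at z)"
    and sym_\<eta>: "\<And>z u v. \<eta> z u \<bullet> v = \<eta> z v \<bullet> u"
    and supp_\<rho>: "\<And>z. 1 / 2 < norm z \<Longrightarrow> \<rho> z = 0" "\<And>z. 1 / 2 < norm z \<Longrightarrow> \<gamma> z = 0"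
    and mass_\<rho>: "integral UNIV \<rho> = 1"

text \<open>The rescaled problem in the coordinates \<open>y\<close>. The radius 2 leaves room for
  the image of the unit ball, which has radius at most 5/4.\<close>

locale balanced = weight \<rho> \<gamma> \<eta>
  for \<rho> :: "real ^ 'n::finite \<Rightarrow> real" and \<gamma> \<eta> +
  fixes V :: "real ^ 'n \<Rightarrow> real ^ 'n" and V' :: "real ^ 'n \<Rightarrow> real ^ 'n \<Rightarrow> real ^ 'n"
  assumes C1_V: "Ck_on (Suc 0) UNIV V"
    and der_V: "\<And>z. (V has_derivative V' z) (at z)"
    and supp_V: "\<And>z. 2 < norm z \<Longrightarrow> V z = 0"
    and moment0: "\<And>l. integral UNIV (\<lambda>z. V z $ l) = 0"
    and moment1: "\<And>j l. integral UNIV (\<lambda>z. z $ j * V z $ l - z $ l * V z $ j) = 0"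
begin

text \<open>The segment is now described from its running point \<open>w\<close>, reached at
  parameter \<open>s\<close>: its base point is \<open>w - s *\<^sub>R h\<close> and its end point
  \<open>w + (1 - s) *\<^sub>R h\<close>.\<close>

definition \<sigma> :: "'n \<Rightarrow> 'n \<Rightarrow> real ^ 'n \<Rightarrow> real" where
  "\<sigma> j k w = integral (cbox 0 1) (\<lambda>s. integral (cube 4) (\<lambda>h.
     kern (\<rho> (w - s *\<^sub>R h)) (\<gamma> (w - s *\<^sub>R h)) (V (w + (1 - s) *\<^sub>R h)) h j k))"

lemma lin_V': "linear (V' z)" and lin_\<eta>: "linear (\<eta> z)"
  using der_V der_\<gamma> has_derivative_linear by blast+

lemma linear_trace:
  fixes f :: "real ^ 'n \<Rightarrow> real"
  assumes "linear f" shows "(\<Sum>k\<in>UNIV. f (axis k 1) * x $ k) = f x"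
proof -
  have "f x = f (\<Sum>k\<in>UNIV. x $ k *\<^sub>R axis k 1)"
    using basis_expansion[of x] by (simp add: scalar_mult_eq_scaleR)
  also have "\<dots> = (\<Sum>k\<in>UNIV. f (axis k 1) * x $ k)"
    by (simp add: linear_sum[OF assms] linear_cmul[OF assms] mult.commute)
  finally show ?thesis by simp
qed

lemma tr_V': "(\<Sum>k\<in>UNIV. V' z (axis k 1) $ j * x $ k) = V' z x $ j"
  and tr_gV': "(\<Sum>k\<in>UNIV. y \<bullet> V' z (axis k 1) * x $ k) = y \<bullet> V' z x"
  and tr_\<eta>: "(\<Sum>k\<in>UNIV. \<eta> z (axis k 1) \<bullet> y * x $ k) = \<eta> z x \<bullet> y"
  and tr_inner: "(\<Sum>k\<in>UNIV. y $ k * x $ k) = y \<bullet> x"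
  and tr_axis: "(\<Sum>k\<in>UNIV. axis k 1 $ j * x $ k) = x $ j"
proof -
  show "(\<Sum>k\<in>UNIV. V' z (axis k 1) $ j * x $ k) = V' z x $ j"
    by (rule linear_trace) (intro linear_compose[OF lin_V', unfolded o_def] bounded_linear.linear bounded_linear_vec_nth)
  show "(\<Sum>k\<in>UNIV. y \<bullet> V' z (axis k 1) * x $ k) = y \<bullet> V' z x"
    by (rule linear_trace) (intro linear_compose[OF lin_V', unfolded o_def] bounded_linear.linear bounded_linear_inner_right)
  show "(\<Sum>k\<in>UNIV. \<eta> z (axis k 1) \<bullet> y * x $ k) = \<eta> z x \<bullet> y"
    by (rule linear_trace) (intro linear_compose[OF lin_\<eta>, unfolded o_def] bounded_linear.linear bounded_linear_inner_left)
  show "(\<Sum>k\<in>UNIV. y $ k * x $ k) = y \<bullet> x" by (simp add: inner_vec_def)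
  show "(\<Sum>k\<in>UNIV. axis k 1 $ j * x $ k) = x $ j" by (simp add: axis_def if_distrib[of "\<lambda>u. u * _"] cong: if_cong)
qed

context
  fixes w h :: "real ^ 'n" and s :: real and j :: 'n
begin

abbreviation "bwd \<equiv> w - s *\<^sub>R h"
abbreviation "fwd \<equiv> w + (1 - s) *\<^sub>R h"

definition dkern where
  "dkern k v = ((\<eta> bwd v \<bullet> h - real CARD('n) * (\<gamma> bwd \<bullet> v)) * (V fwd $ j * h $ k + V fwd $ k * h $ j)
      + (\<gamma> bwd \<bullet> h - real CARD('n) * \<rho> bwd) * (V' fwd v $ j * h $ k + V' fwd v $ k * h $ j)) / 2
      - (\<eta> bwd v \<bullet> V fwd + \<gamma> bwd \<bullet> V' fwd v) * h $ j * h $ k"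

text \<open>The derivative in \<open>s\<close> of the field \<open>Q\<close> introduced below, see
  \<open>der_Q\<close>.\<close>

definition dQ where
  "dQ = ((real CARD('n) + 1) * (- V' fwd h $ j * \<rho> bwd - V fwd $ j * (\<gamma> bwd \<bullet> h)) + V' fwd h $ j * (\<gamma> bwd \<bullet> h) + V fwd $ j * (\<eta> bwd h \<bullet> h)
      - h $ j * (\<eta> bwd h \<bullet> V fwd + \<gamma> bwd \<bullet> V' fwd h)) / 2"

text \<open>The derivative in \<open>h\<close> of the field \<open>W\<close> introduced below, see
  \<open>der_W\<close>.\<close>

definition dW where
  "dW v = (v $ j * (\<gamma> bwd \<bullet> h - real CARD('n) * \<rho> bwd) + h $ j * (\<gamma> bwd \<bullet> v - s * (\<eta> bwd v \<bullet> h) + s * real CARD('n) * (\<gamma> bwd \<bullet> v))) *\<^sub>R V fwd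
      + (h $ j * (\<gamma> bwd \<bullet> h - real CARD('n) * \<rho> bwd) * (1 - s)) *\<^sub>R V' fwd v
      + ((1 - s) * V' fwd v $ j * \<rho> bwd - s * V fwd $ j * (\<gamma> bwd \<bullet> v) - v $ j * (\<gamma> bwd \<bullet> V fwd) + h $ j * s * (\<eta> bwd v \<bullet> V fwd)
          - h $ j * (1 - s) * (\<gamma> bwd \<bullet> V' fwd v)) *\<^sub>R h
      + (V fwd $ j * \<rho> bwd - h $ j * (\<gamma> bwd \<bullet> V fwd)) *\<^sub>R v"

lemma trace_dkern:
  "(\<Sum>k\<in>UNIV. dkern k (axis k 1)) =
     (V fwd $ j * (\<eta> bwd h \<bullet> h) + h $ j * (\<eta> bwd (V fwd) \<bullet> h) - real CARD('n) * V fwd $ j * (\<gamma> bwd \<bullet> h) - real CARD('n) * h $ j * (\<gamma> bwd \<bullet> V fwd)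
      + (\<gamma> bwd \<bullet> h - real CARD('n) * \<rho> bwd) * (V' fwd h $ j + h $ j * (\<Sum>k\<in>UNIV. V' fwd (axis k 1) $ k))) / 2
      - h $ j * (\<eta> bwd h \<bullet> V fwd + \<gamma> bwd \<bullet> V' fwd h)"
proof -
  have "dkern k (axis k 1) = (V fwd $ j / 2) * (\<eta> bwd (axis k 1) \<bullet> h * h $ k) + (h $ j / 2) * (\<eta> bwd (axis k 1) \<bullet> h * V fwd $ k)
      - (real CARD('n) * V fwd $ j / 2) * (\<gamma> bwd $ k * h $ k) - (real CARD('n) * h $ j / 2) * (\<gamma> bwd $ k * V fwd $ k)
      + ((\<gamma> bwd \<bullet> h - real CARD('n) * \<rho> bwd) / 2) * (V' fwd (axis k 1) $ j * h $ k) + ((\<gamma> bwd \<bullet> h - real CARD('n) * \<rho> bwd) * h $ j / 2) * V' fwd (axis k 1) $ k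
      - h $ j * (\<eta> bwd (axis k 1) \<bullet> V fwd * h $ k) - h $ j * (\<gamma> bwd \<bullet> V' fwd (axis k 1) * h $ k)" for k
    by (simp add: dkern_def inner_axis field_simps)
  then show ?thesis
    by (simp only: sum.distrib sum_subtractf sum_distrib_left[symmetric] tr_V' tr_gV' tr_\<eta> tr_inner) (simp add: field_simps)
qed

text \<open>The key cancellation. An \<open>h\<close>-derivative acts on fields at
  \<open>fwd\<close> as \<open>1 - s\<close> times a \<open>w\<close>-derivative and on fields at
  \<open>bwd\<close> as \<open>- s\<close> times one; so, up to an \<open>h\<close>-divergence, the
  \<open>w\<close>-divergence of the kernel is a pure \<open>s\<close>-derivative. The dimension in
  \<open>kern\<close> compensates the trace of the identity arising from explicit factors
  \<open>h\<close>, and \<open>sym_\<eta>\<close> matches the Hessian terms.\<close>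

lemma trace_dW:
  "(\<Sum>i\<in>UNIV. dW (axis i 1) $ i) = 2 * (1 - s) * ((\<Sum>k\<in>UNIV. dkern k (axis k 1)) - dQ)"
proof -
  have "dW (axis i 1) $ i = (\<gamma> bwd \<bullet> h - real CARD('n) * \<rho> bwd) * (axis i 1 $ j * V fwd $ i) + (h $ j * (1 + s * real CARD('n))) * (\<gamma> bwd $ i * V fwd $ i)
      - (h $ j * s) * (\<eta> bwd (axis i 1) \<bullet> h * V fwd $ i) + (h $ j * (\<gamma> bwd \<bullet> h - real CARD('n) * \<rho> bwd) * (1 - s)) * V' fwd (axis i 1) $ i
      + ((1 - s) * \<rho> bwd) * (V' fwd (axis i 1) $ j * h $ i) - (s * V fwd $ j) * (\<gamma> bwd $ i * h $ i)
      - (\<gamma> bwd \<bullet> V fwd) * (axis i 1 $ j * h $ i) + (h $ j * s) * (\<eta> bwd (axis i 1) \<bullet> V fwd * h $ i)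
      - (h $ j * (1 - s)) * (\<gamma> bwd \<bullet> V' fwd (axis i 1) * h $ i) + (V fwd $ j * \<rho> bwd - h $ j * (\<gamma> bwd \<bullet> V fwd)) * 1" for i
    by (simp add: dW_def inner_axis algebra_simps)
  then have "(\<Sum>i\<in>UNIV. dW (axis i 1) $ i) =
      (\<gamma> bwd \<bullet> h - real CARD('n) * \<rho> bwd) * V fwd $ j + (h $ j * (1 + s * real CARD('n))) * (\<gamma> bwd \<bullet> V fwd)
      - (h $ j * s) * (\<eta> bwd (V fwd) \<bullet> h) + (h $ j * (\<gamma> bwd \<bullet> h - real CARD('n) * \<rho> bwd) * (1 - s)) * (\<Sum>i\<in>UNIV. V' fwd (axis i 1) $ i)
      + ((1 - s) * \<rho> bwd) * V' fwd h $ j - (s * V fwd $ j) * (\<gamma> bwd \<bullet> h)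
      - (\<gamma> bwd \<bullet> V fwd) * h $ j + (h $ j * s) * (\<eta> bwd h \<bullet> V fwd)
      - (h $ j * (1 - s)) * (\<gamma> bwd \<bullet> V' fwd h) + (V fwd $ j * \<rho> bwd - h $ j * (\<gamma> bwd \<bullet> V fwd)) * real CARD('n)"
    by (simp only: sum.distrib sum_subtractf sum_distrib_left[symmetric] tr_V' tr_gV' tr_\<eta> tr_inner tr_axis) simp
  then show ?thesis
    unfolding trace_dkern dQ_def sym_\<eta>[of bwd "V fwd" h] by (simp only:) (simp add: field_simps)
qed

end

text \<open>Its integral over \<open>h\<close> is 0 at \<open>s = 0\<close>, where only the moments
  of \<open>V\<close> enter, and \<open>V w\<close> at \<open>s = 1\<close>, where only the mass of
  \<open>\<rho>\<close> and the first moments of \<open>\<gamma>\<close> enter.\<close>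

definition Q where
  "Q w h s j = ((real CARD('n) + 1) * (V (fwd w h s) $ j * \<rho> (bwd w h s)) - V (fwd w h s) $ j * (\<gamma> (bwd w h s) \<bullet> h)
      + h $ j * (\<gamma> (bwd w h s) \<bullet> V (fwd w h s))) / 2"

text \<open>A field in \<open>h\<close> that vanishes for large \<open>h\<close>, so its divergence
  integrates to 0; by \<open>trace_dW\<close> that divergence is the defect between the divergence
  of the kernel and \<open>dQ\<close>.\<close>

definition W where
  "W w h s j = (h $ j * (\<gamma> (bwd w h s) \<bullet> h - real CARD('n) * \<rho> (bwd w h s))) *\<^sub>R V (fwd w h s)
      + (V (fwd w h s) $ j * \<rho> (bwd w h s) - h $ j * (\<gamma> (bwd w h s) \<bullet> V (fwd w h s))) *\<^sub>R h"

lemmas derivative_rules = has_derivative_const has_derivative_ident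
  bounded_linear.has_derivative[OF bounded_linear_divide] bounded_linear.has_derivative[OF bounded_linear_vec_nth]
  has_derivative_add has_derivative_diff has_derivative_mult has_derivative_inner

lemma der_fwd_bwd:
  "((\<lambda>w. V (fwd w h s)) has_derivative V' (fwd w h s)) (at w)"
  "((\<lambda>w. \<rho> (bwd w h s)) has_derivative (\<lambda>v. \<gamma> (bwd w h s) \<bullet> v)) (at w)"
  "((\<lambda>w. \<gamma> (bwd w h s)) has_derivative \<eta> (bwd w h s)) (at w)"
  "((\<lambda>s. V (fwd w h s)) has_derivative (\<lambda>v. - v *\<^sub>R V' (fwd w h s) h)) (at s within S)"
  "((\<lambda>s. \<rho> (bwd w h s)) has_derivative (\<lambda>v. - v * (\<gamma> (bwd w h s) \<bullet> h))) (at s within S)"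
  "((\<lambda>s. \<gamma> (bwd w h s)) has_derivative (\<lambda>v. - v *\<^sub>R \<eta> (bwd w h s) h)) (at s within S)"
  "((\<lambda>h. V (fwd w h s)) has_derivative (\<lambda>v. (1 - s) *\<^sub>R V' (fwd w h s) v)) (at h)"
  "((\<lambda>h. \<rho> (bwd w h s)) has_derivative (\<lambda>v. - s * (\<gamma> (bwd w h s) \<bullet> v))) (at h)"
  "((\<lambda>h. \<gamma> (bwd w h s)) has_derivative (\<lambda>v. - s *\<^sub>R \<eta> (bwd w h s) v)) (at h)"
proof -
  note comp = has_derivative_compose[OF _ der_V] has_derivative_compose[OF _ der_\<rho>] has_derivative_compose[OF _ der_\<gamma>]
  have w: "((\<lambda>w. fwd w h s) has_derivative (\<lambda>v. v)) (at w)" "((\<lambda>w. bwd w h s) has_derivative (\<lambda>v. v)) (at w)"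
    by (auto intro!: derivative_eq_intros)
  show "((\<lambda>w. V (fwd w h s)) has_derivative V' (fwd w h s)) (at w)"
    "((\<lambda>w. \<rho> (bwd w h s)) has_derivative (\<lambda>v. \<gamma> (bwd w h s) \<bullet> v)) (at w)"
    "((\<lambda>w. \<gamma> (bwd w h s)) has_derivative \<eta> (bwd w h s)) (at w)"
    using comp(1)[OF w(1)] comp(2,3)[OF w(2)] by simp_all
  have s: "((\<lambda>s. fwd w h s) has_derivative (\<lambda>v. - v *\<^sub>R h)) (at s within S)" "((\<lambda>s. bwd w h s) has_derivative (\<lambda>v. - v *\<^sub>R h)) (at s within S)"
    by (auto intro!: derivative_eq_intros)
  show "((\<lambda>s. V (fwd w h s)) has_derivative (\<lambda>v. - v *\<^sub>R V' (fwd w h s) h)) (at s within S)"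
    "((\<lambda>s. \<rho> (bwd w h s)) has_derivative (\<lambda>v. - v * (\<gamma> (bwd w h s) \<bullet> h))) (at s within S)"
    "((\<lambda>s. \<gamma> (bwd w h s)) has_derivative (\<lambda>v. - v *\<^sub>R \<eta> (bwd w h s) h)) (at s within S)"
    using comp(1)[OF s(1)] comp(2,3)[OF s(2)] unfolding linear_cmul[OF lin_V'] linear_cmul[OF lin_\<eta>] inner_scaleR_right .
  have h: "((\<lambda>h. fwd w h s) has_derivative (\<lambda>v. (1 - s) *\<^sub>R v)) (at h)" "((\<lambda>h. bwd w h s) has_derivative (\<lambda>v. - s *\<^sub>R v)) (at h)"
    by (auto intro!: derivative_eq_intros)
  show "((\<lambda>h. V (fwd w h s)) has_derivative (\<lambda>v. (1 - s) *\<^sub>R V' (fwd w h s) v)) (at h)"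
    "((\<lambda>h. \<rho> (bwd w h s)) has_derivative (\<lambda>v. - s * (\<gamma> (bwd w h s) \<bullet> v))) (at h)"
    "((\<lambda>h. \<gamma> (bwd w h s)) has_derivative (\<lambda>v. - s *\<^sub>R \<eta> (bwd w h s) v)) (at h)"
    using comp(1)[OF h(1)] comp(2,3)[OF h(2)] unfolding linear_cmul[OF lin_V'] linear_cmul[OF lin_\<eta>] inner_scaleR_right .
qed

lemma der_kern:
  "((\<lambda>w. kern (\<rho> (bwd w h s)) (\<gamma> (bwd w h s)) (V (fwd w h s)) h j k) has_derivative dkern w h s j k) (at w)"
proof -
  \<comment> \<open>Stated for arbitrary \<open>p\<close>, \<open>g\<close>, \<open>A\<close>, so
    that the product rule is applied before the points of the segment are inserted.\<close>
  have gen: "((\<lambda>w. kern (p w) (g w) (A w) h j k) has_derivative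
      (\<lambda>v. ((g' v \<bullet> h - real CARD('n) * p' v) * (A x $ j * h $ k + A x $ k * h $ j)
      + (g x \<bullet> h - real CARD('n) * p x) * (A' v $ j * h $ k + A' v $ k * h $ j)) / 2
      - (g' v \<bullet> A x + g x \<bullet> A' v) * h $ j * h $ k)) (at x)"
    if "(p has_derivative p') (at x)" "(g has_derivative g') (at x)" "(A has_derivative A') (at x)"
    for p :: "real ^ 'n \<Rightarrow> real" and g A :: "real ^ 'n \<Rightarrow> real ^ 'n" and p' g' A' x
    unfolding kern_def
    by (rule has_derivative_eq_rhs, (rule that derivative_rules)+)
       (simp_all add: fun_eq_iff field_simps)
  show ?thesis unfolding dkern_def[abs_def] by (rule gen[OF der_fwd_bwd(2,3,1)])
qed

lemma der_Q: "((\<lambda>s. Q w h s j) has_vector_derivative dQ w h s j) (at s within S)"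
proof -
  have gen: "((\<lambda>s. ((real CARD('n) + 1) * (A s $ j * p s) - A s $ j * (g s \<bullet> h) + h $ j * (g s \<bullet> A s)) / 2) has_derivative
      (\<lambda>v. ((real CARD('n) + 1) * (A x $ j * p' v + A' v $ j * p x) - (A x $ j * (g' v \<bullet> h) + A' v $ j * (g x \<bullet> h))
        + h $ j * (g x \<bullet> A' v + g' v \<bullet> A x)) / 2)) (at x within S)"
    if "(p has_derivative p') (at x within S)" "(g has_derivative g') (at x within S)" "(A has_derivative A') (at x within S)"
    for p :: "real \<Rightarrow> real" and g A :: "real \<Rightarrow> real ^ 'n" and p' g' A' x
    by (rule has_derivative_eq_rhs, (rule that derivative_rules)+)
       (simp_all add: fun_eq_iff field_simps)
  show ?thesis unfolding Q_def has_vector_derivative_def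
    by (rule has_derivative_eq_rhs[OF gen[OF der_fwd_bwd(5,6,4)]]) (simp add: fun_eq_iff dQ_def field_simps)
qed

lemma der_W: "((\<lambda>h. W w h s j) has_derivative dW w h s j) (at h)"
proof -
  have c1: "((\<lambda>h. h $ j * (g h \<bullet> h - real CARD('n) * p h)) has_derivative
      (\<lambda>v. x $ j * (g x \<bullet> v + g' v \<bullet> x - real CARD('n) * p' v) + v $ j * (g x \<bullet> x - real CARD('n) * p x))) (at x)"
    and c2: "((\<lambda>h. A h $ j * p h - h $ j * (g h \<bullet> A h)) has_derivative
      (\<lambda>v. A x $ j * p' v + A' v $ j * p x - (x $ j * (g x \<bullet> A' v + g' v \<bullet> A x) + v $ j * (g x \<bullet> A x)))) (at x)"
    if "(p has_derivative p') (at x)" "(g has_derivative g') (at x)" "(A has_derivative A') (at x)"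
    for p :: "real ^ 'n \<Rightarrow> real" and g A :: "real ^ 'n \<Rightarrow> real ^ 'n" and p' g' A' x
    subgoal by (rule has_derivative_eq_rhs, (rule that derivative_rules)+) (simp_all add: fun_eq_iff algebra_simps)
    subgoal by (rule has_derivative_eq_rhs, (rule that derivative_rules)+) (simp_all add: fun_eq_iff algebra_simps)
    done
  note d = der_fwd_bwd(8,9,7)[of w s h]
  show ?thesis
    unfolding W_def
  proof (rule has_derivative_eq_rhs[OF has_derivative_add[OF has_derivative_scaleR[OF c1[OF d] d(3)]
        has_derivative_scaleR[OF c2[OF d] has_derivative_ident]]], rule ext)
    fix v
    let ?g = "\<gamma> (bwd w h s)" and ?p = "\<rho> (bwd w h s)" and ?A = "V (fwd w h s)" and ?B = "V' (fwd w h s) v" and ?e = "\<eta> (bwd w h s) v"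
    have 1: "h $ j * (?g \<bullet> v + (- s *\<^sub>R ?e) \<bullet> h - real CARD('n) * (- s * (?g \<bullet> v))) + v $ j * (?g \<bullet> h - real CARD('n) * ?p)
        = v $ j * (?g \<bullet> h - real CARD('n) * ?p) + h $ j * (?g \<bullet> v - s * (?e \<bullet> h) + s * real CARD('n) * (?g \<bullet> v))"
      by (simp add: algebra_simps)
    have 2: "?A $ j * (- s * (?g \<bullet> v)) + ((1 - s) *\<^sub>R ?B) $ j * ?p - (h $ j * (?g \<bullet> ((1 - s) *\<^sub>R ?B) + (- s *\<^sub>R ?e) \<bullet> ?A) + v $ j * (?g \<bullet> ?A))
        = (1 - s) * ?B $ j * ?p - s * ?A $ j * (?g \<bullet> v) - v $ j * (?g \<bullet> ?A) + h $ j * s * (?e \<bullet> ?A) - h $ j * (1 - s) * (?g \<bullet> ?B)"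
      by (simp add: algebra_simps)
    show "(h $ j * (?g \<bullet> h - real CARD('n) * ?p)) *\<^sub>R ((1 - s) *\<^sub>R ?B)
        + (h $ j * (?g \<bullet> v + (- s *\<^sub>R ?e) \<bullet> h - real CARD('n) * (- s * (?g \<bullet> v))) + v $ j * (?g \<bullet> h - real CARD('n) * ?p)) *\<^sub>R ?A
        + ((?A $ j * ?p - h $ j * (?g \<bullet> ?A)) *\<^sub>R v
        + (?A $ j * (- s * (?g \<bullet> v)) + ((1 - s) *\<^sub>R ?B) $ j * ?p - (h $ j * (?g \<bullet> ((1 - s) *\<^sub>R ?B) + (- s *\<^sub>R ?e) \<bullet> ?A) + v $ j * (?g \<bullet> ?A))) *\<^sub>R h)
        = dW w h s j v"
      unfolding 1 2 dW_def by (simp only: scaleR_scaleR add_ac)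
  qed
qed

lemma Ck_on_divide_const: "Ck_on k S f \<Longrightarrow> Ck_on k S (\<lambda>x. f x / c :: real)"
  unfolding divide_inverse by (rule Ck_on_mult[OF _ Ck_on_const])

lemmas C1_intros = Ck_on_diff Ck_on_add Ck_on_divide_const Ck_on_mult Ck_on_scaleR Ck_on_inner Ck_on_nth
  Ck_on_compose_UNIV[OF C1_V] Ck_on_compose_UNIV[OF C1_\<rho>] Ck_on_compose_UNIV[OF C1_\<gamma>]
  Ck_on_fst Ck_on_snd Ck_on_ident Ck_on_const

lemma C1_kern:
  "Ck_on (Suc 0) S (\<lambda>q. kern (\<rho> (fst (fst q) - snd (fst q) *\<^sub>R snd q)) (\<gamma> (fst (fst q) - snd (fst q) *\<^sub>R snd q))
     (V (fst (fst q) + (1 - snd (fst q)) *\<^sub>R snd q)) (snd q) j k)"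
  unfolding kern_def by (intro C1_intros)

lemma C1_Q: "Ck_on (Suc 0) S (\<lambda>q. Q w (snd q) (fst q) j)"
  unfolding Q_def by (intro C1_intros)

lemma C1_W: "Ck_on (Suc 0) S (\<lambda>h. W w h s j)"
  unfolding W_def by (intro C1_intros)

text \<open>\<open>h\<close> is the difference of the two points, and 3 exceeds the sum 2 + 1/2 of
  the support radii.\<close>

lemma support: "3 < norm h \<Longrightarrow> V (fwd w h s) = 0 \<or> \<rho> (bwd w h s) = 0 \<and> \<gamma> (bwd w h s) = 0"
proof -
  assume h: "3 < norm h"
  have "h = fwd w h s - bwd w h s" by (simp add: algebra_simps)
  then have "norm h \<le> norm (fwd w h s) + norm (bwd w h s)" by (metis norm_triangle_ineq4)
  then have "2 < norm (fwd w h s) \<or> 1 / 2 < norm (bwd w h s)" using h by linarith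
  then show ?thesis using supp_V supp_\<rho> by blast
qed

lemma integral_weight_reflected:
  assumes "norm w \<le> 2"
  shows "integral (cube 4) (\<lambda>h. \<rho> (w - h)) = 1"
proof -
  have "integral (cube 4) (\<lambda>h. \<rho> (- (h + (- w)))) = integral (cube 4) (\<lambda>h. \<rho> (- h))"
    by (rule integral_cube_shift[where r = "1 / 2"]) (use assms supp_\<rho> in auto)
  also have "\<dots> = integral (cube 4) \<rho>"
    using integral_reflect[of "4 *\<^sub>R One" "- (4 *\<^sub>R One)" \<rho>] by (simp add: cube_def)
  also have "\<dots> = integral UNIV \<rho>"
  proof (rule integral_supported)
    fix x :: "real ^ 'n" assume "x \<notin> cube 4"
    then have "1 / 2 < norm x" using mem_cube[of x 4] by linarith
    then show "\<rho> x = 0" by (rule supp_\<rho>)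
  qed
  finally show ?thesis using mass_\<rho> by simp
qed

lemma cont_slices:
  "continuous_on S (\<lambda>h. \<rho> (w - h))" "continuous_on S (\<lambda>h. \<gamma> (w - h))" "continuous_on S (\<lambda>h. V (w + h))"
  by (rule Ck_on_continuous[of "Suc 0"], intro C1_intros)+

text \<open>Integrate the derivative of \<open>h $ i * \<rho> (w - h)\<close> in direction
  \<open>k\<close>; what remains besides the moment is the mass of \<open>\<rho>\<close>.\<close>

lemma integral_weight_moment:
  assumes "norm w \<le> 2"
  shows "integral (cube 4) (\<lambda>h. h $ i * \<gamma> (w - h) $ k) = (if i = k then 1 else 0)"
proof -
  have d: "((\<lambda>h. h $ i * \<rho> (w - h)) has_derivative (\<lambda>v. v $ i * \<rho> (w - h) - h $ i * (\<gamma> (w - h) \<bullet> v))) (at h)" for h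
    by (rule has_derivative_eq_rhs, (rule derivative_rules has_derivative_compose[OF _ der_\<rho>])+) (simp add: fun_eq_iff)
  have "integral (cube 4) (\<lambda>h. axis k 1 $ i * \<rho> (w - h) - h $ i * (\<gamma> (w - h) \<bullet> axis k 1)) = 0"
  proof (rule integral_derivative_eq_0[OF _ d, of "5 / 2" 4])
    show "Ck_on (Suc 0) UNIV (\<lambda>h. h $ i * \<rho> (w - h))" by (intro C1_intros)
    show "h $ i * \<rho> (w - h) = 0" if "5 / 2 < norm h" for h
      using that assms norm_triangle_ineq2[of h w] supp_\<rho>(1)[of "w - h"] by (simp add: norm_minus_commute)
  qed simp
  moreover have "integral (cube 4) (\<lambda>h. axis k 1 $ i * \<rho> (w - h) - h $ i * (\<gamma> (w - h) \<bullet> axis k 1))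
      = (if i = k then 1 else 0) * integral (cube 4) (\<lambda>h. \<rho> (w - h)) - integral (cube 4) (\<lambda>h. h $ i * \<gamma> (w - h) $ k)"
    unfolding cube_def
    by (subst Henstock_Kurzweil_Integration.integral_diff)
       (auto intro!: integrable_continuous continuous_intros cont_slices simp: inner_axis axis_nth_if)
  ultimately show ?thesis using integral_weight_reflected[OF assms] by simp
qed

text \<open>At \<open>s = 1\<close> the end point is \<open>w\<close>, so \<open>V w\<close> factors
  out; with \<open>n\<close> the dimension the coefficients are (n + 1)/2 - n/2 + 1/2 = 1.\<close>

lemma integral_Q_1: "integral (cube 4) (\<lambda>h. Q w h 1 j) = V w $ j"
proof (cases "norm w \<le> 2")
  case True
  let ?n = "real CARD('n)" and ?V = "V w"
  have I: "(\<lambda>h. h $ i * \<gamma> (w - h) $ k) integrable_on cube 4" "(\<lambda>h. \<rho> (w - h)) integrable_on cube 4" for i k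
    unfolding cube_def by (auto intro!: integrable_continuous continuous_intros cont_slices)
  have "Q w h 1 j = ((?n + 1) * ?V $ j / 2) * \<rho> (w - h) - (?V $ j / 2) * (\<Sum>i\<in>UNIV. h $ i * \<gamma> (w - h) $ i)
      + (\<Sum>k\<in>UNIV. (?V $ k / 2) * (h $ j * \<gamma> (w - h) $ k))" for h
    by (simp add: Q_def inner_vec_def sum_distrib_left sum_divide_distrib field_simps)
  then have "integral (cube 4) (\<lambda>h. Q w h 1 j) = ((?n + 1) * ?V $ j / 2) * integral (cube 4) (\<lambda>h. \<rho> (w - h))
      - (?V $ j / 2) * (\<Sum>i\<in>UNIV. integral (cube 4) (\<lambda>h. h $ i * \<gamma> (w - h) $ i))
      + (\<Sum>k\<in>UNIV. (?V $ k / 2) * integral (cube 4) (\<lambda>h. h $ j * \<gamma> (w - h) $ k))"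
    by (simp add: Henstock_Kurzweil_Integration.integral_add Henstock_Kurzweil_Integration.integral_diff
        Henstock_Kurzweil_Integration.integral_sum I integrable_sum integrable_diff integrable_on_mult_right)
  also have "\<dots> = V w $ j"
  proof -
    have "(\<Sum>k\<in>UNIV. ?V $ k / 2 * (if j = k then 1 else 0)) = ?V $ j / 2"
      by (simp add: if_distrib[of "\<lambda>u. _ * u"] cong: if_cong)
    then show ?thesis
      unfolding integral_weight_reflected[OF True] integral_weight_moment[OF True]
      by (simp only:) (simp add: field_simps)
  qed
  finally show ?thesis .
next
  case False
  then have "V w = 0" using supp_V by simp
  then show ?thesis by (simp add: Q_def)
qed

text \<open>At \<open>s = 0\<close> the base point is \<open>w\<close>, so \<open>\<rho> w\<close>
  and \<open>\<gamma> w\<close> factor out, leaving linear moments of \<open>V\<close> and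
  antisymmetric first moments about \<open>w\<close>.\<close>

lemma integral_Q_0: "integral (cube 4) (\<lambda>h. Q w h 0 j) = 0"
proof (cases "norm w \<le> 1 / 2")
  case True
  let ?n = "real CARD('n)"
  have I: "(\<lambda>h. V (w + h) $ i) integrable_on cube 4" "(\<lambda>h. h $ l * V (w + h) $ i) integrable_on cube 4" for i l
    unfolding cube_def by (auto intro!: integrable_continuous continuous_intros cont_slices)
  have IV: "(\<lambda>h. V h $ i) integrable_on cube 4" "(\<lambda>h. h $ l * V h $ i) integrable_on cube 4" for i l
    unfolding cube_def using cont_slices(3)[of _ 0] by (auto intro!: integrable_continuous continuous_intros)
  have out: "2 < norm x" if "x \<notin> cube 4" for x :: "real ^ 'n" using that mem_cube[of x 4] by linarith
  have V0: "integral (cube 4) (\<lambda>z. V z $ i) = 0" for i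
    using moment0[of i] by (subst integral_supported) (auto simp: out supp_V)
  have V1: "integral (cube 4) (\<lambda>z. z $ l * V z $ i - z $ i * V z $ l) = 0" for l i
    using moment1[of l i] by (subst integral_supported) (auto simp: out supp_V)
  have m0: "integral (cube 4) (\<lambda>h. V (w + h) $ i) = 0" for i
    using integral_cube_shift[of 2 "\<lambda>z. V z $ i" w 4] V0[of i] True supp_V by (simp add: add.commute)
  \<comment> \<open>Moments about \<open>w\<close> differ from those about 0 by multiples of the
    linear moments.\<close>
  have m1: "integral (cube 4) (\<lambda>h. h $ l * V (w + h) $ i - h $ i * V (w + h) $ l) = 0" for l i
  proof -
    have A: "integral (cube 4) (\<lambda>h. ((h + w) - w) $ l * V (h + w) $ i - ((h + w) - w) $ i * V (h + w) $ l)
        = integral (cube 4) (\<lambda>z. (z - w) $ l * V z $ i - (z - w) $ i * V z $ l)"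
      by (rule integral_cube_shift[where r = 2]) (use True supp_V in auto)
    have B: "(\<lambda>z. (z - w) $ l * V z $ i - (z - w) $ i * V z $ l) =
        (\<lambda>z. (z $ l * V z $ i - z $ i * V z $ l) - w $ l * V z $ i + w $ i * V z $ l)"
      by (simp add: fun_eq_iff algebra_simps)
    have C: "integral (cube 4) (\<lambda>z. (z $ l * V z $ i - z $ i * V z $ l) - w $ l * V z $ i + w $ i * V z $ l) = 0"
    proof -
      have "((\<lambda>z. z $ l * V z $ i - z $ i * V z $ l) has_integral 0) (cube 4)" for l i
        using integrable_integral[OF integrable_diff[OF IV(2)[of l i] IV(2)[of i l]]] V1 by simp
      moreover have "((\<lambda>z. V z $ i) has_integral 0) (cube 4)" for i
        using integrable_integral[OF IV(1)[of i]] V0 by simp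
      ultimately have "((\<lambda>z. (z $ l * V z $ i - z $ i * V z $ l) - w $ l * V z $ i + w $ i * V z $ l) has_integral
          0 - w $ l * 0 + w $ i * 0) (cube 4)"
        by (intro has_integral_add has_integral_diff has_integral_mult_right)
      then show ?thesis by (simp add: integral_unique)
    qed
    have "(h + w) - w = h" for h by simp
    with A B C show ?thesis by (simp only: add.commute[of w])
  qed
  have "Q w h 0 j = ((?n + 1) * \<rho> w / 2) * V (w + h) $ j
      + (\<Sum>k\<in>UNIV. (\<gamma> w $ k / 2) * (h $ j * V (w + h) $ k - h $ k * V (w + h) $ j))" for h
  proof -
    have "(\<Sum>k\<in>UNIV. (\<gamma> w $ k / 2) * (h $ j * V (w + h) $ k - h $ k * V (w + h) $ j))
        = (\<Sum>k\<in>UNIV. (h $ j / 2) * (\<gamma> w $ k * V (w + h) $ k) - (V (w + h) $ j / 2) * (\<gamma> w $ k * h $ k))"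
      by (intro sum.cong refl) (simp add: field_simps)
    also have "\<dots> = (h $ j / 2) * (\<gamma> w \<bullet> V (w + h)) - (V (w + h) $ j / 2) * (\<gamma> w \<bullet> h)"
      by (simp only: sum_subtractf sum_distrib_left[symmetric] tr_inner)
    finally show ?thesis by (simp add: Q_def field_simps)
  qed
  then have "integral (cube 4) (\<lambda>h. Q w h 0 j) = ((?n + 1) * \<rho> w / 2) * integral (cube 4) (\<lambda>h. V (w + h) $ j)
      + (\<Sum>k\<in>UNIV. (\<gamma> w $ k / 2) * integral (cube 4) (\<lambda>h. h $ j * V (w + h) $ k - h $ k * V (w + h) $ j))"
    by (simp only: Henstock_Kurzweil_Integration.integral_add
        Henstock_Kurzweil_Integration.integral_sum I integrable_sum integrable_diff integrable_on_mult_right finite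
        Henstock_Kurzweil_Integration.integral_mult_right)
  then show ?thesis unfolding m0 m1 by simp
next
  case False
  then show ?thesis using supp_\<rho>[of w] by (simp add: Q_def)
qed

definition d\<sigma> where
  "d\<sigma> j k w v = integral (cbox 0 1) (\<lambda>s. integral (cube 4) (\<lambda>h. dkern w h s j k v))"

lemma der_\<sigma>: "(\<sigma> j k has_derivative d\<sigma> j k w) (at w)"
  unfolding \<sigma>_def[abs_def] d\<sigma>_def[abs_def] cube_def
  by (rule has_derivative_integral2(1)[OF C1_kern der_kern])

text \<open>After integration over \<open>h\<close> the divergence of the kernel is
  \<open>dQ\<close>, and integrating that over \<open>s\<close> gives the boundary values of
  \<open>Q\<close>.\<close>

lemma divergence_\<sigma>: "(\<Sum>k\<in>UNIV. d\<sigma> j k w (axis k 1)) = V w $ j"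
proof -
  let ?K = "cbox (- (4 *\<^sub>R One)) (4 *\<^sub>R One) :: (real ^ 'n) set"
  have cK: "continuous_on (cbox 0 1 \<times> ?K) (\<lambda>q. dkern w (snd q) (fst q) j k v)" for k v
    by (rule has_derivative_integral2(2)[OF C1_kern der_kern])
  have slice: "(\<lambda>h. f (s, h)) integrable_on ?K" if "continuous_on (cbox 0 1 \<times> ?K) f" "s \<in> cbox 0 1"
    for f :: "real \<times> (real ^ 'n) \<Rightarrow> real" and s
    by (intro integrable_continuous continuous_on_compose2[OF that(1)] continuous_intros) (use that(2) in auto)
  have iK: "(\<lambda>h. dkern w h s j k v) integrable_on ?K" if "s \<in> cbox 0 1" for s k v
    using slice[OF cK that] by simp
  have cQ: "continuous_on (cbox 0 1 \<times> ?K) (\<lambda>q. dQ w (snd q) (fst q) j)"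
    using integral_param_ftc(2)[OF C1_Q der_Q] by simp
  have iQ: "(\<lambda>h. dQ w h s j) integrable_on ?K" if "s \<in> cbox 0 1" for s
    using slice[OF cQ that] by simp
  have oK: "(\<lambda>s. integral ?K (\<lambda>h. dkern w h s j k v)) integrable_on cbox 0 1" for k v
    using continuous_on_integral_param[OF cK] by (intro integrable_continuous) simp
  have "(\<Sum>k\<in>UNIV. d\<sigma> j k w (axis k 1))
      = integral (cbox 0 1) (\<lambda>s. \<Sum>k\<in>UNIV. integral ?K (\<lambda>h. dkern w h s j k (axis k 1)))"
    unfolding d\<sigma>_def cube_def by (rule Henstock_Kurzweil_Integration.integral_sum[symmetric]) (auto intro: oK[simplified])
  also have "\<dots> = integral (cbox 0 1) (\<lambda>s. integral ?K (\<lambda>h. \<Sum>k\<in>UNIV. dkern w h s j k (axis k 1)))"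
    by (intro integral_cong Henstock_Kurzweil_Integration.integral_sum[symmetric] iK) auto
  also have "\<dots> = integral (cbox 0 1) (\<lambda>s. integral ?K (\<lambda>h. dQ w h s j))"
  \<comment> \<open>The identity \<open>trace_dW\<close> carries the factor \<open>1 - s\<close>, so
    the single parameter \<open>s = 1\<close> is discarded as a null set.\<close>
  proof (rule integral_spike[of "{1}"])
    fix s :: real assume s: "s \<in> cbox 0 1 - {1}"
    have "integral (cube 4) (\<lambda>h. \<Sum>i\<in>UNIV. dW w h s j (axis i 1) $ i) = 0"
    proof (rule integral_divergence_eq_0[OF C1_W der_W, of 3])
      show "W w h s j = 0" if "3 < norm h" for h using support[OF that, of w s] by (auto simp: W_def)
    qed simp
    then have "2 * (1 - s) * integral ?K (\<lambda>h. (\<Sum>k\<in>UNIV. dkern w h s j k (axis k 1)) - dQ w h s j) = 0"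
      unfolding trace_dW cube_def by simp
    then have "integral ?K (\<lambda>h. (\<Sum>k\<in>UNIV. dkern w h s j k (axis k 1)) - dQ w h s j) = 0"
      using s by simp
    moreover have "integral ?K (\<lambda>h. (\<Sum>k\<in>UNIV. dkern w h s j k (axis k 1)) - dQ w h s j)
        = integral ?K (\<lambda>h. \<Sum>k\<in>UNIV. dkern w h s j k (axis k 1)) - integral ?K (\<lambda>h. dQ w h s j)"
      using s by (intro Henstock_Kurzweil_Integration.integral_diff integrable_sum iK iQ) auto
    ultimately show "integral ?K (\<lambda>h. dQ w h s j) = integral ?K (\<lambda>h. \<Sum>k\<in>UNIV. dkern w h s j k (axis k 1))"
      by simp
  qed simp
  also have "\<dots> = integral ?K (\<lambda>h. Q w h 1 j) - integral ?K (\<lambda>h. Q w h 0 j)"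
    using integral_param_ftc(1)[OF C1_Q der_Q] by (simp add: integral_unique)
  also have "\<dots> = V w $ j"
    using integral_Q_1[of w j] integral_Q_0[of w j] by (simp add: cube_def)
  finally show ?thesis .
qed

end

section \<open>Return from the coordinates \<open>y\<close> to the coordinates
  \<open>x\<close>\<close>

lemma kern_scaleR: "kern p g (c *\<^sub>R V) h j k = c * kern p g V h j k"
  by (simp add: kern_def algebra_simps add_divide_distrib diff_divide_distrib)

context near_identity
begin

text \<open>The difference quotient of \<open>g\<close> between \<open>x\<close> and
  \<open>x + (1 - s) *\<^sub>R \<kappa>\<close>, written as an average of the gradient so that it
  remains meaningful and smooth at \<open>s = 1\<close>.\<close>

definition chord :: "real \<Rightarrow> real ^ 'n \<Rightarrow> real ^ 'n \<Rightarrow> real ^ 'n" where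
  "chord s x \<kappa> = integral {0..1} (\<lambda>\<theta>. G (x + (\<theta> * (1 - s)) *\<^sub>R \<kappa>) *v \<kappa>)"

lemma chord_eq: "(1 - s) *\<^sub>R chord s x \<kappa> = g (x + (1 - s) *\<^sub>R \<kappa>) - g x"
proof -
  have "((\<lambda>\<theta>. (1 - s) *\<^sub>R (G (x + (\<theta> * (1 - s)) *\<^sub>R \<kappa>) *v \<kappa>)) has_integral
      g (x + (1 * (1 - s)) *\<^sub>R \<kappa>) - g (x + (0 * (1 - s)) *\<^sub>R \<kappa>)) {0..1}"
  proof (rule fundamental_theorem_of_calculus)
    fix \<theta> :: real
    have "((\<lambda>\<theta>. g (x + (\<theta> * (1 - s)) *\<^sub>R \<kappa>)) has_derivative (\<lambda>v. G (x + (\<theta> * (1 - s)) *\<^sub>R \<kappa>) *v ((v * (1 - s)) *\<^sub>R \<kappa>))) (at \<theta> within {0..1})"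
      by (rule has_derivative_compose[OF _ der]) (auto intro!: derivative_eq_intros)
    then show "((\<lambda>\<theta>. g (x + (\<theta> * (1 - s)) *\<^sub>R \<kappa>)) has_vector_derivative (1 - s) *\<^sub>R (G (x + (\<theta> * (1 - s)) *\<^sub>R \<kappa>) *v \<kappa>)) (at \<theta> within {0..1})"
      by (simp add: has_vector_derivative_def matrix_vector_mult_scaleR)
  qed simp
  then show ?thesis by (simp add: chord_def integral_unique flip: integral_cmul)
qed

text \<open>For \<open>s \<noteq> 1\<close> the chord is \<open>g\<close> recentred at
  \<open>x\<close> and rescaled by \<open>1 - s\<close>, so its gradient is \<open>G\<close> at the
  moved point.\<close>

lemma chord_near_identity:
  assumes s: "s \<noteq> 1" "0 \<le> s" "s \<le> 1"
  shows "near_identity (chord s x) (\<lambda>\<kappa>. G (x + (1 - s) *\<^sub>R \<kappa>)) (\<lambda>\<kappa> i j v. (1 - s) * dG (x + (1 - s) *\<^sub>R \<kappa>) i j v)"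
proof -
  have c: "chord s x = (\<lambda>\<kappa>. (1 / (1 - s)) *\<^sub>R (g (x + (1 - s) *\<^sub>R \<kappa>) - g x))"
    using s by (simp add: chord_eq[symmetric] fun_eq_iff)
  have d: "((\<lambda>\<kappa>. x + (1 - s) *\<^sub>R \<kappa>) has_derivative (\<lambda>v. (1 - s) *\<^sub>R v)) (at \<kappa>)" for \<kappa>
    by (auto intro!: derivative_eq_intros)
  show ?thesis
  proof
    show "chord s x 0 = 0" by (simp add: c)
    show "(chord s x has_derivative (\<lambda>v. G (x + (1 - s) *\<^sub>R \<kappa>) *v v)) (at \<kappa>)" for \<kappa>
    proof -
      have "((\<lambda>\<kappa>. (1 / (1 - s)) *\<^sub>R (g (x + (1 - s) *\<^sub>R \<kappa>) - g x)) has_derivative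
          (\<lambda>v. (1 / (1 - s)) *\<^sub>R (G (x + (1 - s) *\<^sub>R \<kappa>) *v ((1 - s) *\<^sub>R v) - 0))) (at \<kappa>)"
        by (intro has_derivative_scaleR_right has_derivative_diff has_derivative_const has_derivative_compose[OF d der])
      then show ?thesis unfolding c using s by (simp add: matrix_vector_mult_scaleR)
    qed
    show "((\<lambda>\<kappa>. G (x + (1 - s) *\<^sub>R \<kappa>) $ i $ j) has_derivative (\<lambda>v. (1 - s) * dG (x + (1 - s) *\<^sub>R \<kappa>) i j v)) (at \<kappa>)" for \<kappa> i j
      using has_derivative_compose[OF d derG[of i j]] linear_cmul[OF has_derivative_linear[OF derG]] by simp
    show "(1 - s) * dG (x + (1 - s) *\<^sub>R \<kappa>) i j (axis k 1) = (1 - s) * dG (x + (1 - s) *\<^sub>R \<kappa>) i k (axis j 1)" for \<kappa> i j k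
      using dG_sym by simp
    show "Ck_on (Suc 0) UNIV (chord s x)"
      unfolding c by (intro Ck_on_scaleR Ck_on_const Ck_on_diff Ck_on_compose_UNIV[OF C1_g] Ck_on_add Ck_on_ident)
    show "Ck_on (Suc 0) UNIV (\<lambda>\<kappa>. G (x + (1 - s) *\<^sub>R \<kappa>) $ i $ j)" for i j
      by (intro Ck_on_scaleR Ck_on_const Ck_on_compose_UNIV[OF C1_G] Ck_on_add Ck_on_ident)
    show "norm (G (x + (1 - s) *\<^sub>R \<kappa>) *v v - v) \<le> norm v / 4" for \<kappa> v by (rule near)
  qed
qed

end

locale static = near_identity g G dG + weight \<rho> \<gamma> \<eta>
  for g :: "real ^ 'n::finite \<Rightarrow> real ^ 'n" and G dG and \<rho> :: "real ^ 'n \<Rightarrow> real" and \<gamma> \<eta> +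
  fixes U :: "real ^ 'n \<Rightarrow> real ^ 'n"
  assumes C1_U: "Ck_on (Suc 0) UNIV U"
    and supp_U: "\<And>x. 1 \<le> norm x \<Longrightarrow> U x = 0"
    and U_moment0: "\<And>l. integral UNIV (\<lambda>x. U x $ l) = 0"
    and U_moment1: "\<And>j l. integral UNIV (\<lambda>x. g x $ j * U x $ l - g x $ l * U x $ j) = 0"
begin

text \<open>This is \<open>\<sigma> (g x)\<close> after the substitution \<open>h = chord s x \<kappa>\<close>, for which \<open>g x + (1 - s) *\<^sub>R h\<close> is
  \<open>g (x + (1 - s) *\<^sub>R \<kappa>)\<close>; the Jacobian cancels the determinant in \<open>V\<close>, so the inverse of \<open>g\<close> does not occur.\<close>

definition S :: "'n \<Rightarrow> 'n \<Rightarrow> real ^ 'n \<Rightarrow> real" where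
  "S j k x = integral (cbox 0 1) (\<lambda>s. integral (cube 4) (\<lambda>\<kappa>.
     kern (\<rho> (g x - s *\<^sub>R chord s x \<kappa>)) (\<gamma> (g x - s *\<^sub>R chord s x \<kappa>)) (U (x + (1 - s) *\<^sub>R \<kappa>)) (chord s x \<kappa>) j k))"

definition V :: "real ^ 'n \<Rightarrow> real ^ 'n" where
  "V z = (1 / det (G (inv g z))) *\<^sub>R U (inv g z)"

lemma V_g: "V (g x) = (1 / det (G x)) *\<^sub>R U x"
  by (simp add: V_def inv_g)

lemma C1_V: "Ck_on (Suc 0) UNIV V"
  unfolding V_def[abs_def]
  by (intro Ck_on_scaleR Ck_on_divide Ck_on_const Ck_on_compose_UNIV[OF C1_U] C1_inv
      Ck_on_compose_UNIV[OF Ck_on_det[OF C1_G]] det_nonzero)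

lemma supp_V: "2 < norm z \<Longrightarrow> V z = 0"
proof -
  assume "2 < norm z"
  moreover have "norm z \<le> 5 / 4 * norm (inv g z)"
    using expand_bounds(2)[of "inv g z" 0] by (simp add: inv_g g0)
  ultimately have "1 \<le> norm (inv g z)" by linarith
  then show ?thesis by (simp add: V_def supp_U)
qed

text \<open>Tested with 1 and with the coordinate functions, this turns the Lagrangian moments of
  \<open>U\<close> into the ordinary moments of \<open>V\<close>.\<close>

lemma integral_V:
  assumes p: "Ck_on (Suc 0) UNIV p"
  shows "integral UNIV (\<lambda>z. V z $ l * p z) = integral UNIV (\<lambda>x. U x $ l * p (g x))"
proof -
  have "integral (cube 3) (\<lambda>x. (V (g x) $ l * p (g x)) * det (G x)) = integral (cube 3) (\<lambda>z. V z $ l * p z)"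
    by (rule integral_change_of_variables[of "\<lambda>z. V z $ l * p z" 2])
       (auto intro!: Ck_on_mult p Ck_on_nth C1_V simp: supp_V)
  moreover have "(\<lambda>x. (V (g x) $ l * p (g x)) * det (G x)) = (\<lambda>x. U x $ l * p (g x))"
    by (simp add: V_g det_nonzero fun_eq_iff)
  moreover have "integral (cube 3) (\<lambda>z. V z $ l * p z) = integral UNIV (\<lambda>z. V z $ l * p z)"
  proof (rule integral_supported)
    fix z :: "real ^ 'n" assume "z \<notin> cube 3"
    then show "V z $ l * p z = 0" using mem_cube[of z 3] supp_V[of z] by force
  qed
  moreover have "integral (cube 3) (\<lambda>x. U x $ l * p (g x)) = integral UNIV (\<lambda>x. U x $ l * p (g x))"
  proof (rule integral_supported)
    fix z :: "real ^ 'n" assume "z \<notin> cube 3"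
    then show "U z $ l * p (g z) = 0" using mem_cube[of z 3] supp_U[of z] by force
  qed
  ultimately show ?thesis by simp
qed

lemma balanced_V:
  assumes "\<And>z. (V has_derivative V' z) (at z)"
  shows "balanced \<rho> \<gamma> \<eta> V V'"
proof
  show "Ck_on (Suc 0) UNIV V" by (rule C1_V)
  show "(V has_derivative V' z) (at z)" for z by (rule assms)
  show "2 < norm z \<Longrightarrow> V z = 0" for z by (rule supp_V)
  show "integral UNIV (\<lambda>z. V z $ l) = 0" for l
    using integral_V[of "\<lambda>z. 1" l] by (simp add: Ck_on_const U_moment0)
  show "integral UNIV (\<lambda>z. z $ j * V z $ l - z $ l * V z $ j) = 0" for j l
  proof -
    \<comment> \<open>The two halves of the angular moment are transformed separately, so each must
      be integrable by itself.\<close>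
    have i: "(\<lambda>z. V z $ l * z $ j) integrable_on UNIV" for j l
    proof -
      have "continuous_on UNIV (\<lambda>z. V z $ l * z $ j)"
        by (rule Ck_on_continuous[of "Suc 0"]) (intro Ck_on_mult Ck_on_nth C1_V Ck_on_ident)
      then have "(\<lambda>z. V z $ l * z $ j) integrable_on cube 3"
        unfolding cube_def by (rule integrable_continuous[OF continuous_on_subset]) simp
      moreover have "V z $ l * z $ j = 0" if "z \<notin> cube 3" for z
        using that mem_cube[of z 3] supp_V[of z] by force
      ultimately show ?thesis
        by (subst (asm) integrable_restrict_UNIV[symmetric]) (auto elim!: integrable_eq)
    qed
    have iU: "(\<lambda>x. U x $ l * g x $ j) integrable_on UNIV" for j l
    proof -
      have "continuous_on UNIV (\<lambda>x. U x $ l * g x $ j)"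
        by (rule Ck_on_continuous[of "Suc 0"]) (intro Ck_on_mult Ck_on_nth C1_U C1_g)
      then have "(\<lambda>x. U x $ l * g x $ j) integrable_on cube 3"
        unfolding cube_def by (rule integrable_continuous[OF continuous_on_subset]) simp
      moreover have "U x $ l * g x $ j = 0" if "x \<notin> cube 3" for x
        using that mem_cube[of x 3] supp_U[of x] by force
      ultimately show ?thesis
        by (subst (asm) integrable_restrict_UNIV[symmetric]) (auto elim!: integrable_eq)
    qed
    have e: "integral UNIV (\<lambda>z. V z $ l * z $ j) = integral UNIV (\<lambda>x. U x $ l * g x $ j)" for j l
      by (rule integral_V) (intro Ck_on_nth Ck_on_ident)
    have "integral UNIV (\<lambda>z. z $ j * V z $ l - z $ l * V z $ j) = integral UNIV (\<lambda>z. V z $ l * z $ j) - integral UNIV (\<lambda>z. V z $ j * z $ l)"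
      using Henstock_Kurzweil_Integration.integral_diff[OF i i] by (simp add: mult.commute)
    also have "\<dots> = integral UNIV (\<lambda>x. g x $ j * U x $ l - g x $ l * U x $ j)"
      unfolding e using Henstock_Kurzweil_Integration.integral_diff[OF iU iU] by (simp add: mult.commute)
    finally show ?thesis by (simp add: U_moment1)
  qed
qed

lemma S_eq_\<sigma>:
  assumes "\<And>z. (V has_derivative V' z) (at z)"
  shows "S j k x = balanced.\<sigma> \<rho> \<gamma> V j k (g x)"
proof -
  interpret balanced \<rho> \<gamma> \<eta> V V' by (rule balanced_V[OF assms])
  have "integral (cube 4) (\<lambda>h. kern (\<rho> (g x - s *\<^sub>R h)) (\<gamma> (g x - s *\<^sub>R h)) (V (g x + (1 - s) *\<^sub>R h)) h j k) =
    integral (cube 4) (\<lambda>\<kappa>. kern (\<rho> (g x - s *\<^sub>R chord s x \<kappa>)) (\<gamma> (g x - s *\<^sub>R chord s x \<kappa>)) (U (x + (1 - s) *\<^sub>R \<kappa>)) (chord s x \<kappa>) j k)"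
    if s: "s \<in> cbox 0 1 - {1}" for s
  proof -
    let ?f = "\<lambda>h. kern (\<rho> (g x - s *\<^sub>R h)) (\<gamma> (g x - s *\<^sub>R h)) (V (g x + (1 - s) *\<^sub>R h)) h j k"
    interpret H: near_identity "chord s x" "\<lambda>\<kappa>. G (x + (1 - s) *\<^sub>R \<kappa>)" "\<lambda>\<kappa> i j v. (1 - s) * dG (x + (1 - s) *\<^sub>R \<kappa>) i j v"
      by (rule chord_near_identity) (use s in auto)
    have "integral (cube 4) (\<lambda>\<kappa>. ?f (chord s x \<kappa>) * det (G (x + (1 - s) *\<^sub>R \<kappa>))) = integral (cube 4) ?f"
    \<comment> \<open>The radius 3 of \<open>support\<close>, enlarged by the factor 4/3, is exactly
      the half side 4 of the cube.\<close>
    proof (rule H.integral_change_of_variables[of _ 3])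
      show "Ck_on (Suc 0) UNIV ?f" unfolding kern_def by (intro C1_intros)
      show "?f h = 0" if "3 < norm h" for h using support[OF that, of "g x" s] by auto
    qed simp
    moreover have "?f (chord s x \<kappa>) * det (G (x + (1 - s) *\<^sub>R \<kappa>)) =
        kern (\<rho> (g x - s *\<^sub>R chord s x \<kappa>)) (\<gamma> (g x - s *\<^sub>R chord s x \<kappa>)) (U (x + (1 - s) *\<^sub>R \<kappa>)) (chord s x \<kappa>) j k" for \<kappa>
      using det_nonzero by (simp add: chord_eq V_g kern_scaleR)
    ultimately show ?thesis by simp
  qed
  then show ?thesis
    unfolding S_def \<sigma>_def by (rule integral_spike[of "{1}", OF negligible_sing])
qed

text \<open>This is \<open>J F\<^sup>-\<^sup>1 S F\<^sup>-\<^sup>T\<close> with both inverses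
  written as cofactors over determinant, which leaves one power of \<open>det (G x)\<close> in the
  denominator.\<close>

definition R :: "real ^ 'n \<Rightarrow> real ^ 'n ^ 'n" where
  "R x = (\<chi> a b. (1 / det (G x)) * (\<Sum>i\<in>UNIV. \<Sum>k\<in>UNIV. cof (G x) i a * S i k x * cof (G x) k b))"

lemma G_R: "(G x ** R x) $ l $ b = (\<Sum>k\<in>UNIV. S l k x * cof (G x) k b)"
proof -
  have "(G x ** R x) $ l $ b = (1 / det (G x)) * (\<Sum>a\<in>UNIV. \<Sum>i\<in>UNIV. \<Sum>k\<in>UNIV. (G x $ l $ a * cof (G x) i a) * (S i k x * cof (G x) k b))"
    by (simp add: matrix_matrix_mult_def R_def sum_distrib_left sum_divide_distrib mult_ac)
  also have "(\<Sum>a\<in>UNIV. \<Sum>i\<in>UNIV. \<Sum>k\<in>UNIV. (G x $ l $ a * cof (G x) i a) * (S i k x * cof (G x) k b))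
      = (\<Sum>i\<in>UNIV. (\<Sum>a\<in>UNIV. G x $ l $ a * cof (G x) i a) * (\<Sum>k\<in>UNIV. S i k x * cof (G x) k b))"
    by (subst sum.swap) (simp only: sum_distrib_left[symmetric] sum_distrib_right[symmetric])
  also have "\<dots> = det (G x) * (\<Sum>k\<in>UNIV. S l k x * cof (G x) k b)"
    by (simp add: sum_row_cof if_distrib[of "\<lambda>u. u * _"] cong: if_cong)
  finally show ?thesis using det_nonzero by simp
qed

text \<open>By \<open>piola\<close> the derivative falls on \<open>S\<close> alone;
  \<open>sum_derivative_cof\<close> then produces \<open>det (G x)\<close> times the divergence of
  \<open>\<sigma>\<close> at \<open>g x\<close>, and the determinant cancels the one in
  \<open>V\<close>.\<close>

lemma divergence_G_R:
  obtains D where "\<And>b. ((\<lambda>x. (G x ** R x) $ l $ b) has_derivative D b) (at x)"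
    "(\<Sum>b\<in>UNIV. D b (axis b 1)) = U x $ l"
proof -
  obtain V' where V': "\<And>z. z \<in> UNIV \<Longrightarrow> (V has_derivative V' z) (at z within UNIV)"
    using C1_V by (rule Ck_on_SucE) (rule that)
  then have dV: "(V has_derivative V' z) (at z)" for z by simp
  interpret balanced \<rho> \<gamma> \<eta> V V' by (rule balanced_V[OF dV])
  let ?D = "\<lambda>b v. \<Sum>k\<in>UNIV. S l k x * dcof x k b v + d\<sigma> l k (g x) (G x *v v) * cof (G x) k b"
  have dS: "(S l k has_derivative (\<lambda>v. d\<sigma> l k (g x) (G x *v v))) (at x)" for k
    unfolding S_eq_\<sigma>[OF dV, abs_def] by (rule has_derivative_compose[OF der der_\<sigma>])
  have D: "((\<lambda>x. (G x ** R x) $ l $ b) has_derivative ?D b) (at x)" for b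
    unfolding G_R by (intro has_derivative_sum has_derivative_mult has_derivative_cof dS)
  have "(\<Sum>b\<in>UNIV. ?D b (axis b 1)) =
      (\<Sum>k\<in>UNIV. S l k x * (\<Sum>b\<in>UNIV. dcof x k b (axis b 1)) + (\<Sum>b\<in>UNIV. d\<sigma> l k (g x) (G x *v axis b 1) * cof (G x) k b))"
    by (subst sum.swap) (simp add: sum.distrib sum_distrib_left)
  also have "\<dots> = (\<Sum>k\<in>UNIV. d\<sigma> l k (g x) (axis k 1) * det (G x))"
    by (simp add: piola sum_derivative_cof has_derivative_linear[OF der_\<sigma>])
  also have "\<dots> = U x $ l"
    using det_nonzero[of x] by (simp add: sum_distrib_right[symmetric] divergence_\<sigma> V_g)
  finally show ?thesis using that[OF D] by blast
qed

text \<open>\<open>g x\<close> is the convex combination of the end point with weight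
  \<open>s\<close> and the base point with weight \<open>1 - s\<close>. If the kernel is nonzero,
  both lie in the ball of radius \<open>m\<close>, which is convex.\<close>

lemma S_support:
  assumes m: "\<And>x. U x \<noteq> 0 \<Longrightarrow> norm (g x) \<le> m" "1 / 2 \<le> m" and x: "m < norm (g x)"
  shows "S j k x = 0"
proof -
  have "kern (\<rho> (g x - s *\<^sub>R chord s x \<kappa>)) (\<gamma> (g x - s *\<^sub>R chord s x \<kappa>)) (U (x + (1 - s) *\<^sub>R \<kappa>)) (chord s x \<kappa>) j k = 0"
    if s: "s \<in> cbox 0 1" for s \<kappa>
  proof (rule ccontr)
    assume *: "\<not> ?thesis"
    then have "U (x + (1 - s) *\<^sub>R \<kappa>) \<noteq> 0" by auto
    then have 1: "norm (g x + (1 - s) *\<^sub>R chord s x \<kappa>) \<le> m" using m(1) by (simp add: chord_eq)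
    have "norm (g x - s *\<^sub>R chord s x \<kappa>) \<le> 1 / 2"
      using * supp_\<rho>[of "g x - s *\<^sub>R chord s x \<kappa>"] by force
    then have 2: "norm (g x - s *\<^sub>R chord s x \<kappa>) \<le> m" using m(2) by linarith
    have "g x = s *\<^sub>R (g x + (1 - s) *\<^sub>R chord s x \<kappa>) + (1 - s) *\<^sub>R (g x - s *\<^sub>R chord s x \<kappa>)"
      by (simp add: algebra_simps)
    moreover have "norm \<dots> \<le> s * m + (1 - s) * m"
      by (rule norm_triangle_le) (use s 1 2 in \<open>auto intro!: add_mono mult_left_mono\<close>)
    ultimately have "norm (g x) \<le> m" by (simp add: algebra_simps)
    then show False using x by simp
  qed
  then have "S j k x = integral (cbox 0 1) (\<lambda>s::real. 0)"
    unfolding S_def by (intro integral_cong) simp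
  then show ?thesis by simp
qed

end

subsection \<open>Partial derivatives of smooth fields\<close>

definition pd :: "real set \<Rightarrow> 'n option \<Rightarrow> (real \<Rightarrow> real ^ 'n::finite \<Rightarrow> 'b::real_normed_vector)
    \<Rightarrow> real \<Rightarrow> real ^ 'n \<Rightarrow> 'b" where
  "pd I c f = (case c of None \<Rightarrow> dt I f | Some j \<Rightarrow> dx j f)"

definition dir :: "'n option \<Rightarrow> real \<times> (real ^ 'n::finite)" where
  "dir c = (case c of None \<Rightarrow> (1, 0) | Some j \<Rightarrow> (0, axis j 1))"

lemma smooth_field_iff: "smooth_field I f \<longleftrightarrow> (\<forall>k. Ck_on k (I \<times> UNIV) (\<lambda>z. f (fst z) (snd z)))"
  unfolding smooth_field_def by (simp add: split_beta')

lemma smooth_field_cong: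
  "smooth_field I f \<Longrightarrow> (\<And>t x. t \<in> I \<Longrightarrow> f t x = g t x) \<Longrightarrow> smooth_field I g"
  unfolding smooth_field_iff by (intro allI, rule Ck_on_cong[of _ _ "\<lambda>z. f (fst z) (snd z)"]) auto

lemma dx_eqI: "(f t has_derivative f') (at x) \<Longrightarrow> dx j f t x = f' (axis j 1)"
  unfolding dx_def by (simp add: frechet_derivative_at[symmetric])

lemma linear_scale_fst:
  assumes "linear L"
  shows "(\<lambda>v::real. L (v, 0)) = (\<lambda>v. v *\<^sub>R L (1, 0))"
proof
  fix v :: real
  show "L (v, 0) = v *\<^sub>R L (1, 0)" using linear_cmul[OF assms, of v "(1, 0)"] by simp
qed

locale time_range =
  fixes I :: "real set"
  assumes nondegenerate: "\<exists>a b. a < b \<and> I = {a..b}"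
begin

lemma convex_I: "convex I"
  using nondegenerate by auto

lemma convex_S: "convex (I \<times> (UNIV :: (real ^ 'n) set))"
  by (simp add: convex_I convex_Times)

lemma at_within_I: "t \<in> I \<Longrightarrow> at t within I \<noteq> bot"
  using nondegenerate islimpt_Icc trivial_limit_within by metis

lemma dt_eqI:
  assumes "((\<lambda>s. f s x) has_vector_derivative d) (at t within I)" "t \<in> I"
  shows "dt I f t x = d"
  unfolding dt_def using assms at_within_I vector_derivative_within by blast

text \<open>Partial derivatives are read off the joint derivative in the direction
  \<open>dir c\<close>; the rules for \<open>pd\<close> below thereby reduce to those for
  \<open>has_derivative\<close>.\<close>

lemma pd_eqI:
  fixes f :: "real \<Rightarrow> real ^ 'n::finite \<Rightarrow> 'b::real_normed_vector"
  assumes d: "((\<lambda>z. f (fst z) (snd z)) has_derivative F') (at (t, x) within I \<times> UNIV)" and t: "t \<in> I"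
  shows "pd I c f t x = F' (dir c)"
proof (cases c)
  case None
  have "((\<lambda>s. f (fst (s, x)) (snd (s, x))) has_derivative (\<lambda>v. F' (v, 0))) (at t within I)"
    using has_derivative_partial[OF d] by simp
  moreover have "(\<lambda>v. F' (v, 0)) = (\<lambda>v. v *\<^sub>R F' (1, 0))"
    by (rule linear_scale_fst[OF has_derivative_linear[OF d]])
  ultimately have "((\<lambda>s. f s x) has_vector_derivative F' (1, 0)) (at t within I)"
    unfolding has_vector_derivative_def by simp
  then show ?thesis using dt_eqI t by (simp add: None pd_def dir_def)
next
  case (Some j)
  have "((\<lambda>x. f (fst (t, x)) (snd (t, x))) has_derivative (\<lambda>v. F' (0, v))) (at x within UNIV)"
  proof (rule has_derivative_in_compose[of "\<lambda>x. (t, x)" "\<lambda>v. (0, v)"])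
    show "((\<lambda>z. f (fst z) (snd z)) has_derivative F') (at (t, x) within range (Pair t))"
      by (rule has_derivative_subset[OF d]) (use t in auto)
  qed (auto intro!: derivative_eq_intros)
  then show ?thesis using dx_eqI[of f t "\<lambda>v. F' (0, v)" x] by (simp add: Some pd_def dir_def)
qed

lemma smooth_field_derivative:
  fixes f :: "real \<Rightarrow> real ^ 'n::finite \<Rightarrow> 'b::real_normed_vector"
  assumes "smooth_field I f"
  obtains F' where "\<And>t x. t \<in> I \<Longrightarrow> ((\<lambda>z. f (fst z) (snd z)) has_derivative F' t x) (at (t, x) within I \<times> UNIV)"
    "\<And>t x c. t \<in> I \<Longrightarrow> F' t x (dir c) = pd I c f t x"
proof -
  have "Ck_on (Suc 0) (I \<times> UNIV) (\<lambda>z. f (fst z) (snd z))"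
    using assms by (simp add: smooth_field_iff)
  then obtain F' where F: "\<And>z. z \<in> I \<times> UNIV \<Longrightarrow> ((\<lambda>z. f (fst z) (snd z)) has_derivative F' z) (at z within I \<times> UNIV)"
    by (rule Ck_on_SucE) (rule that)
  then have F2: "((\<lambda>z. f (fst z) (snd z)) has_derivative F' (t, x)) (at (t, x) within I \<times> UNIV)" if "t \<in> I" for t x
    using that by simp
  show ?thesis
    by (rule that[of "\<lambda>t x. F' (t, x)"]) (use F2 pd_eqI[OF F2] in simp_all)
qed

lemma smooth_field_derivative_at:
  fixes f :: "real \<Rightarrow> real ^ 'n::finite \<Rightarrow> 'b::real_normed_vector"
  assumes "smooth_field I f" "t \<in> I"
  obtains F' where "((\<lambda>z. f (fst z) (snd z)) has_derivative F') (at (t, x) within I \<times> UNIV)"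
    "\<And>c. F' (dir c) = pd I c f t x"
proof -
  obtain F' where F: "\<And>t x. t \<in> I \<Longrightarrow> ((\<lambda>z. f (fst z) (snd z)) has_derivative F' t x) (at (t, x) within I \<times> UNIV)"
    "\<And>t x c. t \<in> I \<Longrightarrow> F' t x (dir c) = pd I c f t x"
    by (rule smooth_field_derivative[OF assms(1)]) (rule that)
  show ?thesis by (rule that[OF F(1)[OF assms(2)] F(2)[OF assms(2)]])
qed

lemma pd_cong:
  fixes f :: "real \<Rightarrow> real ^ 'n::finite \<Rightarrow> 'b::real_normed_vector"
  assumes "\<And>t x. t \<in> I \<Longrightarrow> f t x = g t x" "t \<in> I"
  shows "pd I c f t x = pd I c g t x"
proof (cases c)
  case None
  have "((\<lambda>s. f s x) has_vector_derivative d) (at t within I) = ((\<lambda>s. g s x) has_vector_derivative d) (at t within I)" for d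
    using has_vector_derivative_transform[of t I "\<lambda>s. f s x" "\<lambda>s. g s x"]
      has_vector_derivative_transform[of t I "\<lambda>s. g s x" "\<lambda>s. f s x"] assms by metis
  then show ?thesis by (simp add: None pd_def dt_def vector_derivative_def)
next
  case (Some j)
  have "f t = g t" using assms by auto
  then show ?thesis by (simp add: Some pd_def dx_def)
qed

lemma smooth_field_pd:
  fixes f :: "real \<Rightarrow> real ^ 'n::finite \<Rightarrow> 'b::real_normed_vector"
  assumes "smooth_field I f"
  shows "smooth_field I (pd I c f)"
  unfolding smooth_field_iff
proof
  fix k
  have "Ck_on (Suc k) (I \<times> UNIV) (\<lambda>z. f (fst z) (snd z))"
    using assms by (simp add: smooth_field_iff)
  then obtain F' where F: "\<And>z. z \<in> I \<times> UNIV \<Longrightarrow> ((\<lambda>z. f (fst z) (snd z)) has_derivative F' z) (at z within I \<times> UNIV)"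
    "\<And>v. Ck_on k (I \<times> UNIV) (\<lambda>z. F' z v)"
    by (rule Ck_on_SucE) (rule that)
  show "Ck_on k (I \<times> UNIV) (\<lambda>z. pd I c f (fst z) (snd z))"
  proof (rule Ck_on_cong[OF F(2)[of "dir c"]])
    fix z :: "real \<times> (real ^ 'n)" assume z: "z \<in> I \<times> UNIV"
    show "F' z (dir c) = pd I c f (fst z) (snd z)"
      using pd_eqI[of f "F' z" "fst z" "snd z" c] F(1)[OF z] z by auto
  qed
qed

lemma slice_derivative:
  fixes f :: "real \<Rightarrow> real ^ 'n::finite \<Rightarrow> 'b::real_normed_vector"
  assumes f: "smooth_field I f" and t: "t \<in> I"
  shows "(f t has_derivative (\<lambda>v. \<Sum>j\<in>UNIV. v $ j *\<^sub>R dx j f t x)) (at x)"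
proof -
  obtain F' where F: "((\<lambda>z. f (fst z) (snd z)) has_derivative F') (at (t, x) within I \<times> UNIV)"
    "\<And>c. F' (dir c) = pd I c f t x"
    by (rule smooth_field_derivative_at[OF assms]) (rule that)
  have "((\<lambda>x. f (fst (t, x)) (snd (t, x))) has_derivative (\<lambda>v. F' (0, v))) (at x within UNIV)"
    by (rule has_derivative_in_compose[of "\<lambda>x. (t, x)" "\<lambda>v. (0, v)"])
       (use F(1) t in \<open>auto intro!: derivative_eq_intros intro: has_derivative_subset\<close>)
  moreover have "F' (0, v) = (\<Sum>j\<in>UNIV. v $ j *\<^sub>R dx j f t x)" for v
  proof -
    note lin = has_derivative_linear[OF F(1)]
    have l0: "linear (\<lambda>v. F' (0, v))"
      using linear_compose[OF bounded_linear.linear[OF bounded_linear_Pair[OF bounded_linear_zero bounded_linear_ident]] lin]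
      by (simp add: o_def)
    have "F' (0, v) = F' (0, \<Sum>j\<in>UNIV. v $ j *\<^sub>R axis j 1)"
      using basis_expansion[of v] by (simp add: scalar_mult_eq_scaleR)
    also have "\<dots> = (\<Sum>j\<in>UNIV. v $ j *\<^sub>R F' (0, axis j 1))"
      using linear_sum[OF l0, of "\<lambda>j. v $ j *\<^sub>R axis j 1" UNIV] linear_cmul[OF l0] by simp
    also have "\<dots> = (\<Sum>j\<in>UNIV. v $ j *\<^sub>R dx j f t x)"
      using F(2)[of "Some _"] by (simp add: dir_def pd_def)
    finally show ?thesis .
  qed
  ultimately show ?thesis by simp
qed

lemma dx_along_line:
  fixes f :: "real \<Rightarrow> real ^ 'n::finite \<Rightarrow> 'b::real_normed_vector"
  assumes "smooth_field I f" "t \<in> I"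
  shows "((\<lambda>b. f t (x + b *\<^sub>R axis j 1)) has_vector_derivative dx j f t (x + b *\<^sub>R axis j 1)) (at b within S)"
proof -
  have "((\<lambda>b. f t (x + b *\<^sub>R axis j 1)) has_derivative
      (\<lambda>v. \<Sum>i\<in>UNIV. (v *\<^sub>R axis j 1) $ i *\<^sub>R dx i f t (x + b *\<^sub>R axis j 1))) (at b within S)"
    by (rule has_derivative_compose[of "\<lambda>b. x + b *\<^sub>R axis j 1" "\<lambda>v. v *\<^sub>R axis j 1", OF _ slice_derivative[OF assms]])
       (auto intro!: derivative_eq_intros)
  then show ?thesis
    by (simp add: has_vector_derivative_def axis_def if_distrib[of "\<lambda>u. _ * u"] if_distrib[of "\<lambda>u. u *\<^sub>R _"] cong: if_cong)
qed

lemma dt_along_time: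
  fixes f :: "real \<Rightarrow> real ^ 'n::finite \<Rightarrow> 'b::real_normed_vector"
  assumes "smooth_field I f" "t \<in> I"
  shows "((\<lambda>s. f s x) has_vector_derivative dt I f t x) (at t within I)"
proof -
  obtain F' where F: "((\<lambda>z. f (fst z) (snd z)) has_derivative F') (at (t, x) within I \<times> UNIV)"
    "\<And>c. F' (dir c) = pd I c f t x"
    by (rule smooth_field_derivative_at[OF assms]) (rule that)
  have "((\<lambda>s. f s x) has_derivative (\<lambda>v. F' (v, 0))) (at t within I)"
    using has_derivative_partial[OF F(1)] by simp
  then show ?thesis
    using F(2)[of None] unfolding linear_scale_fst[OF has_derivative_linear[OF F(1)]] has_vector_derivative_def
    by (simp add: dir_def pd_def)
qed

lemma smooth_field_continuous:
  "smooth_field I f \<Longrightarrow> continuous_on (I \<times> UNIV) (\<lambda>z. f (fst z) (snd z))"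
  unfolding smooth_field_iff using Ck_on_continuous by blast

text \<open>\<open>mixed_derivatives_eq\<close> with time as the first variable and the unit segment
  from \<open>x\<close> in direction \<open>j\<close> as the second; time derivatives are taken
  within \<open>I\<close>, so its end points are covered.\<close>

lemma pd_comm:
  fixes f :: "real \<Rightarrow> real ^ 'n::finite \<Rightarrow> 'b::euclidean_space"
  assumes f: "smooth_field I f" and t: "t \<in> I"
  shows "dx j (dt I f) t x = dt I (dx j f) t x"
proof -
  have sm: "smooth_field I (dt I f)" "smooth_field I (dx j f)"
    using smooth_field_pd[OF f, of None] smooth_field_pd[OF f, of "Some j"] by (simp_all add: pd_def)
  have sm2: "smooth_field I (dt I (dx j f))"
    using smooth_field_pd[OF sm(2), of None] by (simp add: pd_def)
  have "dx j (dt I f) t (x + 0 *\<^sub>R axis j 1) = dt I (dx j f) t (x + 0 *\<^sub>R axis j 1)"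
  proof (rule mixed_derivatives_eq[of I "\<lambda>a b. f a (x + b *\<^sub>R axis j 1)" "\<lambda>a b. dx j f a (x + b *\<^sub>R axis j 1)"
        "\<lambda>b. dt I f t (x + b *\<^sub>R axis j 1)" t "\<lambda>a b. dt I (dx j f) a (x + b *\<^sub>R axis j 1)"])
    show "continuous_on (I \<times> {0..1}) (\<lambda>(a, b). dt I (dx j f) a (x + b *\<^sub>R axis j 1))"
    proof -
      have "continuous_on (I \<times> {0..1}) (\<lambda>z. dt I (dx j f) (fst (fst z, x + snd z *\<^sub>R axis j 1)) (snd (fst z, x + snd z *\<^sub>R axis j 1)))"
        by (rule continuous_on_compose2[OF smooth_field_continuous[OF sm2], of _ "\<lambda>z. (fst z, x + snd z *\<^sub>R axis j 1)"])
           (auto intro!: continuous_on_Pair continuous_on_add continuous_on_scaleR continuous_on_fst continuous_on_snd continuous_on_const continuous_on_id)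
      then show ?thesis by (simp add: split_beta')
    qed
    show "continuous_on {0..1} (\<lambda>b. dx j f a (x + b *\<^sub>R axis j 1))" if "a \<in> I" for a
      by (rule continuous_on_vector_derivative) (rule dx_along_line[OF sm(2) that])
    show "((\<lambda>b. dt I f t (x + b *\<^sub>R axis j 1)) has_vector_derivative dx j (dt I f) t (x + 0 *\<^sub>R axis j 1)) (at 0 within {0..1})"
      by (rule dx_along_line[OF sm(1) t])
    show "at t within I \<noteq> bot" by (rule at_within_I[OF t])
  qed (rule dx_along_line[OF f], assumption, rule dt_along_time[OF f t], rule dt_along_time[OF sm(2)], assumption, rule convex_I, rule t)
  then show ?thesis by simp
qed

lemma dx_comm:
  fixes f :: "real \<Rightarrow> real ^ 'n::finite \<Rightarrow> 'b::euclidean_space"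
  assumes f: "smooth_field I f" and t: "t \<in> I"
  shows "dx j (dx k f) t x = dx k (dx j f) t x"
proof -
  have sm: "smooth_field I (dx k f)" "smooth_field I (dx j f)"
    using smooth_field_pd[OF f, of "Some k"] smooth_field_pd[OF f, of "Some j"] by (simp_all add: pd_def)
  have sm2: "smooth_field I (dx k (dx j f))"
    using smooth_field_pd[OF sm(2), of "Some k"] by (simp add: pd_def)
  let ?p = "\<lambda>a b. x + b *\<^sub>R axis j 1 + a *\<^sub>R axis k 1 :: real ^ 'n"
  have swap: "?p a b = (x + a *\<^sub>R axis k 1) + b *\<^sub>R axis j 1" for a b by simp
  have d: "((\<lambda>b. g t (?p a b)) has_vector_derivative dx j g t (?p a b)) (at b within {0..1})"
    if "smooth_field I g" for g :: "real \<Rightarrow> real ^ 'n \<Rightarrow> 'b" and a b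
    unfolding swap by (rule dx_along_line[OF that t])
  have "dx j (dx k f) t (?p 0 0) = dx k (dx j f) t (?p 0 0)"
  proof (rule mixed_derivatives_eq[of "{0..1}" "\<lambda>a b. f t (?p a b)" "\<lambda>a b. dx j f t (?p a b)"
        "\<lambda>b. dx k f t (?p 0 b)" 0 "\<lambda>a b. dx k (dx j f) t (?p a b)"])
    show "continuous_on ({0..1} \<times> {0..1}) (\<lambda>(a, b). dx k (dx j f) t (?p a b))"
    proof -
      have "continuous_on ({0..1} \<times> {0..1}) (\<lambda>z. dx k (dx j f) (fst (t, ?p (fst z) (snd z))) (snd (t, ?p (fst z) (snd z))))"
        by (rule continuous_on_compose2[OF smooth_field_continuous[OF sm2], of _ "\<lambda>z. (t, ?p (fst z) (snd z))"])
           (use t in \<open>auto intro!: continuous_on_Pair continuous_on_add continuous_on_scaleR continuous_on_fst continuous_on_snd continuous_on_const continuous_on_id\<close>)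
      then show ?thesis by (simp add: split_beta')
    qed
    show "((\<lambda>b. f t (?p a b)) has_vector_derivative dx j f t (?p a b)) (at b within {0..1})" for a b
      by (rule d[OF f])
    show "continuous_on {0..1} (\<lambda>b. dx j f t (?p a b))" for a
      by (rule continuous_on_vector_derivative) (rule d[OF sm(2)])
    show "((\<lambda>b. dx k f t (?p 0 b)) has_vector_derivative dx j (dx k f) t (?p 0 0)) (at 0 within {0..1})"
      by (rule d[OF sm(1)])
    show "at (0::real) within {0..1} \<noteq> bot" by (simp add: trivial_limit_within)
    show "((\<lambda>a. f t (?p a b)) has_vector_derivative dx k f t (?p 0 b)) (at 0 within {0..1})" for b
      by (rule dx_along_line[OF f t])
    show "((\<lambda>a. dx j f t (?p a b)) has_vector_derivative dx k (dx j f) t (?p a b)) (at a within {0..1})" for a b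
      by (rule dx_along_line[OF sm(2) t])
  qed auto
  then show ?thesis by simp
qed

lemma smooth_field_const: "smooth_field I (\<lambda>t x. c)"
  by (simp add: smooth_field_iff Ck_on_const)

lemma smooth_field_add: "smooth_field I f \<Longrightarrow> smooth_field I g \<Longrightarrow> smooth_field I (\<lambda>t x. f t x + g t x)"
  by (simp add: smooth_field_iff Ck_on_add)

lemma smooth_field_mult:
  fixes f g :: "real \<Rightarrow> real ^ 'n::finite \<Rightarrow> real"
  shows "smooth_field I f \<Longrightarrow> smooth_field I g \<Longrightarrow> smooth_field I (\<lambda>t x. f t x * g t x)"
  by (simp add: smooth_field_iff Ck_on_mult)

lemma pd_const:
  assumes "t \<in> I" shows "pd I k (\<lambda>t x. c) t x = (0 :: 'b::real_normed_vector)"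
  using pd_eqI[OF _ assms, of "\<lambda>t x. c" "\<lambda>_. 0"] by simp

lemma pd_add:
  assumes "smooth_field I f" "smooth_field I g" "t \<in> I"
  shows "pd I k (\<lambda>t x. f t x + g t x) t x = pd I k f t x + pd I k g t x"
proof -
  obtain F' where F: "((\<lambda>z. f (fst z) (snd z)) has_derivative F') (at (t, x) within I \<times> UNIV)" "F' (dir k) = pd I k f t x"
    by (rule smooth_field_derivative_at[OF assms(1,3)]) (rule that)
  obtain G' where G: "((\<lambda>z. g (fst z) (snd z)) has_derivative G') (at (t, x) within I \<times> UNIV)" "G' (dir k) = pd I k g t x"
    by (rule smooth_field_derivative_at[OF assms(2,3)]) (rule that)
  show ?thesis
    using pd_eqI[OF has_derivative_add[OF F(1) G(1)] assms(3)] F G by simp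
qed

lemma pd_mult:
  fixes f g :: "real \<Rightarrow> real ^ 'n::finite \<Rightarrow> real"
  assumes "smooth_field I f" "smooth_field I g" "t \<in> I"
  shows "pd I k (\<lambda>t x. f t x * g t x) t x = pd I k f t x * g t x + f t x * pd I k g t x"
proof -
  obtain F' where F: "((\<lambda>z. f (fst z) (snd z)) has_derivative F') (at (t, x) within I \<times> UNIV)" "F' (dir k) = pd I k f t x"
    by (rule smooth_field_derivative_at[OF assms(1,3)]) (rule that)
  obtain G' where G: "((\<lambda>z. g (fst z) (snd z)) has_derivative G') (at (t, x) within I \<times> UNIV)" "G' (dir k) = pd I k g t x"
    by (rule smooth_field_derivative_at[OF assms(2,3)]) (rule that)
  show ?thesis
    using pd_eqI[OF has_derivative_mult[OF F(1) G(1)] assms(3)] F G by (simp add: add.commute)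
qed

lemma smooth_field_tower:
  fixes f :: "real \<Rightarrow> real ^ 'n::finite \<Rightarrow> real"
  assumes g: "\<And>m x. x \<in> A \<Longrightarrow> (g m has_real_derivative g (Suc m) x) (at x within A)"
    and f: "smooth_field I f" "\<And>t x. t \<in> I \<Longrightarrow> f t x \<in> A"
  shows "smooth_field I (\<lambda>t x. g m (f t x))"
  unfolding smooth_field_iff
proof
  fix k
  have "Ck_on k A (g m)" by (rule Ck_on_tower) (rule g)
  then show "Ck_on k (I \<times> UNIV) (\<lambda>z. g m (f (fst z) (snd z)))"
    by (rule Ck_on_compose) (use f in \<open>auto simp: smooth_field_iff\<close>)
qed

lemma pd_tower:
  fixes f :: "real \<Rightarrow> real ^ 'n::finite \<Rightarrow> real"
  assumes g: "\<And>m x. x \<in> A \<Longrightarrow> (g m has_real_derivative g (Suc m) x) (at x within A)"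
    and f: "smooth_field I f" "\<And>t x. t \<in> I \<Longrightarrow> f t x \<in> A" and t: "t \<in> I"
  shows "pd I k (\<lambda>t x. g m (f t x)) t x = g (Suc m) (f t x) * pd I k f t x"
proof -
  obtain F' where F: "((\<lambda>z. f (fst z) (snd z)) has_derivative F') (at (t, x) within I \<times> UNIV)" "F' (dir k) = pd I k f t x"
    by (rule smooth_field_derivative_at[OF f(1) t]) (rule that)
  have "(g m has_derivative (*) (g (Suc m) (f t x))) (at (f t x) within (\<lambda>z. f (fst z) (snd z)) ` (I \<times> UNIV))"
    by (rule has_derivative_subset[OF g[OF f(2)[OF t], unfolded has_field_derivative_def]]) (use f(2) in auto)
  then have "((\<lambda>z. g m (f (fst z) (snd z))) has_derivative (\<lambda>v. g (Suc m) (f t x) * F' v)) (at (t, x) within I \<times> UNIV)"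
    using has_derivative_in_compose[OF F(1), of "g m" "(*) (g (Suc m) (f t x))"] by simp
  then show ?thesis
    using pd_eqI[of "\<lambda>t x. g m (f t x)" "\<lambda>v. g (Suc m) (f t x) * F' v" t x k] t F(2) by simp
qed

lemma smooth_field_affine:
  fixes f :: "real \<Rightarrow> real ^ 'n::finite \<Rightarrow> 'b::real_normed_vector"
  assumes "smooth_field I f"
  shows "smooth_field I (\<lambda>t x. f t (\<alpha> *\<^sub>R x + c))"
  unfolding smooth_field_iff
proof
  fix k
  have "Ck_on k (I \<times> UNIV) (\<lambda>z. (fst z, \<alpha> *\<^sub>R snd z + c) :: real \<times> (real ^ 'n))"
    by (intro Ck_on_Pair Ck_on_add Ck_on_scaleR Ck_on_const Ck_on_fst Ck_on_snd Ck_on_ident)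
  then show "Ck_on k (I \<times> UNIV) (\<lambda>z. f (fst z) (\<alpha> *\<^sub>R snd z + c))"
    using Ck_on_compose[of k "I \<times> UNIV" "\<lambda>z. f (fst z) (snd z)" "I \<times> UNIV" "\<lambda>z. (fst z, \<alpha> *\<^sub>R snd z + c)"] assms
    by (simp add: smooth_field_iff image_subset_iff)
qed

lemma pd_affine:
  fixes f :: "real \<Rightarrow> real ^ 'n::finite \<Rightarrow> 'b::real_normed_vector"
  assumes f: "smooth_field I f" and t: "t \<in> I"
  shows "pd I k (\<lambda>t x. f t (\<alpha> *\<^sub>R x + c)) t x = (case k of None \<Rightarrow> 1 | Some _ \<Rightarrow> \<alpha>) *\<^sub>R pd I k f t (\<alpha> *\<^sub>R x + c)"
proof -
  obtain F' where F: "((\<lambda>z. f (fst z) (snd z)) has_derivative F') (at (t, \<alpha> *\<^sub>R x + c) within I \<times> UNIV)" "F' (dir k) = pd I k f t (\<alpha> *\<^sub>R x + c)"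
    by (rule smooth_field_derivative_at[OF f t]) (rule that)
  have "((\<lambda>z. (fst z, \<alpha> *\<^sub>R snd z + c)) has_derivative (\<lambda>v. (fst v, \<alpha> *\<^sub>R snd v))) (at (t, x) within I \<times> UNIV)"
    by (auto intro!: derivative_eq_intros)
  then have "((\<lambda>z. f (fst (fst z, \<alpha> *\<^sub>R snd z + c)) (snd (fst z, \<alpha> *\<^sub>R snd z + c))) has_derivative (\<lambda>v. F' (fst v, \<alpha> *\<^sub>R snd v))) (at (t, x) within I \<times> UNIV)"
  proof (rule has_derivative_in_compose)
    show "((\<lambda>z. f (fst z) (snd z)) has_derivative F')
        (at (fst (t, x), \<alpha> *\<^sub>R snd (t, x) + c) within (\<lambda>z. (fst z, \<alpha> *\<^sub>R snd z + c)) ` (I \<times> UNIV))"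
      unfolding fst_conv snd_conv by (rule has_derivative_subset[OF F(1)]) auto
  qed
  then have "pd I k (\<lambda>t x. f t (\<alpha> *\<^sub>R x + c)) t x = F' (fst (dir k), \<alpha> *\<^sub>R snd (dir k))"
    using pd_eqI[of "\<lambda>t x. f t (\<alpha> *\<^sub>R x + c)" "\<lambda>v. F' (fst v, \<alpha> *\<^sub>R snd v)" t x k] t by simp
  also have "\<dots> = (case k of None \<Rightarrow> 1 | Some _ \<Rightarrow> \<alpha>) *\<^sub>R F' (dir k)"
    using linear_cmul[OF has_derivative_linear[OF F(1)], of \<alpha> "dir k"] by (cases k) (auto simp: dir_def)
  finally show ?thesis using F by simp
qed

definition psmooth :: "'p::euclidean_space \<Rightarrow> 'p \<Rightarrow> (real \<Rightarrow> real ^ 'n::finite \<Rightarrow> 'p \<Rightarrow> real) \<Rightarrow> bool" where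
  "psmooth a b f \<longleftrightarrow> (\<forall>k. Ck_on k ((I \<times> UNIV) \<times> cbox a b) (\<lambda>q. f (fst (fst q)) (snd (fst q)) (snd q)))"

lemma psmooth_integral:
  assumes "psmooth a b f"
  shows "smooth_field I (\<lambda>t x. integral (cbox a b) (f t x))"
  unfolding smooth_field_iff
proof
  fix k
  show "Ck_on k (I \<times> UNIV) (\<lambda>z. integral (cbox a b) (f (fst z) (snd z)))"
    using Ck_on_integral[OF convex_S, of k a b "\<lambda>q. f (fst (fst q)) (snd (fst q)) (snd q)"] assms
    by (simp add: psmooth_def)
qed

lemma psmooth_pd:
  assumes f: "psmooth a b f"
  shows "psmooth a b (\<lambda>t x p. pd I k (\<lambda>t x. f t x p) t x)"
    and "t \<in> I \<Longrightarrow> pd I k (\<lambda>t x. integral (cbox a b) (f t x)) t x = integral (cbox a b) (\<lambda>p. pd I k (\<lambda>t x. f t x p) t x)"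
proof -
  let ?f = "\<lambda>q. f (fst (fst q)) (snd (fst q)) (snd q)" and ?S = "(I \<times> UNIV) \<times> cbox a b"
  have part: "pd I k (\<lambda>t x. f t x (snd q)) (fst (fst q)) (snd (fst q)) = F' q (dir k, 0)"
    if "\<And>q. q \<in> ?S \<Longrightarrow> (?f has_derivative F' q) (at q within ?S)" "q \<in> ?S" for F' q
  proof -
    have "((\<lambda>z. ?f (z, snd q)) has_derivative (\<lambda>v. F' q (v, 0))) (at (fst q) within I \<times> UNIV)"
      by (rule has_derivative_partial[where P="cbox a b"]) (use that in auto)
    then show ?thesis
      using pd_eqI[of "\<lambda>t x. f t x (snd q)" "\<lambda>v. F' q (v, 0)" "fst (fst q)" "snd (fst q)"] that(2) by auto
  qed
  show "psmooth a b (\<lambda>t x p. pd I k (\<lambda>t x. f t x p) t x)"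
    unfolding psmooth_def
  proof
    fix m
    have "Ck_on (Suc m) ?S ?f" using f unfolding psmooth_def by blast
    then obtain F' where F: "\<And>q. q \<in> ?S \<Longrightarrow> (?f has_derivative F' q) (at q within ?S)" "\<And>v. Ck_on m ?S (\<lambda>q. F' q v)"
      by (rule Ck_on_SucE) (rule that)
    show "Ck_on m ?S (\<lambda>q. pd I k (\<lambda>t x. f t x (snd q)) (fst (fst q)) (snd (fst q)))"
      by (rule Ck_on_cong[OF F(2)[of "(dir k, 0)"]]) (rule part[OF F(1), symmetric])
  qed
  assume t: "t \<in> I"
  have "Ck_on (Suc 0) ?S ?f" using f unfolding psmooth_def by blast
  then obtain F' where F: "\<And>q. q \<in> ?S \<Longrightarrow> (?f has_derivative F' q) (at q within ?S)" "\<And>v. Ck_on 0 ?S (\<lambda>q. F' q v)"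
    by (rule Ck_on_SucE) (rule that)
  have "((\<lambda>z. integral (cbox a b) (\<lambda>p. ?f (z, p))) has_derivative
          (\<lambda>v. integral (cbox a b) (\<lambda>p. F' ((t, x), p) (v, 0)))) (at (t, x) within I \<times> UNIV)"
    by (rule has_derivative_integral_param[OF F(1) Ck_on_continuous[OF F(2)] convex_S]) (use t in auto)
  then have "pd I k (\<lambda>t x. integral (cbox a b) (f t x)) t x = integral (cbox a b) (\<lambda>p. F' ((t, x), p) (dir k, 0))"
    using pd_eqI[of "\<lambda>t x. integral (cbox a b) (f t x)" "\<lambda>v. integral (cbox a b) (\<lambda>p. F' ((t, x), p) (v, 0))" t x k] t
    by simp
  also have "\<dots> = integral (cbox a b) (\<lambda>p. pd I k (\<lambda>t x. f t x p) t x)"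
  proof (rule integral_cong)
    fix p assume "p \<in> cbox a b"
    then show "F' ((t, x), p) (dir k, 0) = pd I k (\<lambda>t x. f t x p) t x"
      using part[OF F(1), of "((t, x), p)"] t by simp
  qed
  finally show "pd I k (\<lambda>t x. integral (cbox a b) (f t x)) t x = integral (cbox a b) (\<lambda>p. pd I k (\<lambda>t x. f t x p) t x)" .
qed

lemma psmooth_integral_bound:
  assumes "psmooth a b f" "\<And>p. p \<in> cbox a b \<Longrightarrow> \<bar>f t x p\<bar> \<le> C" "0 \<le> C" "t \<in> I"
  shows "\<bar>integral (cbox a b) (f t x)\<bar> \<le> measure lborel (cbox a b) * C"
proof -
  have "Ck_on 0 ((I \<times> UNIV) \<times> cbox a b) (\<lambda>q. f (fst (fst q)) (snd (fst q)) (snd q))"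
    using assms(1) unfolding psmooth_def by blast
  then have "continuous_on ((I \<times> UNIV) \<times> cbox a b) (\<lambda>q. f (fst (fst q)) (snd (fst q)) (snd q))"
    by simp
  from continuous_on_compose2[OF this, of "cbox a b" "\<lambda>p. ((t, x), p)"]
  have "continuous_on (cbox a b) (f t x)"
    using assms(4) by (simp add: image_subset_iff continuous_on_Pair)
  then have "f t x integrable_on cbox a b" by (rule integrable_continuous)
  then have "norm (integral (cbox a b) (f t x)) \<le> C * measure lborel (cbox a b)"
    by (intro has_integral_bound[OF assms(3) integrable_integral]) (use assms(2) in auto)
  then show ?thesis by (simp add: mult.commute)
qed

end

subsection \<open>Anisotropic derivative bounds\<close>

text \<open>Every space derivative costs a factor \<open>M\<close> and every time derivative a factor \<open>T\<close>. At most \<open>r\<close>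
  time derivatives and \<open>N\<close> derivatives in total are taken, the time derivatives first.\<close>

fun SB :: "real set \<Rightarrow> (real ^ 'n::finite) set \<Rightarrow> real \<Rightarrow> real \<Rightarrow> nat \<Rightarrow> nat
    \<Rightarrow> (real \<Rightarrow> real ^ 'n \<Rightarrow> real) \<Rightarrow> real \<Rightarrow> bool" where
  "SB I X M T r 0 f B \<longleftrightarrow> smooth_field I f \<and> (\<forall>t\<in>I. \<forall>x\<in>X. \<bar>f t x\<bar> \<le> B)"
| "SB I X M T r (Suc N) f B \<longleftrightarrow> smooth_field I f \<and> (\<forall>t\<in>I. \<forall>x\<in>X. \<bar>f t x\<bar> \<le> B) \<and>
     (\<forall>j. SB I X M T 0 N (dx j f) (B * M)) \<and> (0 < r \<longrightarrow> SB I X M T (r - 1) N (dt I f) (B * T))"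

text \<open>Time and space derivatives are treated uniformly by \<open>pd\<close>; \<open>after r c\<close> is the number of time
  derivatives still allowed after the derivative \<open>c\<close>.\<close>

definition after :: "nat \<Rightarrow> 'n option \<Rightarrow> nat" where
  "after r c = (case c of None \<Rightarrow> r - 1 | Some _ \<Rightarrow> 0)"

definition cost :: "real \<Rightarrow> real \<Rightarrow> 'n option \<Rightarrow> real" where
  "cost M T c = (case c of None \<Rightarrow> T | Some _ \<Rightarrow> M)"

lemma SB_Suc_iff:
  "SB I X M T r (Suc N) f B \<longleftrightarrow> smooth_field I f \<and> (\<forall>t\<in>I. \<forall>x\<in>X. \<bar>f t x\<bar> \<le> B) \<and>
     (\<forall>c. (c = None \<longrightarrow> 0 < r) \<longrightarrow> SB I X M T (after r c) N (pd I c f) (B * cost M T c))"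
  by (auto simp: pd_def after_def cost_def split: option.splits)

lemma SB_SucI:
  assumes "smooth_field I f" "\<And>t x. t \<in> I \<Longrightarrow> x \<in> X \<Longrightarrow> \<bar>f t x\<bar> \<le> B"
    and "\<And>c. (c = None \<longrightarrow> 0 < r) \<Longrightarrow> SB I X M T (after r c) N (pd I c f) (B * cost M T c)"
  shows "SB I X M T r (Suc N) f B"
  unfolding SB_Suc_iff using assms by blast

lemma SB_SucD:
  assumes "SB I X M T r (Suc N) f B" "c = None \<longrightarrow> 0 < r"
  shows "SB I X M T (after r c) N (pd I c f) (B * cost M T c)"
  using assms unfolding SB_Suc_iff by blast

lemma SB_smooth: "SB I X M T r N f B \<Longrightarrow> smooth_field I f"
  by (cases N) auto

lemma SB_bound: "SB I X M T r N f B \<Longrightarrow> t \<in> I \<Longrightarrow> x \<in> X \<Longrightarrow> \<bar>f t x\<bar> \<le> B"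
  by (cases N) auto

declare SB.simps(2)[simp del]

text \<open>The constant of the iterated chain rule: one derivative produces the next function of
  the tower times a derivative of the inner function, a product to which the Leibniz factor
  \<open>2 ^ N\<close> applies. The summand \<open>G\<close> bounds the value itself.\<close>

primrec tower_const :: "real \<Rightarrow> real \<Rightarrow> nat \<Rightarrow> real" where
  "tower_const G b 0 = G"
| "tower_const G b (Suc N) = G + 2 ^ N * tower_const G b N * b"

lemma tower_const_nonneg: "0 \<le> G \<Longrightarrow> 0 \<le> b \<Longrightarrow> 0 \<le> tower_const G b N"
  by (induction N) auto

text \<open>\<open>X\<close> restricts only the pointwise bounds; the fields are smooth on the whole
  space, so derivatives at points of \<open>X\<close> make sense for any set
  \<open>X\<close>.\<close>

locale weights = time_range +
  fixes X :: "(real ^ 'n::finite) set" and M T :: real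
  assumes M: "0 \<le> M" and T: "0 \<le> T"
begin

abbreviation "B \<equiv> SB I X M T"

lemma cost_nonneg: "0 \<le> cost M T c"
  using M T by (simp add: cost_def split: option.split)

lemma SB_mono: "B r N f b \<Longrightarrow> b \<le> b' \<Longrightarrow> r' \<le> r \<Longrightarrow> N' \<le> N \<Longrightarrow> B r' N' f b'"
proof (induction N' arbitrary: r N f b r' b')
  case 0
  then have "\<bar>f t x\<bar> \<le> b'" if "t \<in> I" "x \<in> X" for t x
    using SB_bound[OF 0(1) that] by simp
  then show ?case using SB_smooth[OF 0(1)] by simp
next
  case (Suc N')
  then obtain N2 where N: "N = Suc N2" by (cases N) auto
  show ?case
  proof (rule SB_SucI)
    show "smooth_field I f" using SB_smooth[OF Suc.prems(1)] .
    show "\<bar>f t x\<bar> \<le> b'" if "t \<in> I" "x \<in> X" for t x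
      using SB_bound[OF Suc.prems(1) that] Suc.prems(2) by simp
    fix c :: "'n option" assume c: "c = None \<longrightarrow> 0 < r'"
    have "B (after r c) N2 (pd I c f) (b * cost M T c)"
      using SB_SucD[OF Suc.prems(1)[unfolded N]] c Suc.prems(3) by auto
    then show "B (after r' c) N' (pd I c f) (b' * cost M T c)"
      by (rule Suc.IH) (use Suc.prems N cost_nonneg[of c] in \<open>auto intro: mult_right_mono simp: after_def split: option.split\<close>)
  qed
qed

lemma SB_mono_bound: "B r N f b \<Longrightarrow> b \<le> b' \<Longrightarrow> B r N f b'"
  by (rule SB_mono) auto

lemma SB_lower: "B r (Suc N) f b \<Longrightarrow> B (after r c) N f b"
  by (rule SB_mono) (auto simp: after_def split: option.split)

lemma SB_cong: "B r N f b \<Longrightarrow> (\<And>t x. t \<in> I \<Longrightarrow> f t x = g t x) \<Longrightarrow> B r N g b"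
proof (induction N arbitrary: r f g b)
  case 0
  then show ?case using smooth_field_cong[of I f g] by auto
next
  case (Suc N)
  show ?case
  proof (rule SB_SucI)
    show "smooth_field I g" by (rule smooth_field_cong[OF SB_smooth[OF Suc.prems(1)] Suc.prems(2)])
    show "\<bar>g t x\<bar> \<le> b" if "t \<in> I" "x \<in> X" for t x
      using SB_bound[OF Suc.prems(1) that] Suc.prems(2)[OF that(1)] by simp
    fix c :: "'n option" assume "c = None \<longrightarrow> 0 < r"
    from SB_SucD[OF Suc.prems(1) this] show "B (after r c) N (pd I c g) (b * cost M T c)"
      by (rule Suc.IH) (rule pd_cong[OF Suc.prems(2)])
  qed
qed

lemma SB_const: "\<bar>c\<bar> \<le> b \<Longrightarrow> B r N (\<lambda>t x. c) b"
proof (induction N arbitrary: r c b)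
  case 0
  then show ?case by (simp add: smooth_field_const)
next
  case (Suc N)
  show ?case
  proof (rule SB_SucI)
    fix k :: "'n option"
    have "B (after r k) N (\<lambda>t x. 0) (b * cost M T k)"
      using Suc.prems cost_nonneg[of k] by (intro Suc.IH) auto
    then show "B (after r k) N (pd I k (\<lambda>t x. c)) (b * cost M T k)"
      by (rule SB_cong) (simp add: pd_const)
  qed (use Suc.prems in \<open>auto simp: smooth_field_const\<close>)
qed

lemma SB_add: "B r N f a \<Longrightarrow> B r N g b \<Longrightarrow> B r N (\<lambda>t x. f t x + g t x) (a + b)"
proof (induction N arbitrary: r f g a b)
  case 0
  then have "\<bar>f t x + g t x\<bar> \<le> a + b" if "t \<in> I" "x \<in> X" for t x
    using SB_bound[OF 0(1) that] SB_bound[OF 0(2) that] by simp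
  then show ?case using 0 by (simp add: smooth_field_add)
next
  case (Suc N)
  note sm = SB_smooth[OF Suc.prems(1)] SB_smooth[OF Suc.prems(2)]
  show ?case
  proof (rule SB_SucI)
    show "smooth_field I (\<lambda>t x. f t x + g t x)" using sm by (rule smooth_field_add)
    show "\<bar>f t x + g t x\<bar> \<le> a + b" if "t \<in> I" "x \<in> X" for t x
      using SB_bound[OF Suc.prems(1) that] SB_bound[OF Suc.prems(2) that] by simp
    fix c :: "'n option" assume c: "c = None \<longrightarrow> 0 < r"
    from Suc.IH[OF SB_SucD[OF Suc.prems(1) c] SB_SucD[OF Suc.prems(2) c]]
    show "B (after r c) N (pd I c (\<lambda>t x. f t x + g t x)) ((a + b) * cost M T c)"
      unfolding distrib_right by (rule SB_cong) (simp add: pd_add[OF sm])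
  qed
qed

text \<open>Each of the \<open>N\<close> derivatives doubles the number of products, hence
  \<open>2 ^ N\<close>. The factor that is not differentiated loses one admissible derivative at no
  cost, by \<open>SB_lower\<close>.\<close>

lemma SB_mult:
  "B r N f a \<Longrightarrow> B r N g b \<Longrightarrow> 0 \<le> a \<Longrightarrow> 0 \<le> b \<Longrightarrow> B r N (\<lambda>t x. f t x * g t x) (2 ^ N * a * b)"
proof (induction N arbitrary: r f g a b)
  case 0
  then have "\<bar>f t x * g t x\<bar> \<le> a * b" if "t \<in> I" "x \<in> X" for t x
    unfolding abs_mult using SB_bound[OF 0(1) that] SB_bound[OF 0(2) that] by (intro mult_mono) auto
  then show ?case using 0 by (simp add: smooth_field_mult)
next
  case (Suc N)
  note sm = SB_smooth[OF Suc.prems(1)] SB_smooth[OF Suc.prems(2)]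
  show ?case
  proof (rule SB_SucI)
    show "smooth_field I (\<lambda>t x. f t x * g t x)" using sm by (rule smooth_field_mult)
    show "\<bar>f t x * g t x\<bar> \<le> 2 ^ Suc N * a * b" if "t \<in> I" "x \<in> X" for t x
    proof -
      have "\<bar>f t x * g t x\<bar> \<le> a * b"
        unfolding abs_mult using SB_bound[OF Suc.prems(1) that] SB_bound[OF Suc.prems(2) that] Suc.prems
        by (intro mult_mono) auto
      also have "\<dots> \<le> 2 ^ Suc N * (a * b)"
        using Suc.prems mult_right_mono[of 1 "2 ^ Suc N" "a * b"] one_le_power[of "2::real" "Suc N"] by simp
      finally show ?thesis by (simp add: mult.assoc)
    qed
    fix c :: "'n option" assume c: "c = None \<longrightarrow> 0 < r"
    have 1: "B (after r c) N (\<lambda>t x. pd I c f t x * g t x) (2 ^ N * (a * cost M T c) * b)"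
      using Suc.prems cost_nonneg[of c] by (intro Suc.IH SB_SucD[OF Suc.prems(1) c] SB_lower[OF Suc.prems(2)]) auto
    have 2: "B (after r c) N (\<lambda>t x. f t x * pd I c g t x) (2 ^ N * a * (b * cost M T c))"
      using Suc.prems cost_nonneg[of c] by (intro Suc.IH SB_SucD[OF Suc.prems(2) c] SB_lower[OF Suc.prems(1)]) auto
    have "2 ^ N * (a * cost M T c) * b + 2 ^ N * a * (b * cost M T c) = 2 ^ Suc N * a * b * cost M T c"
      by simp
    from SB_add[OF 1 2, unfolded this]
    show "B (after r c) N (pd I c (\<lambda>t x. f t x * g t x)) (2 ^ Suc N * a * b * cost M T c)"
      by (rule SB_cong) (simp add: pd_mult[OF sm])
  qed
qed

lemma SB_cmult: "B r N f b \<Longrightarrow> B r N (\<lambda>t x. c * f t x) (\<bar>c\<bar> * b)"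
proof (induction N arbitrary: r f b)
  case 0
  then have "\<bar>c * f t x\<bar> \<le> \<bar>c\<bar> * b" if "t \<in> I" "x \<in> X" for t x
    unfolding abs_mult using SB_bound[OF 0(1) that] by (intro mult_left_mono) auto
  then show ?case using 0 by (simp add: smooth_field_mult smooth_field_const)
next
  case (Suc N)
  note sm = SB_smooth[OF Suc.prems(1)]
  show ?case
  proof (rule SB_SucI)
    show "smooth_field I (\<lambda>t x. c * f t x)" using sm by (intro smooth_field_mult smooth_field_const)
    show "\<bar>c * f t x\<bar> \<le> \<bar>c\<bar> * b" if "t \<in> I" "x \<in> X" for t x
      unfolding abs_mult using SB_bound[OF Suc.prems that] by (intro mult_left_mono) auto
    fix k :: "'n option" assume k: "k = None \<longrightarrow> 0 < r"
    from Suc.IH[OF SB_SucD[OF Suc.prems k]]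
    show "B (after r k) N (pd I k (\<lambda>t x. c * f t x)) (\<bar>c\<bar> * b * cost M T k)"
      unfolding mult.assoc by (rule SB_cong) (simp add: pd_mult[OF smooth_field_const sm] pd_const)
  qed
qed

lemma SB_diff: "B r N f a \<Longrightarrow> B r N g b \<Longrightarrow> B r N (\<lambda>t x. f t x - g t x) (a + b)"
  using SB_add[of r N f a "\<lambda>t x. -1 * g t x" b] SB_cmult[of r N g b "-1"] by simp

lemma SB_sum:
  assumes "finite A" "\<And>i. i \<in> A \<Longrightarrow> B r N (f i) (b i)"
  shows "B r N (\<lambda>t x. \<Sum>i\<in>A. f i t x) (\<Sum>i\<in>A. b i)"
  using assms by (induction A rule: finite_induct) (auto intro!: SB_const SB_add)

lemma SB_prod:
  assumes "finite A" "\<And>i. i \<in> A \<Longrightarrow> B r N (f i) b" "0 \<le> b"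
  shows "B r N (\<lambda>t x. \<Prod>i\<in>A. f i t x) ((2 ^ N * b) ^ card A)"
  using assms
proof (induction A rule: finite_induct)
  case empty
  then show ?case by (auto intro: SB_const)
next
  case (insert i A)
  then have "B r N (\<lambda>t x. f i t x * (\<Prod>i\<in>A. f i t x)) (2 ^ N * b * (2 ^ N * b) ^ card A)"
    by (intro SB_mult insert.IH) auto
  then show ?case using insert.hyps by simp
qed

text \<open>Every derivative raises the index of the tower by one, so bounds up to index
  \<open>m + N\<close> are required.\<close>

lemma SB_tower:
  fixes g :: "nat \<Rightarrow> real \<Rightarrow> real"
  assumes g: "\<And>m x. x \<in> A \<Longrightarrow> (g m has_real_derivative g (Suc m) x) (at x within A)"
    and f: "\<And>t x. t \<in> I \<Longrightarrow> f t x \<in> A" and b: "0 \<le> b" and G: "0 \<le> G"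
  shows "B r N f b \<Longrightarrow> (\<And>k t x. k \<le> m + N \<Longrightarrow> t \<in> I \<Longrightarrow> x \<in> X \<Longrightarrow> \<bar>g k (f t x)\<bar> \<le> G)
    \<Longrightarrow> B r N (\<lambda>t x. g m (f t x)) (tower_const G b N)"
proof (induction N arbitrary: r m)
  case 0
  then show ?case using smooth_field_tower[of A g f m, OF g SB_smooth[OF 0(1)] f] by simp
next
  case (Suc N)
  note sm = SB_smooth[OF Suc.prems(1)]
  have pos: "0 \<le> 2 ^ N * tower_const G b N * b" using tower_const_nonneg[OF G b] b by simp
  show ?case
  proof (rule SB_SucI)
    show "smooth_field I (\<lambda>t x. g m (f t x))" by (rule smooth_field_tower[of A g f m, OF g sm f])
    show "\<bar>g m (f t x)\<bar> \<le> tower_const G b (Suc N)" if "t \<in> I" "x \<in> X" for t x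
      using Suc.prems(2)[of m t x] that pos by simp
    fix c :: "'n option" assume c: "c = None \<longrightarrow> 0 < r"
    have IH: "B (after r c) N (\<lambda>t x. g (Suc m) (f t x)) (tower_const G b N)"
      by (rule Suc.IH[OF SB_lower[OF Suc.prems(1)]]) (use Suc.prems(2) in auto)
    have *: "B (after r c) N (\<lambda>t x. g (Suc m) (f t x) * pd I c f t x) (2 ^ N * tower_const G b N * (b * cost M T c))"
      by (rule SB_mult[OF IH SB_SucD[OF Suc.prems(1) c]]) (use b tower_const_nonneg[OF G b] cost_nonneg[of c] in auto)
    have "2 ^ N * tower_const G b N * (b * cost M T c) \<le> tower_const G b (Suc N) * cost M T c"
      using mult_nonneg_nonneg[OF G cost_nonneg[of c]] by (simp add: algebra_simps)
    from SB_mono_bound[OF * this]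
    show "B (after r c) N (pd I c (\<lambda>t x. g m (f t x))) (tower_const G b (Suc N) * cost M T c)"
      by (rule SB_cong) (rule pd_tower[of A g f, OF g sm f, symmetric])
  qed
qed

lemma SB_integral:
  assumes "psmooth a b f" "\<And>p. p \<in> cbox a b \<Longrightarrow> B r N (\<lambda>t x. f t x p) C" "0 \<le> C"
  shows "B r N (\<lambda>t x. integral (cbox a b) (f t x)) (measure lborel (cbox a b) * C)"
  using assms
proof (induction N arbitrary: r f C)
  case 0
  then show ?case
    using psmooth_integral[OF 0(1)] psmooth_integral_bound[OF 0(1) _ 0(3)] by simp
next
  case (Suc N)
  show ?case
  proof (rule SB_SucI)
    show "smooth_field I (\<lambda>t x. integral (cbox a b) (f t x))" by (rule psmooth_integral[OF Suc.prems(1)])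
    show "\<bar>integral (cbox a b) (f t x)\<bar> \<le> measure lborel (cbox a b) * C" if "t \<in> I" "x \<in> X" for t x
      by (rule psmooth_integral_bound[OF Suc.prems(1) SB_bound[OF Suc.prems(2) that] Suc.prems(3) that(1)])
    fix c :: "'n option" assume c: "c = None \<longrightarrow> 0 < r"
    have "B (after r c) N (\<lambda>t x. integral (cbox a b) (\<lambda>p. pd I c (\<lambda>t x. f t x p) t x)) (measure lborel (cbox a b) * (C * cost M T c))"
      by (rule Suc.IH[OF psmooth_pd(1)[OF Suc.prems(1)]])
         (use SB_SucD[OF Suc.prems(2) c] Suc.prems(3) cost_nonneg[of c] in auto)
    then show "B (after r c) N (pd I c (\<lambda>t x. integral (cbox a b) (f t x))) (measure lborel (cbox a b) * C * cost M T c)"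
      unfolding mult.assoc by (rule SB_cong) (simp add: psmooth_pd(2)[OF Suc.prems(1)])
  qed
qed

text \<open>\<open>\<alpha> = 1\<close> gives translates, and \<open>\<alpha> = 0\<close> freezes
  the space variable at \<open>c\<close>.\<close>

lemma SB_affine:
  assumes \<alpha>: "\<bar>\<alpha>\<bar> \<le> 1"
  shows "SB I UNIV M T r N f b \<Longrightarrow> B r N (\<lambda>t x. f t (\<alpha> *\<^sub>R x + c)) b"
proof (induction N arbitrary: r f b)
  case 0
  then show ?case by (simp add: smooth_field_affine)
next
  case (Suc N)
  note sm = SB_smooth[OF Suc.prems]
  show ?case
  proof (rule SB_SucI)
    show "smooth_field I (\<lambda>t x. f t (\<alpha> *\<^sub>R x + c))" by (rule smooth_field_affine[OF sm])
    show bd: "\<bar>f t (\<alpha> *\<^sub>R x + c)\<bar> \<le> b" if "t \<in> I" "x \<in> X" for t x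
      using SB_bound[OF Suc.prems that(1)] by simp
    fix k :: "'n option" assume k: "k = None \<longrightarrow> 0 < r"
    let ?a = "case k of None \<Rightarrow> 1 | Some _ \<Rightarrow> \<alpha>"
    have IH: "B (after r k) N (\<lambda>t x. pd I k f t (\<alpha> *\<^sub>R x + c)) (b * cost M T k)"
      by (rule Suc.IH[OF SB_SucD[OF Suc.prems k]])
    show "B (after r k) N (pd I k (\<lambda>t x. f t (\<alpha> *\<^sub>R x + c))) (b * cost M T k)"
    \<comment> \<open>A point of \<open>I\<close> is used to see that the bound is nonnegative, so
      that multiplication by \<open>?a\<close> cannot increase it.\<close>
    proof (cases "I = {}")
      case False
      then obtain t where t: "t \<in> I" by blast
      have "0 \<le> b * cost M T k"
        using SB_bound[OF SB_SucD[OF Suc.prems k] t UNIV_I] by (rule order_trans[OF abs_ge_zero])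
      then have "\<bar>?a\<bar> * (b * cost M T k) \<le> b * cost M T k"
        using \<alpha> mult_right_mono[of "\<bar>?a\<bar>" 1 "b * cost M T k"] by (auto split: option.splits)
      from SB_mono_bound[OF SB_cmult[OF IH] this] show ?thesis
        by (rule SB_cong) (simp add: pd_affine[OF sm])
    qed (use nondegenerate in auto)
  qed
qed

lemma funpow_dt_Suc: "(dt I ^^ Suc r) f = (dt I ^^ r) (dt I f)"
  by (simp add: funpow_swap1)

lemma SB_words:
  "SB I X M T r N f b \<Longrightarrow> r' \<le> r \<Longrightarrow> r' + length ks \<le> N \<Longrightarrow> t \<in> I \<Longrightarrow> x \<in> X
    \<Longrightarrow> \<bar>foldr dx ks ((dt I ^^ r') f) t x\<bar> \<le> b * T ^ r' * M ^ length ks"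
proof (induction N arbitrary: r f b r' ks)
  case 0
  then show ?case by simp
next
  case (Suc N)
  show ?case
  proof (cases r')
    case (Suc s)
    have *: "B (after r (None :: 'n option)) N (pd I None f) (b * cost M T (None :: 'n option))"
      by (rule SB_SucD[OF Suc.prems(1)]) (use Suc Suc.prems in auto)
    have "\<bar>foldr dx ks ((dt I ^^ s) (pd I None f)) t x\<bar> \<le> (b * cost M T (None :: 'n option)) * T ^ s * M ^ length ks"
      by (rule Suc.IH[OF *]) (use Suc Suc.prems in \<open>auto simp: after_def\<close>)
    then show ?thesis unfolding Suc funpow_dt_Suc by (simp add: pd_def cost_def mult.assoc)
  next
    case 0
    show ?thesis
    \<comment> \<open>\<open>SB\<close> removes the derivative that is applied first, and for
      \<open>foldr\<close> that is the last entry of \<open>ks\<close>.\<close>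
    proof (cases ks rule: rev_cases)
      case Nil
      then show ?thesis using SB_bound[OF Suc.prems(1,4,5)] 0 by simp
    next
      case (snoc ks' j)
      have *: "B (after r (Some j)) N (pd I (Some j) f) (b * cost M T (Some j))"
        by (rule SB_SucD[OF Suc.prems(1)]) auto
      have "\<bar>foldr dx ks' ((dt I ^^ 0) (pd I (Some j) f)) t x\<bar> \<le> (b * cost M T (Some j)) * T ^ 0 * M ^ length ks'"
        by (rule Suc.IH[OF *]) (use snoc Suc.prems in auto)
      then show ?thesis by (simp add: snoc 0 pd_def cost_def mult.assoc)
    qed
  qed
qed

lemma SB_from_words:
  "smooth_field I f \<Longrightarrow>
    (\<And>r' ks t x. r' \<le> r \<Longrightarrow> r' + length ks \<le> N \<Longrightarrow> t \<in> I \<Longrightarrow> x \<in> X \<Longrightarrow>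
      \<bar>foldr dx ks ((dt I ^^ r') f) t x\<bar> \<le> b * T ^ r' * M ^ length ks)
    \<Longrightarrow> SB I X M T r N f b"
proof (induction N arbitrary: r f b)
  case 0
  then show ?case using 0(2)[of 0 "[]"] by auto
next
  case (Suc N)
  show ?case
  proof (rule SB_SucI)
    show "\<bar>f t x\<bar> \<le> b" if "t \<in> I" "x \<in> X" for t x
      using Suc.prems(2)[of 0 "[]"] that by auto
    fix c :: "'n option" assume c: "c = None \<longrightarrow> 0 < r"
    show "B (after r c) N (pd I c f) (b * cost M T c)"
    proof (rule Suc.IH[OF smooth_field_pd[OF Suc.prems(1)]])
      fix r' t x and ks :: "'n list"
      assume a: "r' \<le> after r c" "r' + length ks \<le> N" "t \<in> I" "x \<in> X"
      show "\<bar>foldr dx ks ((dt I ^^ r') (pd I c f)) t x\<bar> \<le> b * cost M T c * T ^ r' * M ^ length ks"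
      proof (cases c)
        case None
        have "\<bar>foldr dx ks ((dt I ^^ Suc r') f) t x\<bar> \<le> b * T ^ Suc r' * M ^ length ks"
          by (rule Suc.prems(2)) (use a c None in \<open>auto simp: after_def\<close>)
        then show ?thesis unfolding funpow_dt_Suc by (simp add: None pd_def cost_def mult.assoc)
      next
        case (Some j)
        have "\<bar>foldr dx (ks @ [j]) ((dt I ^^ 0) f) t x\<bar> \<le> b * T ^ 0 * M ^ length (ks @ [j])"
          by (rule Suc.prems(2)) (use a Some in \<open>auto simp: after_def\<close>)
        then show ?thesis using a(1) by (simp add: Some pd_def cost_def after_def mult.assoc)
      qed
    qed
  qed (rule Suc.prems(1))
qed

end

subsection \<open>A smooth bump\<close>

text \<open>With \<open>y = 1 / x\<close>, the derivative in \<open>x\<close> of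
  \<open>poly p y * exp (- y)\<close> is
  \<open>y\<^sup>2 * (poly p y - poly (pderiv p) y) * exp (- y)\<close>.\<close>

primrec bump_poly :: "nat \<Rightarrow> real poly" where
  "bump_poly 0 = 1"
| "bump_poly (Suc m) = [:0, 0, 1:] * (bump_poly m - pderiv (bump_poly m))"

text \<open>The derivatives of \<open>exp (- 1 / x)\<close> for positive \<open>x\<close>, extended by 0.\<close>

definition bump :: "nat \<Rightarrow> real \<Rightarrow> real" where
  "bump m x = (if 0 < x then poly (bump_poly m) (1 / x) * exp (- 1 / x) else 0)"

text \<open>The power \<open>y ^ k\<close> makes the induction work: splitting off the lowest
  coefficient of \<open>p\<close> raises \<open>k\<close> by one.\<close>

lemma poly_times_exp_tendsto_0: "((\<lambda>y. y ^ k * poly p y * exp (- y)) \<longlongrightarrow> (0::real)) at_top"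
proof (induction p arbitrary: k)
  case 0
  then show ?case by simp
next
  case (pCons a p)
  have "((\<lambda>y::real. y ^ k / exp y) \<longlongrightarrow> 0) at_top" by (rule tendsto_power_div_exp_0)
  then have "((\<lambda>y. a * (y ^ k / exp y) + y ^ Suc k * poly p y * exp (- y)) \<longlongrightarrow> a * 0 + 0) at_top"
    by (intro tendsto_add tendsto_mult_left pCons.IH)
  then show ?case by (simp add: exp_minus field_simps)
qed

lemma bump_derivative: "(bump m has_real_derivative bump (Suc m) x) (at x within S)"
proof -
  have "(bump m has_real_derivative bump (Suc m) x) (at x)"
  proof -
    consider "0 < x" | "x < 0" | "x = 0" by linarith
    then show ?thesis
    proof cases
      case 1
      have "((\<lambda>x. poly (bump_poly m) (1 / x) * exp (- 1 / x)) has_real_derivative bump (Suc m) x) (at x)"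
        using 1 by (auto intro!: derivative_eq_intros poly_DERIV[THEN DERIV_chain2] simp: bump_def field_simps power2_eq_square)
      then show ?thesis
        by (rule has_field_derivative_transform_within_open[of _ _ _ "{0<..}"]) (use 1 in \<open>auto simp: bump_def\<close>)
    next
      case 2
      have "((\<lambda>x. 0) has_real_derivative bump (Suc m) x) (at x)" using 2 by (simp add: bump_def)
      then show ?thesis
        by (rule has_field_derivative_transform_within_open[of _ _ _ "{..<0}"]) (use 2 in \<open>auto simp: bump_def\<close>)
    next
      \<comment> \<open>At 0 the difference quotient is 0 from the left; from the right the
        substitution of \<open>1 / x\<close> for \<open>x\<close> reduces it to exponential
        decay.\<close>
      case 3
      have "((\<lambda>y. bump m y / y) \<longlongrightarrow> 0) (at_right 0)"
        unfolding filterlim_at_right_to_top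
      proof (rule Lim_transform_eventually[OF poly_times_exp_tendsto_0[of 1 "bump_poly m"]])
        show "\<forall>\<^sub>F y in at_top. y ^ 1 * poly (bump_poly m) y * exp (- y) = bump m (inverse y) / inverse y"
          using eventually_gt_at_top[of 0] by eventually_elim (simp add: bump_def field_simps)
      qed
      moreover have "((\<lambda>y. bump m y / y) \<longlongrightarrow> 0) (at_left 0)"
        by (rule Lim_transform_eventually[OF tendsto_const])
           (auto simp: eventually_at_left_field bump_def intro!: exI[of _ "-1"])
      ultimately have "((\<lambda>y. bump m y / y) \<longlongrightarrow> 0) (at 0)" by (rule filterlim_split_at[rotated])
      then show ?thesis by (simp add: 3 has_field_derivative_iff bump_def)
    qed
  qed
  then show ?thesis by (rule has_field_derivative_at_within)
qed

text \<open>The arguments of \<open>bump\<close> in the weight have the form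
  \<open>1 - 4 * (z \<bullet> z)\<close>, hence are at most 1. On \<open>{0..1}\<close> compactness
  applies, and below 0 the function vanishes.\<close>

lemma bump_bounded: "\<exists>G\<ge>0. \<forall>k\<le>K. \<forall>x\<le>1. \<bar>bump k x\<bar> \<le> G"
proof (induction K)
  have one: "\<exists>G\<ge>0. \<forall>x\<le>1. \<bar>bump k x\<bar> \<le> G" for k
  proof -
    have "continuous_on {0..1} (bump k)" using DERIV_continuous_on[of "{0..1}" "bump k"] bump_derivative by blast
    then have "bounded (bump k ` {0..1})" by (intro compact_imp_bounded compact_continuous_image) auto
    then obtain G where G: "\<forall>y\<in>bump k ` {0..1}. \<bar>y\<bar> \<le> G" by (auto simp: bounded_iff)
    then have "0 \<le> G" by fastforce
    moreover have "\<bar>bump k x\<bar> \<le> G" if "x \<le> 1" for x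
      using G that \<open>0 \<le> G\<close> by (cases "0 < x") (auto simp: bump_def)
    ultimately show ?thesis by blast
  qed
  case 0
  show ?case using one[of 0] by auto
  case (Suc K)
  then obtain G1 where G1: "0 \<le> G1" "\<forall>k\<le>K. \<forall>x\<le>1. \<bar>bump k x\<bar> \<le> G1" by blast
  obtain G2 where G2: "0 \<le> G2" "\<forall>x\<le>1. \<bar>bump (Suc K) x\<bar> \<le> G2" using one by blast
  show ?case
  proof (intro exI[of _ "max G1 G2"] conjI allI impI)
    fix k and x :: real assume "k \<le> Suc K" "x \<le> 1"
    then show "\<bar>bump k x\<bar> \<le> max G1 G2"
      using G1(2) G2(2) by (cases "k = Suc K") (auto simp: le_max_iff_disj)
  qed (use G1 in auto)
qed

definition bump_mass :: "'n::finite itself \<Rightarrow> real" where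
  "bump_mass _ = integral UNIV (\<lambda>z :: real ^ 'n::finite. bump 0 (1 - 4 * (z \<bullet> z)))"

lemma bump_outside: "1 / 2 < norm z \<Longrightarrow> bump m (1 - 4 * (z \<bullet> z)) = 0"
proof -
  assume "1 / 2 < norm z"
  then have "(1 / 2)\<^sup>2 < (norm z)\<^sup>2" by (intro power_strict_mono) auto
  then have "1 < 4 * (z \<bullet> z)" by (simp add: power2_norm_eq_inner power_divide)
  then show ?thesis by (simp add: bump_def)
qed

lemma Ck_on_bump: "Ck_on k S f \<Longrightarrow> Ck_on k S (\<lambda>x. bump m (f x))"
  by (rule Ck_on_compose_UNIV[OF Ck_on_tower]) (auto intro: bump_derivative)

text \<open>A nonnegative continuous function with integral 0 over a box vanishes there, but the
  integrand is \<open>exp (- 1)\<close> at the origin.\<close>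

lemma bump_mass_pos: "0 < bump_mass TYPE('n::finite)"
proof -
  let ?f = "\<lambda>z :: real ^ 'n. bump 0 (1 - 4 * (z \<bullet> z))"
  have nn: "0 \<le> ?f z" for z by (simp add: bump_def)
  have c: "continuous_on S ?f" for S
    by (rule Ck_on_continuous[of 0]) (intro Ck_on_bump Ck_on_diff Ck_on_mult Ck_on_inner Ck_on_const Ck_on_ident)
  have e: "integral (cube 1) ?f = integral UNIV ?f"
  proof (rule integral_supported)
    fix z :: "real ^ 'n" assume "z \<notin> cube 1"
    then show "?f z = 0" using mem_cube[of z 1] by (intro bump_outside) linarith
  qed
  have "integral (cube 1) ?f \<noteq> 0"
  proof
    assume 0: "integral (cube 1) ?f = 0"
    have "(?f has_integral integral (cube 1) ?f) (cube 1)"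
      unfolding cube_def by (rule integrable_integral[OF integrable_continuous[OF c]])
    then have "(?f has_integral 0) (cbox (- (1 *\<^sub>R One)) (1 *\<^sub>R One))"
      unfolding 0 by (simp add: cube_def)
    moreover have "box (- (1 *\<^sub>R One)) (1 *\<^sub>R One) \<noteq> ({} :: (real ^ 'n) set)"
      by (simp add: box_ne_empty)
    moreover have "(0 :: real ^ 'n) \<in> cbox (- (1 *\<^sub>R One)) (1 *\<^sub>R One)"
      using mem_cube[of "0 :: real ^ 'n" 1] by (simp add: cube_def)
    ultimately have "?f 0 = 0"
      by (rule has_integral_0_cbox_imp_0[OF c nn])
    then show False by (simp add: bump_def)
  qed
  moreover have "0 \<le> integral (cube 1) ?f"
    by (intro Henstock_Kurzweil_Integration.integral_nonneg) (auto simp: cube_def nn intro!: integrable_continuous c)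
  ultimately show ?thesis unfolding bump_mass_def e by simp
qed

definition bump_weight :: "real ^ 'n::finite \<Rightarrow> real" where
  "bump_weight z = bump 0 (1 - 4 * (z \<bullet> z)) / bump_mass TYPE('n)"

definition bump_grad :: "real ^ 'n::finite \<Rightarrow> real ^ 'n" where
  "bump_grad z = (- 8 * bump 1 (1 - 4 * (z \<bullet> z)) / bump_mass TYPE('n)) *\<^sub>R z"

text \<open>The gradient of \<open>1 - 4 * (z \<bullet> z)\<close> is
  \<open>- 8 *\<^sub>R z\<close>, whence \<open>- 8\<close>, and 64 as its square.\<close>

definition bump_hess :: "real ^ 'n::finite \<Rightarrow> real ^ 'n \<Rightarrow> real ^ 'n" where
  "bump_hess z v = (- 8 * bump 1 (1 - 4 * (z \<bullet> z)) / bump_mass TYPE('n)) *\<^sub>R v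
     + (64 * bump 2 (1 - 4 * (z \<bullet> z)) * (z \<bullet> v) / bump_mass TYPE('n)) *\<^sub>R z"

lemma bump_weight_is_weight: "weight bump_weight bump_grad (bump_hess :: real ^ 'n::finite \<Rightarrow> _)"
proof
  have db: "((\<lambda>z :: real ^ 'n. bump m (1 - 4 * (z \<bullet> z))) has_derivative (\<lambda>v. bump (Suc m) (1 - 4 * (z \<bullet> z)) * (- 8 * (z \<bullet> v)))) (at z)" for m z
  proof -
    have 1: "((\<lambda>z. 1 - 4 * (z \<bullet> z)) has_derivative (\<lambda>v. - 8 * (z \<bullet> v))) (at z)"
      by (auto intro!: derivative_eq_intros simp: inner_commute)
    have 2: "(bump m has_derivative (\<lambda>h. bump (Suc m) (1 - 4 * (z \<bullet> z)) * h)) (at (1 - 4 * (z \<bullet> z)))"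
      using bump_derivative[of m "1 - 4 * (z \<bullet> z)" UNIV] by (simp add: has_field_derivative_def)
    show ?thesis by (rule has_derivative_compose[OF 1 2])
  qed
  show "Ck_on (Suc 0) UNIV (bump_weight :: real ^ 'n \<Rightarrow> real)" "Ck_on (Suc 0) UNIV (bump_grad :: real ^ 'n \<Rightarrow> real ^ 'n)"
    unfolding bump_weight_def[abs_def] bump_grad_def[abs_def] divide_inverse
    by (intro Ck_on_scaleR Ck_on_mult Ck_on_bump Ck_on_diff Ck_on_inner Ck_on_const Ck_on_ident)+
  show "(bump_weight has_derivative (\<bullet>) (bump_grad z)) (at z)" for z :: "real ^ 'n"
    unfolding bump_weight_def[abs_def]
    by (rule has_derivative_eq_rhs[OF bounded_linear.has_derivative[OF bounded_linear_divide db]])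
       (simp add: fun_eq_iff bump_grad_def)
  show "(bump_grad has_derivative bump_hess z) (at z)" for z :: "real ^ 'n"
    unfolding bump_grad_def[abs_def]
    by (rule has_derivative_eq_rhs[OF has_derivative_scaleR[OF bounded_linear.has_derivative[OF bounded_linear_divide has_derivative_mult_right[OF db]] has_derivative_ident]])
       (simp add: fun_eq_iff bump_hess_def numeral_2_eq_2)
  show "bump_hess z u \<bullet> v = bump_hess z v \<bullet> u" for z u v :: "real ^ 'n"
    by (simp add: bump_hess_def inner_simps inner_commute mult_ac)
  show "1 / 2 < norm z \<Longrightarrow> bump_weight z = 0" "1 / 2 < norm z \<Longrightarrow> bump_grad z = 0" for z :: "real ^ 'n"
    by (simp_all add: bump_weight_def bump_grad_def bump_outside)
  show "integral UNIV (bump_weight :: real ^ 'n \<Rightarrow> real) = 1"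
    unfolding bump_weight_def[abs_def] using bump_mass_pos[where 'n = 'n] by (simp add: bump_mass_def)
qed

subsection \<open>Words of derivatives\<close>

definition word :: "real set \<Rightarrow> 'n option list \<Rightarrow> (real \<Rightarrow> real ^ 'n::finite \<Rightarrow> 'b::real_normed_vector)
    \<Rightarrow> real \<Rightarrow> real ^ 'n \<Rightarrow> 'b" where
  "word I w f = foldr (pd I) w f"

lemma word_simps [simp]: "word I [] f = f" "word I (c # w) f = pd I c (word I w f)"
  by (simp_all add: word_def)

lemma word_append: "word I (v @ w) f = word I v (word I w f)"
  by (simp add: word_def)

lemma word_eq: "foldr dx ks ((dt I ^^ r) f) = word I (map Some ks @ replicate r None) f"
proof -
  have "(dt I ^^ r) f = word I (replicate r None) f"
    by (induction r) (simp_all add: pd_def)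
  moreover have "foldr dx ks h = word I (map Some ks) h" for h
    by (induction ks) (simp_all add: pd_def)
  ultimately show ?thesis by (simp add: word_append)
qed

context time_range
begin

lemma smooth_word: "smooth_field I f \<Longrightarrow> smooth_field I (word I w f)"
  by (induction w) (auto intro: smooth_field_pd)

lemma word_cong: "(\<And>t x. t \<in> I \<Longrightarrow> f t x = g t x) \<Longrightarrow> t \<in> I \<Longrightarrow> word I w f t x = word I w g t x"
  by (induction w arbitrary: t x) (auto intro: pd_cong)

lemma smooth_field_nth: "smooth_field I f \<Longrightarrow> smooth_field I (\<lambda>t x. f t x $ i)"
  by (simp add: smooth_field_iff Ck_on_nth)

lemma pd_nth:
  fixes f :: "real \<Rightarrow> real ^ 'n::finite \<Rightarrow> real ^ 'm::finite"
  assumes "smooth_field I f" "t \<in> I"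
  shows "pd I c (\<lambda>t x. f t x $ i) t x = pd I c f t x $ i"
proof -
  obtain F' where F: "((\<lambda>z. f (fst z) (snd z)) has_derivative F') (at (t, x) within I \<times> UNIV)"
    "\<And>c. F' (dir c) = pd I c f t x"
    by (rule smooth_field_derivative_at[OF assms]) (rule that)
  have "((\<lambda>z. f (fst z) (snd z) $ i) has_derivative (\<lambda>v. F' v $ i)) (at (t, x) within I \<times> UNIV)"
    by (rule bounded_linear.has_derivative[OF bounded_linear_vec_nth F(1)])
  then show ?thesis
    using pd_eqI[of "\<lambda>t x. f t x $ i" "\<lambda>v. F' v $ i" t x c] assms(2) F(2) by simp
qed

lemma word_nth:
  fixes f :: "real \<Rightarrow> real ^ 'n::finite \<Rightarrow> real ^ 'm::finite"
  assumes "smooth_field I f"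
  shows "t \<in> I \<Longrightarrow> word I w (\<lambda>t x. f t x $ i) t x = word I w f t x $ i"
proof (induction w arbitrary: t x)
  case (Cons c w)
  have "pd I c (word I w (\<lambda>t x. f t x $ i)) t x = pd I c (\<lambda>t x. word I w f t x $ i) t x"
    by (rule pd_cong[OF Cons.IH Cons.prems])
  also have "\<dots> = pd I c (word I w f) t x $ i"
    by (rule pd_nth[OF smooth_word[OF assms] Cons.prems])
  finally show ?case by simp
qed simp

text \<open>The bounds on \<open>u\<close> concern words in which time derivatives come first; this
  moves the space derivative contained in \<open>F\<close> past them.\<close>

lemma word_time_space_comm:
  fixes f :: "real \<Rightarrow> real ^ 'n::finite \<Rightarrow> 'b::euclidean_space"
  assumes f: "smooth_field I f"
  shows "t \<in> I \<Longrightarrow> word I (replicate r None) (dx j f) t x = dx j (word I (replicate r None) f) t x"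
proof (induction r arbitrary: t x)
  case (Suc r)
  have "word I (replicate (Suc r) None) (dx j f) t x = pd I None (dx j (word I (replicate r None) f)) t x"
    using pd_cong[OF Suc.IH Suc.prems] by simp
  also have "\<dots> = dx j (dt I (word I (replicate r None) f)) t x"
    using pd_comm[OF smooth_word[OF f] Suc.prems] by (simp add: pd_def)
  finally show ?case by (simp add: pd_def)
qed simp

lemma word_vanishes:
  fixes f :: "real \<Rightarrow> real ^ 'n::finite \<Rightarrow> 'b::real_normed_vector"
  assumes O: "open O'" and f: "\<And>t x. t \<in> I \<Longrightarrow> x \<in> O' \<Longrightarrow> f t x = 0"
  shows "t \<in> I \<Longrightarrow> x \<in> O' \<Longrightarrow> word I w f t x = 0"
proof (induction w arbitrary: t x)
  case (Cons c w)
  show ?case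
  proof (cases c)
    case None
    have "((\<lambda>s. word I w f s x) has_vector_derivative 0) (at t within I)"
      by (rule has_vector_derivative_transform[OF _ _ has_vector_derivative_const]) (use Cons in auto)
    then show ?thesis using dt_eqI Cons.prems by (simp add: None pd_def)
  next
    case (Some j)
    have "((\<lambda>x. 0) has_derivative (\<lambda>v. 0)) (at x)" by simp
    then have "(word I w f t has_derivative (\<lambda>v. 0)) (at x)"
      by (rule has_derivative_transform_within_open[OF _ O]) (use Cons in auto)
    then show ?thesis using dx_eqI[of "word I w f" t "\<lambda>v. 0" x j] by (simp add: Some pd_def)
  qed
qed (simp add: f)

end

lemma norm_CN_word:
  fixes f :: "real \<Rightarrow> real ^ 'n::finite \<Rightarrow> 'b::real_normed_vector"
  assumes "norm_CN I N f \<le> ennreal b" "0 \<le> b" "length ks \<le> N" "t \<in> I"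
  shows "norm (foldr dx ks f t x) \<le> b"
proof -
  have "ennreal (norm (foldr dx ks f t x)) \<le> (SUP x. ennreal (norm (foldr dx ks f t x)))"
    by (rule SUP_upper) simp
  also have "\<dots> \<le> (SUP t\<in>I. SUP x. ennreal (norm (foldr dx ks f t x)))"
    by (rule SUP_upper) (rule assms(4))
  also have "\<dots> \<le> (SUP ks\<in>{ls. length ls = length ks}. SUP t\<in>I. SUP x. ennreal (norm (foldr dx ks f t x)))"
    by (rule SUP_upper) simp
  also have "\<dots> \<le> norm_CN I N f"
    unfolding norm_CN_def using assms(3)
    by (intro member_le_sum[of _ _ "\<lambda>j. SUP ks\<in>{ks. length ks = j}. SUP t\<in>I. SUP x. ennreal (norm (foldr dx ks f t x))"]) auto
  finally have "ennreal (norm (foldr dx ks f t x)) \<le> ennreal b" using assms(1) by (rule order_trans)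
  then show ?thesis using assms(2) by (simp add: ennreal_le_iff)
qed

text \<open>The factor \<open>Suc N\<close> counts the orders over which the norm sums.\<close>

lemma norm_CN_le:
  fixes f :: "real \<Rightarrow> real ^ 'n::finite \<Rightarrow> 'b::real_normed_vector"
  assumes "\<And>ks t x. length ks \<le> N \<Longrightarrow> t \<in> I \<Longrightarrow> norm (foldr dx ks f t x) \<le> b" "0 \<le> b"
  shows "norm_CN I N f \<le> ennreal (real (Suc N) * b)"
proof -
  have "norm_CN I N f \<le> (\<Sum>j\<le>N. ennreal b)"
    unfolding norm_CN_def
    by (intro sum_mono SUP_least ennreal_leI assms(1)) auto
  also have "\<dots> = ennreal (real (Suc N) * b)"
    using assms(2) by (simp add: ennreal_mult ennreal_of_nat_eq_real_of_nat del: of_nat_Suc)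
  finally show ?thesis .
qed

subsection \<open>The solution operator of a time-dependent deformation\<close>

lemma norm_matrix_vector_mult_le: "norm (A *v v) \<le> norm A * norm (v :: real ^ 'n::finite)" for A :: "real ^ 'n ^ 'm::finite"
proof -
  have "norm (A *v v) = L2_set (\<lambda>i. \<bar>A $ i \<bullet> v\<bar>) UNIV"
    by (simp add: norm_vec_def[of "A *v v"] matrix_vector_mul_component)
  also have "\<dots> \<le> L2_set (\<lambda>i. norm (A $ i) * norm v) UNIV"
    by (intro L2_set_mono Cauchy_Schwarz_ineq2) auto
  also have "\<dots> = norm A * norm v"
    by (simp add: norm_vec_def[of A] L2_set_left_distrib)
  finally show ?thesis .
qed

text \<open>\<open>LINT\<close> is 0 by convention for functions that are not integrable, so
  integrability has to be secured first; continuity and bounded support provide it.\<close>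

lemma has_integral_of_LINT:
  fixes f :: "'a::euclidean_space \<Rightarrow> real"
  assumes c: "continuous_on UNIV f" and s: "\<And>x. x \<notin> cball x0 r \<Longrightarrow> f x = 0" and i: "(LINT x|lborel. f x) = i"
  shows "(f has_integral i) UNIV"
proof -
  have "integrable lborel (\<lambda>x. indicator (cball x0 r) x *\<^sub>R f x)"
    by (intro borel_integrable_compact continuous_on_subset[OF c]) auto
  moreover have "(\<lambda>x. indicator (cball x0 r) x *\<^sub>R f x) = f"
    using s by (auto simp: fun_eq_iff indicator_def)
  ultimately show ?thesis using has_integral_integral_lborel[of f] i by simp
qed

text \<open>The value 0 makes the Jacobian of the rescaling irrelevant.\<close>

lemma has_integral_0_affine:
  fixes f :: "'a::euclidean_space \<Rightarrow> real"
  assumes f: "(f has_integral 0) UNIV" and s: "\<And>x. x \<notin> cball x0 r \<Longrightarrow> f x = 0" and m: "m \<noteq> 0"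
  shows "((\<lambda>\<xi>. f (x0 + m *\<^sub>R \<xi>)) has_integral 0) UNIV"
proof -
  obtain a b where ab: "cball x0 r \<subseteq> cbox a b"
    using bounded_subset_cbox_symmetric[OF bounded_cball] by blast
  then have s': "f x = 0" if "x \<notin> cbox a b" for x using s[of x] that by blast
  have "(\<lambda>x. if x \<in> cbox a b then f x else 0) = f" using s' by auto
  then have "(f has_integral 0) (cbox a b)"
    using f has_integral_restrict_UNIV[of "cbox a b" f 0] by simp
  from has_integral_affinity[OF this m, of x0]
  have "((\<lambda>x. f (m *\<^sub>R x + x0)) has_integral 0) ((\<lambda>x. (1 / m) *\<^sub>R x + - ((1 / m) *\<^sub>R x0)) ` cbox a b)" by simp
  then have "((\<lambda>x. f (m *\<^sub>R x + x0)) has_integral 0) UNIV"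
  proof (rule has_integral_on_superset)
    fix x assume x: "x \<notin> (\<lambda>x. (1 / m) *\<^sub>R x + - ((1 / m) *\<^sub>R x0)) ` cbox a b"
    have "x = (1 / m) *\<^sub>R (m *\<^sub>R x + x0) + - ((1 / m) *\<^sub>R x0)"
      using m by (simp add: algebra_simps)
    then have "m *\<^sub>R x + x0 \<notin> cbox a b" using x by blast
    then show "f (m *\<^sub>R x + x0) = 0" by (rule s')
  qed simp
  then show ?thesis by (simp add: add.commute)
qed

lemma (in time_range) Ck_on_slice:
  fixes f :: "real \<Rightarrow> real ^ 'n::finite \<Rightarrow> 'b::real_normed_vector"
  assumes "smooth_field I f" "t \<in> I"
  shows "Ck_on k UNIV (f t)"
proof -
  have "Ck_on k UNIV (\<lambda>x. (\<lambda>z. f (fst z) (snd z)) (t, x))"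
    by (rule Ck_on_compose[of k "I \<times> UNIV"])
       (use assms in \<open>auto simp: smooth_field_iff intro: Ck_on_Pair Ck_on_const Ck_on_ident\<close>)
  then show ?thesis by simp
qed

lemma (in time_range) smooth_field_dx: "smooth_field I f \<Longrightarrow> smooth_field I (dx j f)"
  using smooth_field_pd[of f "Some j"] by (simp add: pd_def)

text \<open>\<open>\<epsilon> \<le> 1 / 4\<close> yields the assumption \<open>near\<close> of
  \<open>near_identity\<close>, and \<open>det_near\<close> a lower bound for the determinant that
  controls every derivative of its reciprocal.\<close>

locale deformation = time_range I for I +
  fixes u :: "real \<Rightarrow> real ^ 'n::finite \<Rightarrow> real ^ 'n" and L :: nat and \<epsilon> \<Lambda> \<mu> :: real and x0 :: "real ^ 'n"
  assumes smooth_u: "smooth_field I u" and u_bounds: "deformation_bounds I L \<epsilon> \<Lambda> u"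
    and \<epsilon>: "0 < \<epsilon>" "\<epsilon> \<le> 1 / 4" and \<Lambda>: "1 \<le> \<Lambda>" and \<mu>: "0 < \<mu>"
    and det_near: "\<And>A :: real ^ 'n ^ 'n. norm (A - mat 1) \<le> \<epsilon> \<Longrightarrow> 1 / 2 \<le> det A"
begin

definition y :: "real \<Rightarrow> real ^ 'n \<Rightarrow> real ^ 'n" where
  "y t x = x + u t x"

text \<open>The entries of the gradient of \<open>y\<close> as scalar fields built from derivatives
  of \<open>u\<close>, the form in which \<open>SB\<close> applies; \<open>grad_y\<close> identifies
  them for \<open>t \<in> I\<close>.\<close>

definition f :: "'n \<Rightarrow> 'n \<Rightarrow> real \<Rightarrow> real ^ 'n \<Rightarrow> real" where
  "f i j t x = (if i = j then 1 else 0) + dx j (\<lambda>t x. u t x $ i) t x"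

definition F :: "real \<Rightarrow> real ^ 'n \<Rightarrow> real ^ 'n ^ 'n" where
  "F t x = (\<chi> i j. f i j t x)"

lemma smooth_du: "smooth_field I (dx j (\<lambda>t x. u t x $ i))"
  by (intro smooth_field_dx smooth_field_nth smooth_u)

lemma smooth_f: "smooth_field I (f i j)"
  unfolding f_def[abs_def] by (intro smooth_field_add smooth_field_const smooth_du)

lemma dx_u_nth: "t \<in> I \<Longrightarrow> dx j (\<lambda>t x. u t x $ i) t x = dx j u t x $ i"
  using pd_nth[OF smooth_u, of t "Some j"] by (simp add: pd_def)

lemma der_u: "t \<in> I \<Longrightarrow> (u t has_derivative (\<lambda>v. (F t x - mat 1) *v v)) (at x)"
proof -
  assume t: "t \<in> I"
  have "(\<Sum>j\<in>UNIV. v $ j *\<^sub>R dx j u t x) = (F t x - mat 1) *v v" for v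
    by (simp add: vec_eq_iff matrix_vector_mult_def F_def f_def mat_def dx_u_nth[OF t] sum_component mult.commute)
  then show ?thesis using slice_derivative[OF smooth_u t, of x] by simp
qed

lemma der_y: "t \<in> I \<Longrightarrow> (y t has_derivative (\<lambda>v. F t x *v v)) (at x)"
  unfolding y_def[abs_def]
  by (rule has_derivative_eq_rhs[OF has_derivative_add[OF has_derivative_ident der_u]])
     (simp_all add: matrix_vector_mult_diff_rdistrib fun_eq_iff)

lemma grad_eqI:
  assumes "(h t has_derivative (\<lambda>v. A *v v)) (at x)"
  shows "grad h t x = A"
  by (simp add: grad_def jacobian_def frechet_derivative_at[OF assms, symmetric])

lemma grad_y: "t \<in> I \<Longrightarrow> grad y t x = F t x"
  using grad_eqI[of y t "F t x" x] der_y by simp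

lemma F_near: "t \<in> I \<Longrightarrow> norm (F t x - mat 1) \<le> \<epsilon>"
proof -
  assume t: "t \<in> I"
  have "norm_CN I 0 (grad u) \<le> ennreal \<epsilon>" using u_bounds by (simp add: deformation_bounds_def)
  from norm_CN_word[OF this _ _ t, of "[]" x] have "norm (grad u t x) \<le> \<epsilon>" using \<epsilon> by simp
  then show ?thesis using grad_eqI[of u t "F t x - mat 1" x, OF der_u[OF t]] by simp
qed

lemma det_F: "t \<in> I \<Longrightarrow> 1 / 2 \<le> det (F t x)"
  by (rule det_near[OF F_near])

lemma F_vec_near: "t \<in> I \<Longrightarrow> norm (F t x *v v - v) \<le> \<epsilon> * norm v"
  using norm_matrix_vector_mult_le[of "F t x - mat 1" v] mult_right_mono[OF F_near[of t x], of "norm v"]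
  by (simp add: matrix_vector_mult_diff_rdistrib)

lemma u_lipschitz: "t \<in> I \<Longrightarrow> norm (u t a - u t b) \<le> \<epsilon> * norm (a - b)"
  by (rule differentiable_bound[where S = UNIV and f' = "\<lambda>x v. (F t x - mat 1) *v v"])
     (use der_u F_vec_near in \<open>auto intro!: onorm_le simp: matrix_vector_mult_diff_rdistrib\<close>)

text \<open>At a fixed time the problem is rescaled to \<open>\<mu> = 1\<close>, \<open>x0 = 0\<close> and \<open>y 0 = 0\<close>.\<close>

definition gs where "gs t \<xi> = (1 / \<mu>) *\<^sub>R (y t (x0 + \<mu> *\<^sub>R \<xi>) - y t x0)"
definition Gs where "Gs t \<xi> = F t (x0 + \<mu> *\<^sub>R \<xi>)"
definition dGs where "dGs t \<xi> i j v = \<mu> * (\<Sum>k\<in>UNIV. v $ k * dx k (dx j (\<lambda>t x. u t x $ i)) t (x0 + \<mu> *\<^sub>R \<xi>))"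
definition Us where "Us U t \<xi> = U t (x0 + \<mu> *\<^sub>R \<xi>)" for U :: "real \<Rightarrow> real ^ 'n \<Rightarrow> real ^ 'n"

lemma affine_derivative: "((\<lambda>\<xi>. x0 + \<mu> *\<^sub>R \<xi>) has_derivative (\<lambda>v. \<mu> *\<^sub>R v)) (at \<xi> within S)"
  by (auto intro!: derivative_eq_intros)

lemma Ck_on_affine: "Ck_on k UNIV h \<Longrightarrow> Ck_on k UNIV (\<lambda>\<xi>. h (x0 + \<mu> *\<^sub>R \<xi>))"
  by (rule Ck_on_compose_UNIV, assumption) (intro Ck_on_add Ck_on_scaleR Ck_on_const Ck_on_ident)

lemma near_identity_at:
  assumes t: "t \<in> I"
  shows "near_identity (gs t) (Gs t) (dGs t)"
proof
  show "gs t 0 = 0" by (simp add: gs_def)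
  show "(gs t has_derivative (\<lambda>v. Gs t \<xi> *v v)) (at \<xi>)" for \<xi>
  proof -
    have "((\<lambda>\<xi>. (1 / \<mu>) *\<^sub>R (y t (x0 + \<mu> *\<^sub>R \<xi>) - y t x0)) has_derivative (\<lambda>v. (1 / \<mu>) *\<^sub>R (F t (x0 + \<mu> *\<^sub>R \<xi>) *v (\<mu> *\<^sub>R v) - 0))) (at \<xi>)"
      by (intro has_derivative_scaleR_right has_derivative_diff has_derivative_const has_derivative_compose[OF affine_derivative der_y[OF t]])
    then show ?thesis using \<mu> by (simp add: gs_def[abs_def] Gs_def matrix_vector_mult_scaleR)
  qed
  show "((\<lambda>\<xi>. Gs t \<xi> $ i $ j) has_derivative dGs t \<xi> i j) (at \<xi>)" for \<xi> i j
  proof -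
    have "((\<lambda>\<xi>. (if i = j then 1 else 0) + dx j (\<lambda>t x. u t x $ i) t (x0 + \<mu> *\<^sub>R \<xi>)) has_derivative
        (\<lambda>v. 0 + (\<Sum>k\<in>UNIV. (\<mu> *\<^sub>R v) $ k *\<^sub>R dx k (dx j (\<lambda>t x. u t x $ i)) t (x0 + \<mu> *\<^sub>R \<xi>)))) (at \<xi>)"
      by (intro has_derivative_add has_derivative_const has_derivative_compose[OF affine_derivative slice_derivative[OF smooth_du t]])
    then show ?thesis by (simp add: Gs_def F_def f_def dGs_def[abs_def] sum_distrib_left mult.assoc)
  qed
  show "dGs t \<xi> i j (axis k 1) = dGs t \<xi> i k (axis j 1)" for \<xi> i j k
    using dx_comm[OF smooth_field_nth[OF smooth_u, of i] t, of k j]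
    by (simp add: dGs_def axis_nth_if if_distrib[of "\<lambda>u. u * _"] cong: if_cong)
  show "Ck_on (Suc 0) UNIV (gs t)"
    unfolding gs_def[abs_def] y_def[abs_def]
    by (intro Ck_on_scaleR Ck_on_const Ck_on_diff Ck_on_add Ck_on_ident Ck_on_affine[OF Ck_on_slice[OF smooth_u t]])
  show "Ck_on (Suc 0) UNIV (\<lambda>\<xi>. Gs t \<xi> $ i $ j)" for i j
    using Ck_on_affine[OF Ck_on_slice[OF smooth_f[of i j] t]] by (simp add: Gs_def F_def)
  show "norm (Gs t \<xi> *v v - v) \<le> norm v / 4" for \<xi> v
    using F_vec_near[OF t, of "x0 + \<mu> *\<^sub>R \<xi>" v] mult_right_mono[OF \<epsilon>(2), of "norm v"] by (simp add: Gs_def)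
qed

abbreviation "adm U \<equiv> admissible I y x0 \<mu> U"

lemma adm_outside:
  assumes U: "adm U" "t \<in> I" and x: "x \<notin> ball x0 \<mu>"
  shows "U t x = 0"
proof (rule ccontr)
  assume "U t x \<noteq> 0"
  then have "x \<in> supp_x (U t)" unfolding supp_x_def by (intro subsetD[OF closure_subset]) simp
  moreover have "supp_x (U t) \<subseteq> ball x0 \<mu>" using U by (simp add: admissible_def)
  ultimately show False using x by blast
qed

text \<open>Subtracting the constant \<open>y t x0\<close> changes the angular moments by linear
  moments, which vanish.\<close>

lemma static_at:
  assumes U: "adm U" and t: "t \<in> I"
  shows "static (gs t) (Gs t) (dGs t) bump_weight bump_grad bump_hess (Us U t)"
proof -
  interpret near_identity "gs t" "Gs t" "dGs t" by (rule near_identity_at[OF t])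
  interpret weight "bump_weight :: real ^ 'n \<Rightarrow> real" bump_grad bump_hess by (rule bump_weight_is_weight)
  have smU: "smooth_field I U" using U by (simp add: admissible_def)
  have out: "U t x = 0" if "x \<notin> cball x0 \<mu>" for x
    using adm_outside[OF U t, of x] that by auto
  have cU: "continuous_on UNIV (\<lambda>x. U t x $ l)" for l
    by (rule Ck_on_continuous[of "Suc 0"]) (intro Ck_on_nth Ck_on_slice[OF smU t])
  have cy: "continuous_on UNIV (\<lambda>x. y t x $ l)" for l
    unfolding y_def by (rule Ck_on_continuous[of "Suc 0"]) (intro Ck_on_nth Ck_on_add Ck_on_ident Ck_on_slice[OF smooth_u t])
  have m0: "((\<lambda>x. U t x $ l) has_integral 0) UNIV" for l
    by (rule has_integral_of_LINT[OF cU, of x0 \<mu>]) (use out U t in \<open>auto simp: admissible_def\<close>)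
  have m1: "((\<lambda>x. y t x $ j * U t x $ l - y t x $ l * U t x $ j) has_integral 0) UNIV" for j l
    by (rule has_integral_of_LINT[of _ x0 \<mu>])
       (use out U t in \<open>auto simp: admissible_def intro!: continuous_intros cU cy\<close>)
  show ?thesis
  proof
    show "Ck_on (Suc 0) UNIV (Us U t)"
      unfolding Us_def[abs_def] by (rule Ck_on_affine[OF Ck_on_slice[OF smU t]])
    show "Us U t \<xi> = 0" if "1 \<le> norm \<xi>" for \<xi>
      unfolding Us_def by (rule adm_outside[OF U t]) (use that \<mu> mult_left_mono[OF that, of \<mu>] in \<open>auto simp: dist_norm\<close>)
    show "integral UNIV (\<lambda>\<xi>. Us U t \<xi> $ l) = 0" for l
      unfolding Us_def
      by (rule integral_unique, rule has_integral_0_affine[OF m0, of x0 \<mu>]) (use out \<mu> in auto)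
    show "integral UNIV (\<lambda>\<xi>. gs t \<xi> $ j * Us U t \<xi> $ l - gs t \<xi> $ l * Us U t \<xi> $ j) = 0" for j l
    proof -
      have "((\<lambda>x. (1 / \<mu>) * ((y t x $ j * U t x $ l - y t x $ l * U t x $ j) - y t x0 $ j * U t x $ l + y t x0 $ l * U t x $ j))
          has_integral (1 / \<mu>) * (0 - y t x0 $ j * 0 + y t x0 $ l * 0)) UNIV"
        by (intro has_integral_mult_right has_integral_add has_integral_diff m0 m1)
      then have "((\<lambda>x. (1 / \<mu>) * ((y t x $ j * U t x $ l - y t x $ l * U t x $ j) - y t x0 $ j * U t x $ l + y t x0 $ l * U t x $ j))
          has_integral 0) UNIV" by simp
      from has_integral_0_affine[OF this, of x0 \<mu> \<mu>]
      have "((\<lambda>\<xi>. (1 / \<mu>) * ((y t (x0 + \<mu> *\<^sub>R \<xi>) $ j * U t (x0 + \<mu> *\<^sub>R \<xi>) $ l - y t (x0 + \<mu> *\<^sub>R \<xi>) $ l * U t (x0 + \<mu> *\<^sub>R \<xi>) $ j)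
          - y t x0 $ j * U t (x0 + \<mu> *\<^sub>R \<xi>) $ l + y t x0 $ l * U t (x0 + \<mu> *\<^sub>R \<xi>) $ j)) has_integral 0) UNIV"
        using out \<mu> by simp
      then show ?thesis
        by (intro integral_unique) (simp add: gs_def Us_def algebra_simps add_divide_distrib diff_divide_distrib)
    qed
  qed
qed

text \<open>The chord of the rescaled map, expressed at the original point \<open>x\<close> while
  \<open>\<kappa>\<close> stays rescaled, see \<open>chord_at\<close>. Thus \<open>t\<close> and
  \<open>x\<close> enter only through translates of \<open>f\<close>.\<close>

definition H :: "real \<Rightarrow> real ^ 'n \<Rightarrow> real \<Rightarrow> real ^ 'n \<Rightarrow> real ^ 'n" where
  "H t x s \<kappa> = (\<chi> i. integral (cbox 0 1) (\<lambda>\<theta>. \<Sum>j\<in>UNIV. f i j t (x + (\<theta> * (1 - s) * \<mu>) *\<^sub>R \<kappa>) * \<kappa> $ j))"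

text \<open>The base point of the segment, relative to the image of \<open>x0\<close> and in units
  of \<open>\<mu>\<close>.\<close>

definition Z :: "real \<Rightarrow> real ^ 'n \<Rightarrow> real \<Rightarrow> real ^ 'n \<Rightarrow> real ^ 'n" where
  "Z t x s \<kappa> = (1 / \<mu>) *\<^sub>R (y t x - y t x0) - s *\<^sub>R H t x s \<kappa>"

definition K :: "(real \<Rightarrow> real ^ 'n \<Rightarrow> real ^ 'n) \<Rightarrow> 'n \<Rightarrow> 'n \<Rightarrow> real \<Rightarrow> real ^ 'n \<Rightarrow> real \<Rightarrow> real ^ 'n \<Rightarrow> real" where
  "K U j k t x s \<kappa> = kern (bump_weight (Z t x s \<kappa>)) (bump_grad (Z t x s \<kappa>)) (U t (x + ((1 - s) * \<mu>) *\<^sub>R \<kappa>)) (H t x s \<kappa>) j k"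

definition Sd :: "(real \<Rightarrow> real ^ 'n \<Rightarrow> real ^ 'n) \<Rightarrow> 'n \<Rightarrow> 'n \<Rightarrow> real \<Rightarrow> real ^ 'n \<Rightarrow> real" where
  "Sd U j k t x = integral (cbox 0 1) (\<lambda>s. integral (cube 4) (\<lambda>\<kappa>. K U j k t x s \<kappa>))"

text \<open>The factor \<open>\<mu>\<close> undoes the rescaling, since a derivative in
  \<open>x\<close> is \<open>1 / \<mu>\<close> times one in the rescaled variable.\<close>

definition Rd :: "(real \<Rightarrow> real ^ 'n \<Rightarrow> real ^ 'n) \<Rightarrow> real \<Rightarrow> real ^ 'n \<Rightarrow> real ^ 'n ^ 'n" where
  "Rd U t x = (\<chi> a b. \<mu> * (1 / det (F t x)) * (\<Sum>i\<in>UNIV. \<Sum>k\<in>UNIV. cof (F t x) i a * Sd U i k t x * cof (F t x) k b))"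

lemma Rd_sym: "transpose (Rd U t x) = Rd U t x"
proof -
  have S: "Sd U i k t x = Sd U k i t x" for i k
    by (simp add: Sd_def K_def kern_commute[of _ _ _ _ i k])
  have "(\<Sum>i\<in>UNIV. \<Sum>k\<in>UNIV. cof (F t x) i a * Sd U i k t x * cof (F t x) k b)
      = (\<Sum>i\<in>UNIV. \<Sum>k\<in>UNIV. cof (F t x) i b * Sd U i k t x * cof (F t x) k a)" for a b
    by (subst sum.swap) (intro sum.cong refl, subst S, simp)
  then show ?thesis by (simp add: Rd_def transpose_def vec_eq_iff)
qed

lemma chord_at:
  assumes t: "t \<in> I"
  shows "near_identity.chord (Gs t) s \<xi> \<kappa> = H t (x0 + \<mu> *\<^sub>R \<xi>) s \<kappa>"
proof -
  interpret near_identity "gs t" "Gs t" "dGs t" by (rule near_identity_at[OF t])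
  let ?v = "\<lambda>\<theta>. Gs t (\<xi> + (\<theta> * (1 - s)) *\<^sub>R \<kappa>) *v \<kappa>"
  have cv: "continuous_on {0..1} (\<lambda>\<theta>. ?v \<theta> $ i)" for i
  proof -
    have "continuous_on {0..1} (\<lambda>\<theta>. Gs t (\<xi> + (\<theta> * (1 - s)) *\<^sub>R \<kappa>) $ i $ j)" for j
      by (rule continuous_on_compose2[OF Ck_on_continuous[OF C1_G]]) (auto intro!: continuous_intros)
    then show ?thesis
      unfolding matrix_vector_mult_def vec_lambda_beta by (intro continuous_on_sum continuous_on_mult continuous_on_const)
  qed
  have "continuous_on {0..1} ?v"
  proof (subst continuous_on_componentwise, rule ballI)
    fix b :: "real ^ 'n" assume "b \<in> Basis"
    then obtain i where "b = axis i 1" by (auto simp: Basis_vec_def)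
    then show "continuous_on {0..1} (\<lambda>\<theta>. ?v \<theta> \<bullet> b)" using cv[of i] by (simp only: inner_axis inner_real_def mult_1_right)
  qed
  then have "integral {0..1} ?v $ i = integral {0..1} (\<lambda>\<theta>. ?v \<theta> $ i)" for i
    using integral_linear[OF integrable_continuous_real bounded_linear_vec_nth, of 0 1 ?v i] by (simp add: o_def)
  moreover have "?v \<theta> $ i = (\<Sum>j\<in>UNIV. f i j t (x0 + \<mu> *\<^sub>R \<xi> + (\<theta> * (1 - s) * \<mu>) *\<^sub>R \<kappa>) * \<kappa> $ j)" for \<theta> i
    by (simp add: matrix_vector_mult_def Gs_def F_def algebra_simps)
  ultimately show ?thesis by (simp add: chord_def H_def vec_eq_iff)
qed

lemma S_at:
  assumes U: "adm U" and t: "t \<in> I"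
  shows "static.S (gs t) (Gs t) bump_weight bump_grad (Us U t) j k \<xi> = Sd U j k t (x0 + \<mu> *\<^sub>R \<xi>)"
proof -
  interpret static "gs t" "Gs t" "dGs t" bump_weight bump_grad bump_hess "Us U t" by (rule static_at[OF U t])
  have "Us U t (\<xi> + (1 - s) *\<^sub>R \<kappa>) = U t (x0 + \<mu> *\<^sub>R \<xi> + ((1 - s) * \<mu>) *\<^sub>R \<kappa>)" for s \<kappa>
    by (simp add: Us_def algebra_simps)
  then show ?thesis
    by (simp add: S_def Sd_def K_def Z_def chord_at[OF t] gs_def)
qed

lemma R_at:
  assumes U: "adm U" and t: "t \<in> I"
  shows "Rd U t x = \<mu> *\<^sub>R static.R (gs t) (Gs t) bump_weight bump_grad (Us U t) ((1 / \<mu>) *\<^sub>R (x - x0))"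
proof -
  interpret static "gs t" "Gs t" "dGs t" bump_weight bump_grad bump_hess "Us U t" by (rule static_at[OF U t])
  have x: "x0 + \<mu> *\<^sub>R ((1 / \<mu>) *\<^sub>R (x - x0)) = x" using \<mu> by simp
  show ?thesis
    by (simp only: Rd_def R_def S_at[OF U t] Gs_def x) (simp add: vec_eq_iff mult.assoc)
qed

lemma divergence_Rd:
  assumes U: "adm U" and t: "t \<in> I"
  shows "divergence (\<lambda>t x. grad y t x ** Rd U t x) t x = U t x"
proof -
  interpret static "gs t" "Gs t" "dGs t" bump_weight bump_grad bump_hess "Us U t" by (rule static_at[OF U t])
  let ?\<xi> = "\<lambda>x. (1 / \<mu>) *\<^sub>R (x - x0)"
  have x: "x0 + \<mu> *\<^sub>R ?\<xi> x = x" for x using \<mu> by simp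
  have e: "(grad y t x ** Rd U t x) $ l $ b = \<mu> * (Gs t (?\<xi> x) ** R (?\<xi> x)) $ l $ b" for x l b
    by (simp only: grad_y[OF t] R_at[OF U t] Gs_def x)
       (simp add: matrix_matrix_mult_def sum_distrib_left mult_ac)
  have "(\<Sum>b\<in>UNIV. dx b (\<lambda>t x. (grad y t x ** Rd U t x) $ l $ b) t x) = U t x $ l" for l
  proof -
    obtain D where D: "\<And>b. ((\<lambda>x. (Gs t x ** R x) $ l $ b) has_derivative D b) (at (?\<xi> x))"
      "(\<Sum>b\<in>UNIV. D b (axis b 1)) = Us U t (?\<xi> x) $ l"
      by (rule divergence_G_R) (rule that)
    have "dx b (\<lambda>t x. (grad y t x ** Rd U t x) $ l $ b) t x = D b (axis b 1)" for b
    proof -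
      have d\<xi>: "(?\<xi> has_derivative (\<lambda>v. (1 / \<mu>) *\<^sub>R v)) (at x)"
        by (auto intro!: derivative_eq_intros)
      have "((\<lambda>x. \<mu> * (Gs t (?\<xi> x) ** R (?\<xi> x)) $ l $ b) has_derivative (\<lambda>v. \<mu> * D b ((1 / \<mu>) *\<^sub>R v))) (at x)"
        by (rule has_derivative_mult_right[OF has_derivative_compose[OF d\<xi> D(1)]])
      then have "dx b (\<lambda>t x. (grad y t x ** Rd U t x) $ l $ b) t x = \<mu> * D b ((1 / \<mu>) *\<^sub>R axis b 1)"
        using dx_eqI[of "\<lambda>t x. (grad y t x ** Rd U t x) $ l $ b" t "\<lambda>v. \<mu> * D b ((1 / \<mu>) *\<^sub>R v)" x b] by (simp add: e)
      then show ?thesis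
        using linear_cmul[OF has_derivative_linear[OF D(1)[of b]], of "1 / \<mu>" "axis b 1"] \<mu> by simp
    qed
    then show ?thesis using D(2) unfolding Us_def x by simp
  qed
  then show ?thesis by (simp add: divergence_def vec_eq_iff)
qed

text \<open>The strict inequality is what puts the closed support into an open ball. It comes from
  compactness of \<open>supp_x (U t)\<close>, which lies in a closed ball of radius less than
  \<open>\<mu>\<close>.\<close>

lemma Rd_support:
  assumes U: "adm U" and t: "t \<in> I"
  shows "\<exists>r < (1 + 4 * \<epsilon>) * \<mu>. \<forall>x. r < dist x0 x \<longrightarrow> Rd U t x = 0"
proof -
  interpret static "gs t" "Gs t" "dGs t" bump_weight bump_grad bump_hess "Us U t" by (rule static_at[OF U t])
  have "supp_x (U t) \<subseteq> ball x0 \<mu>" using U t by (simp add: admissible_def)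
  moreover have "closed (supp_x (U t))" by (simp add: supp_x_def)
  ultimately have "compact (supp_x (U t))"
    using compact_eq_bounded_closed bounded_subset[OF bounded_ball] by metis
  have "\<exists>r. 0 \<le> r \<and> r < \<mu> \<and> (\<forall>x\<in>supp_x (U t). dist x0 x \<le> r)"
  proof (cases "supp_x (U t) = {}")
    case False
    obtain z where z: "z \<in> supp_x (U t)" "\<forall>x\<in>supp_x (U t). dist x0 x \<le> dist x0 z"
      using distance_attains_sup[OF \<open>compact (supp_x (U t))\<close> False, of x0] by blast
    then show ?thesis using \<open>supp_x (U t) \<subseteq> ball x0 \<mu>\<close> by (intro exI[of _ "dist x0 z"]) auto
  qed (use \<mu> in auto)
  then obtain r where r: "0 \<le> r" "r < \<mu>" "\<forall>x\<in>supp_x (U t). dist x0 x \<le> r" by blast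
  have gs_eq: "gs t \<xi> = \<xi> + (1 / \<mu>) *\<^sub>R (u t (x0 + \<mu> *\<^sub>R \<xi>) - u t x0)" for \<xi>
    using \<mu> by (simp add: gs_def y_def algebra_simps)
  have ub: "norm ((1 / \<mu>) *\<^sub>R (u t (x0 + \<mu> *\<^sub>R \<xi>) - u t x0)) \<le> \<epsilon> * norm \<xi>" for \<xi>
    unfolding norm_scaleR using u_lipschitz[OF t, of "x0 + \<mu> *\<^sub>R \<xi>" x0] \<mu> by (simp add: divide_le_eq mult_ac)
  have up: "norm (gs t \<xi>) \<le> (1 + \<epsilon>) * norm \<xi>" for \<xi>
    unfolding gs_eq using norm_triangle_ineq[of \<xi> "(1 / \<mu>) *\<^sub>R (u t (x0 + \<mu> *\<^sub>R \<xi>) - u t x0)"] ub[of \<xi>]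
    by (simp add: algebra_simps)
  have lo: "(1 - \<epsilon>) * norm \<xi> \<le> norm (gs t \<xi>)" for \<xi>
    unfolding gs_eq using norm_diff_ineq[of \<xi> "(1 / \<mu>) *\<^sub>R (u t (x0 + \<mu> *\<^sub>R \<xi>) - u t x0)"] ub[of \<xi>]
    by (simp add: algebra_simps)
  \<comment> \<open>A radius in the coordinates \<open>y\<close> containing both the weight and the
    image of the support of \<open>U\<close>.\<close>
  define m where "m = max (1 / 2) ((1 + \<epsilon>) * (r / \<mu>))"
  have m1: "norm (gs t \<xi>) \<le> m" if "Us U t \<xi> \<noteq> 0" for \<xi>
  proof -
    have "x0 + \<mu> *\<^sub>R \<xi> \<in> supp_x (U t)"
      using that unfolding supp_x_def by (intro subsetD[OF closure_subset]) (simp add: Us_def)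
    then have "norm (\<mu> *\<^sub>R \<xi>) \<le> r" using r(3) by (auto simp: dist_norm)
    then have "norm \<xi> \<le> r / \<mu>" using \<mu> by (simp add: field_simps)
    then have "(1 + \<epsilon>) * norm \<xi> \<le> (1 + \<epsilon>) * (r / \<mu>)" using \<epsilon> by (intro mult_left_mono) auto
    then show ?thesis using up[of \<xi>] by (simp add: m_def)
  qed
  \<comment> \<open>Going to \<open>y\<close> and back costs
    \<open>(1 + \<epsilon>) / (1 - \<epsilon>)\<close>, at most \<open>1 + 4 * \<epsilon>\<close>
    for \<open>\<epsilon> \<le> 1 / 4\<close>; this is the origin of the 4.\<close>
  have m2: "m / (1 - \<epsilon>) < 1 + 4 * \<epsilon>"
  proof -
    have "\<epsilon> * \<epsilon> \<le> \<epsilon> * (1 / 4)" using \<epsilon> by (intro mult_left_mono) auto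
    then have le: "1 + \<epsilon> \<le> (1 + 4 * \<epsilon>) * (1 - \<epsilon>)" using \<epsilon> by (simp add: algebra_simps)
    have "(1 + \<epsilon>) * (r / \<mu>) < (1 + \<epsilon>) * 1"
      using r \<mu> \<epsilon> by (intro mult_strict_left_mono) (auto simp: field_simps)
    also have "\<dots> \<le> (1 + 4 * \<epsilon>) * (1 - \<epsilon>)" using le by simp
    finally have "(1 + \<epsilon>) * (r / \<mu>) < (1 + 4 * \<epsilon>) * (1 - \<epsilon>)" .
    moreover have "1 / 2 < (1 + 4 * \<epsilon>) * (1 - \<epsilon>)" using le \<epsilon> by linarith
    ultimately have "m < (1 + 4 * \<epsilon>) * (1 - \<epsilon>)" by (simp add: m_def)
    then show ?thesis using \<epsilon> by (simp add: divide_less_eq)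
  qed
  show ?thesis
  proof (intro exI[of _ "m / (1 - \<epsilon>) * \<mu>"] conjI allI impI)
    show "m / (1 - \<epsilon>) * \<mu> < (1 + 4 * \<epsilon>) * \<mu>" using m2 \<mu> by (rule mult_strict_right_mono)
    fix x assume x: "m / (1 - \<epsilon>) * \<mu> < dist x0 x"
    define \<xi> where "\<xi> = (1 / \<mu>) *\<^sub>R (x - x0)"
    have n: "norm \<xi> = dist x0 x / \<mu>" using \<mu> by (simp add: \<xi>_def dist_norm norm_minus_commute)
    have "m / (1 - \<epsilon>) < norm \<xi>" unfolding n using x \<mu> by (simp only: pos_less_divide_eq)
    moreover have "0 < 1 - \<epsilon>" using \<epsilon> by simp
    ultimately have "m < (1 - \<epsilon>) * norm \<xi>" by (simp only: pos_divide_less_eq mult.commute)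
    then have "m < norm (gs t \<xi>)" using lo[of \<xi>] by linarith
    moreover have "1 / 2 \<le> m" by (simp add: m_def)
    ultimately have "S i k \<xi> = 0" for i k
      using S_support[of m \<xi> i k] m1 by blast
    then show "Rd U t x = 0" unfolding R_at[OF U t] R_def \<xi>_def[symmetric] by (simp add: vec_eq_iff)
  qed
qed

text \<open>The formula is local in time, which gives the statement on temporal supports.\<close>

lemma Rd_zero:
  assumes "\<And>x. U t x = 0"
  shows "Rd U t x = 0"
proof -
  have "K U j k t x s \<kappa> = 0" for j k s \<kappa> by (simp only: K_def assms kern_0)
  then show ?thesis by (simp add: Rd_def Sd_def vec_eq_iff)
qed

end

section \<open>Smoothness and linearity of the solution operator\<close>

lemma kern_linear: "kern p g (a *\<^sub>R V + b *\<^sub>R W) h j k = a * kern p g V h j k + b * kern p g W h j k"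
  by (simp add: kern_def inner_simps algebra_simps add_divide_distrib diff_divide_distrib)

lemma (in time_range) Ck_on_field_compose:
  fixes f :: "real \<Rightarrow> real ^ 'n::finite \<Rightarrow> 'b::real_normed_vector"
  assumes "smooth_field I f" "Ck_on k S a" "Ck_on k S b" "\<And>q. q \<in> S \<Longrightarrow> a q \<in> I"
  shows "Ck_on k S (\<lambda>q. f (a q) (b q))"
proof -
  have "Ck_on k S (\<lambda>q. (\<lambda>z. f (fst z) (snd z)) (a q, b q))"
    by (rule Ck_on_compose[of k "I \<times> UNIV"])
       (use assms in \<open>auto simp: smooth_field_iff intro: Ck_on_Pair\<close>)
  then show ?thesis by simp
qed

context deformation
begin

lemma Ck_on_f: "Ck_on k S a \<Longrightarrow> Ck_on k S b \<Longrightarrow> (\<And>q. q \<in> S \<Longrightarrow> a q \<in> I) \<Longrightarrow> Ck_on k S (\<lambda>q. f i j (a q) (b q))"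
  by (rule Ck_on_field_compose[OF smooth_f])

text \<open>All arguments are functions of one variable \<open>q\<close>, so the same lemma serves
  when different groups of \<open>t\<close>, \<open>x\<close>, \<open>s\<close> and
  \<open>\<kappa>\<close> vary.\<close>

lemma Ck_on_H:
  fixes a :: "'c::euclidean_space \<Rightarrow> real"
  assumes S: "convex S" and a: "Ck_on k S a" "\<And>q. q \<in> S \<Longrightarrow> a q \<in> I"
    and b: "Ck_on k S b" and s: "Ck_on k S s" and \<kappa>: "Ck_on k S \<kappa>"
  shows "Ck_on k S (\<lambda>q. H (a q) (b q) (s q) (\<kappa> q))"
proof (rule Ck_on_vec)
  fix i
  have lift: "Ck_on k (S \<times> cbox 0 1) (\<lambda>p. h (fst p))" if "Ck_on k S h" for h :: "'c \<Rightarrow> 'd::real_normed_vector"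
    by (rule Ck_on_compose[OF that]) (auto intro: Ck_on_fst Ck_on_ident)
  have "Ck_on k (S \<times> cbox 0 1) (\<lambda>p. \<Sum>j\<in>UNIV. f i j (a (fst p)) (b (fst p) + (snd p * (1 - s (fst p)) * \<mu>) *\<^sub>R \<kappa> (fst p)) * \<kappa> (fst p) $ j)"
    by (intro Ck_on_sum Ck_on_mult Ck_on_f Ck_on_nth Ck_on_add Ck_on_diff Ck_on_scaleR Ck_on_const lift a b s \<kappa> Ck_on_snd Ck_on_ident)
       (use a in auto)
  from Ck_on_integral[OF S this] show "Ck_on k S (\<lambda>q. H (a q) (b q) (s q) (\<kappa> q) $ i)"
    by (simp add: H_def)
qed

lemma Ck_on_Z:
  fixes a :: "'c::euclidean_space \<Rightarrow> real"
  assumes S: "convex S" and a: "Ck_on k S a" "\<And>q. q \<in> S \<Longrightarrow> a q \<in> I"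
    and b: "Ck_on k S b" and s: "Ck_on k S s" and \<kappa>: "Ck_on k S \<kappa>"
  shows "Ck_on k S (\<lambda>q. Z (a q) (b q) (s q) (\<kappa> q))"
  unfolding Z_def y_def
  by (intro Ck_on_diff Ck_on_add Ck_on_scaleR Ck_on_const b s Ck_on_H[OF S a b s \<kappa>] Ck_on_field_compose[OF smooth_u] a)

lemma Ck_on_K:
  fixes a :: "'c::euclidean_space \<Rightarrow> real"
  assumes U: "smooth_field I U" and S: "convex S" and a: "Ck_on k S a" "\<And>q. q \<in> S \<Longrightarrow> a q \<in> I"
    and b: "Ck_on k S b" and s: "Ck_on k S s" and \<kappa>: "Ck_on k S \<kappa>"
  shows "Ck_on k S (\<lambda>q. K U j l (a q) (b q) (s q) (\<kappa> q))"
  unfolding K_def kern_def bump_weight_def bump_grad_def divide_inverse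
  by (intro Ck_on_diff Ck_on_add Ck_on_mult Ck_on_scaleR Ck_on_inner Ck_on_nth Ck_on_const b s \<kappa> Ck_on_bump
      Ck_on_H[OF S a b s \<kappa>] Ck_on_Z[OF S a b s \<kappa>] Ck_on_field_compose[OF U] a)

lemma psmooth_K: "smooth_field I U \<Longrightarrow> psmooth (- (4 *\<^sub>R One)) (4 *\<^sub>R One) (\<lambda>t x \<kappa>. K U j l t x s \<kappa>)"
  unfolding psmooth_def
  by (intro allI Ck_on_K convex_Times convex_S convex_box Ck_on_fst Ck_on_snd Ck_on_const Ck_on_ident) auto

lemma psmooth_int_K:
  assumes U: "smooth_field I U"
  shows "psmooth 0 1 (\<lambda>t x s. integral (cube 4) (\<lambda>\<kappa>. K U j l t x s \<kappa>))"
  unfolding psmooth_def cube_def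
proof
  fix k
  have "Ck_on k (((I \<times> UNIV) \<times> cbox 0 1) \<times> cbox (- (4 *\<^sub>R One)) (4 *\<^sub>R One))
      (\<lambda>q. K U j l (fst (fst (fst q))) (snd (fst (fst q))) (snd (fst q)) (snd q))"
    by (intro Ck_on_K[OF U] convex_Times convex_S convex_box Ck_on_fst Ck_on_snd Ck_on_ident) auto
  from Ck_on_integral[OF _ this]
  show "Ck_on k ((I \<times> UNIV) \<times> cbox 0 1) (\<lambda>q. integral (cbox (- (4 *\<^sub>R One)) (4 *\<^sub>R One)) (\<lambda>\<kappa>. K U j l (fst (fst q)) (snd (fst q)) (snd q) \<kappa>))"
    by (simp add: convex_Times convex_S)
qed

lemma smooth_Sd: "smooth_field I U \<Longrightarrow> smooth_field I (Sd U j l)"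
  using psmooth_integral[OF psmooth_int_K, of U j l] by (simp add: Sd_def[abs_def])

lemma smooth_cof: "smooth_field I (\<lambda>t x. cof (F t x) i j)" and smooth_det: "smooth_field I (\<lambda>t x. det (F t x))"
  using smooth_f by (auto simp: smooth_field_iff F_def intro!: Ck_on_cof Ck_on_det)

lemma smooth_Rd: "smooth_field I U \<Longrightarrow> smooth_field I (Rd U)"
proof -
  assume U: "smooth_field I U"
  have nz: "det (F (fst z) (snd z)) \<noteq> 0" if "z \<in> I \<times> UNIV" for z
    using det_F[of "fst z" "snd z"] that by auto
  show ?thesis
    unfolding smooth_field_iff
  proof (intro allI Ck_on_vec)
    fix k a b
    show "Ck_on k (I \<times> UNIV) (\<lambda>z. Rd U (fst z) (snd z) $ a $ b)"
      using smooth_Sd[OF U] smooth_cof smooth_det unfolding Rd_def vec_lambda_beta smooth_field_iff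
      by (intro Ck_on_mult Ck_on_sum Ck_on_divide Ck_on_const nz) auto
  qed
qed

lemma Sd_linear:
  assumes U: "smooth_field I U" and V: "smooth_field I V" and t: "t \<in> I"
  shows "Sd (\<lambda>t x. a *\<^sub>R U t x + b *\<^sub>R V t x) j k t x = a * Sd U j k t x + b * Sd V j k t x"
proof -
  have K: "K (\<lambda>t x. a *\<^sub>R U t x + b *\<^sub>R V t x) j k t x s \<kappa> = a * K U j k t x s \<kappa> + b * K V j k t x s \<kappa>" for s \<kappa>
    by (simp add: K_def kern_linear)
  have i1: "(\<lambda>\<kappa>. K W j k t x s \<kappa>) integrable_on cube 4" if "smooth_field I W" for W s
  proof -
    have "Ck_on 0 (cbox (- (4 *\<^sub>R One)) (4 *\<^sub>R One)) (\<lambda>\<kappa>. K W j k t x s \<kappa>)"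
      by (rule Ck_on_K[OF that convex_box(1) Ck_on_const t Ck_on_const Ck_on_const Ck_on_ident])
    then show ?thesis unfolding cube_def by (intro integrable_continuous) simp
  qed
  have i2: "(\<lambda>s. integral (cube 4) (\<lambda>\<kappa>. K W j k t x s \<kappa>)) integrable_on cbox 0 1" if "smooth_field I W" for W
  proof -
    have "Ck_on 0 (cbox 0 1 \<times> cbox (- (4 *\<^sub>R One)) (4 *\<^sub>R One)) (\<lambda>q. K W j k t x (fst q) (snd q))"
      by (intro Ck_on_K[OF that] convex_Times convex_box Ck_on_const Ck_on_fst Ck_on_snd Ck_on_ident t)
    from Ck_on_integral[OF convex_box(1) this] show ?thesis
      unfolding cube_def by (intro integrable_continuous) simp
  qed
  have "integral (cube 4) (\<lambda>\<kappa>. a * K U j k t x s \<kappa> + b * K V j k t x s \<kappa>)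
      = a * integral (cube 4) (\<lambda>\<kappa>. K U j k t x s \<kappa>) + b * integral (cube 4) (\<lambda>\<kappa>. K V j k t x s \<kappa>)" for s
    using i1[OF U, of s] i1[OF V, of s]
    by (subst Henstock_Kurzweil_Integration.integral_add) (auto intro: integrable_on_mult_right)
  then show ?thesis
    unfolding Sd_def K using i2[OF U] i2[OF V]
    by (simp only:) (subst Henstock_Kurzweil_Integration.integral_add, auto intro: integrable_on_mult_right)
qed

lemma Rd_linear:
  assumes "smooth_field I U" "smooth_field I V" "t \<in> I"
  shows "Rd (\<lambda>t x. a *\<^sub>R U t x + b *\<^sub>R V t x) t x = a *\<^sub>R Rd U t x + b *\<^sub>R Rd V t x"
  unfolding Rd_def Sd_linear[OF assms]
  by (simp add: vec_eq_iff sum.distrib sum_distrib_left algebra_simps add_divide_distrib)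

section \<open>Derivative estimates for the solution operator\<close>

lemma psmooth_H:
  "psmooth 0 1 (\<lambda>t x \<theta>. \<Sum>j\<in>UNIV. f i j t (x + (\<theta> * (1 - s) * \<mu>) *\<^sub>R \<kappa>) * \<kappa> $ j)"
  unfolding psmooth_def
  by (intro allI Ck_on_sum Ck_on_mult Ck_on_f Ck_on_add Ck_on_scaleR Ck_on_const Ck_on_fst Ck_on_snd Ck_on_ident) auto

lemma u_word:
  assumes "2 \<le> length ks + r" "length ks + r \<le> L + 2" "t \<in> I"
  shows "norm (foldr dx ks ((dt I ^^ r) u) t x) \<le> \<epsilon> * \<Lambda> ^ (length ks + r - 1)"
proof (rule norm_CN_word[OF _ _ order_refl assms(3)])
  show "norm_CN I (length ks) ((dt I ^^ r) u) \<le> ennreal (\<epsilon> * \<Lambda> ^ (length ks + r - 1))"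
    using u_bounds assms by (simp add: deformation_bounds_def)
qed (use \<epsilon> \<Lambda> in auto)

end

text \<open>One constant for each layer of the formula: \<open>Z\<close>, the argument of
  \<open>bump\<close>, \<open>bump\<close>, the gradient of the weight, the scalar factor of
  \<open>kern\<close>, the kernel, cofactors and determinant, the reciprocal determinant, and
  \<open>Rd\<close>. The arguments are the dimension \<open>n\<close>, \<open>L\<close>, a bound
  \<open>G\<close> for the derivatives of \<open>bump\<close>, its mass \<open>m\<close> and the
  volume \<open>v\<close> of the cube.\<close>

definition c_Z :: "real \<Rightarrow> real" where "c_Z n = 5 + 8 * n"
definition c_q :: "real \<Rightarrow> nat \<Rightarrow> real" where "c_q n L = 1 + 4 * (n * (2 ^ L * c_Z n * c_Z n))"
definition c_b :: "real \<Rightarrow> nat \<Rightarrow> real \<Rightarrow> real" where "c_b n L G = tower_const G (c_q n L) L"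
definition c_g :: "real \<Rightarrow> nat \<Rightarrow> real \<Rightarrow> real \<Rightarrow> real" where "c_g n L G m = 8 / m * (2 ^ L * c_b n L G * c_Z n)"
definition c_D :: "real \<Rightarrow> nat \<Rightarrow> real \<Rightarrow> real \<Rightarrow> real" where
  "c_D n L G m = n * (2 ^ L * c_g n L G m * (8 * n)) + n * (1 / m * c_b n L G)"
definition c_K :: "real \<Rightarrow> nat \<Rightarrow> real \<Rightarrow> real \<Rightarrow> real" where
  "c_K n L G m = 2 ^ L * c_D n L G m * (2 ^ L * (8 * n)) + 2 ^ L * (2 ^ L * (n * (2 ^ L * c_g n L G m)) * (8 * n)) * (8 * n)"
definition c_F :: "nat \<Rightarrow> nat \<Rightarrow> real" where "c_F n L = fact n * (2 ^ L * 2) ^ n"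
definition c_I :: "nat \<Rightarrow> nat \<Rightarrow> real" where "c_I n L = tower_const (fact L * 2 ^ Suc L) (c_F n L) L"
definition c_R :: "nat \<Rightarrow> nat \<Rightarrow> real \<Rightarrow> real \<Rightarrow> real \<Rightarrow> real" where
  "c_R n L G m v = 2 ^ L * c_I n L * (n * (n * (2 ^ L * (2 ^ L * c_F n L * (v * c_K n L G m)) * c_F n L)))"

lemma c_nonneg:
  assumes "0 \<le> n" "0 \<le> G" "0 < m"
  shows "0 \<le> c_Z n" "0 \<le> c_q n L" "0 \<le> c_b n L G" "0 \<le> c_g n L G m" "0 \<le> c_D n L G m" "0 \<le> c_K n L G m"
    "0 \<le> c_F k L" "0 \<le> c_I k L"
proof -
  show 1: "0 \<le> c_Z n" using assms by (simp add: c_Z_def)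
  show 2: "0 \<le> c_q n L" using assms 1 by (simp add: c_q_def)
  show 3: "0 \<le> c_b n L G" unfolding c_b_def by (rule tower_const_nonneg[OF assms(2) 2])
  show 4: "0 \<le> c_g n L G m" using assms 1 3 by (simp add: c_g_def)
  show 5: "0 \<le> c_D n L G m" using assms 3 4 by (simp add: c_D_def)
  show "0 \<le> c_K n L G m" using assms 4 5 by (simp add: c_K_def)
  show 7: "0 \<le> c_F k L" by (simp add: c_F_def)
  show "0 \<le> c_I k L" unfolding c_I_def by (rule tower_const_nonneg[OF _ 7]) simp
qed

text \<open>The bounds are taken on a ball because \<open>Z\<close> grows with \<open>x\<close>; the
  solution vanishes outside it. Derivatives of \<open>bump\<close> up to order \<open>L + 1\<close>
  occur since the gradient of the weight already contains the first one.\<close>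

locale estimates = deformation I u L \<epsilon> \<Lambda> \<mu> x0 + weights I "cball x0 (4 * \<mu>)" M T
  for I and u :: "real \<Rightarrow> real ^ 'n::finite \<Rightarrow> real ^ 'n" and L \<epsilon> \<Lambda> \<mu> x0 M T +
  fixes G :: real
  assumes M_ge: "1 / \<mu> \<le> M" "\<Lambda> \<le> M" and T_ge: "\<epsilon> / \<mu> \<le> T" "\<Lambda> \<le> T"
    and G: "0 \<le> G" "\<And>k x. k \<le> L + 1 \<Longrightarrow> x \<le> 1 \<Longrightarrow> \<bar>bump k x\<bar> \<le> G"
begin

text \<open>For the given fields, which are evaluated at translates of \<open>x\<close> that may
  leave the ball.\<close>

sublocale full: weights I "UNIV :: (real ^ 'n) set" M T
  by unfold_locales (rule M, rule T)

lemma power_weights: "\<epsilon> * \<Lambda> ^ (a + r) \<le> \<epsilon> * T ^ r * M ^ a"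
proof -
  have "\<Lambda> ^ r * \<Lambda> ^ a \<le> T ^ r * M ^ a"
    using \<Lambda> M_ge T_ge T by (intro mult_mono power_mono) auto
  then show ?thesis using \<epsilon> by (simp add: power_add mult.commute)
qed

lemma SB_du: "full.B 2 L (dx j (\<lambda>t x. u t x $ i)) \<epsilon>"
proof (rule full.SB_from_words[OF smooth_du])
  fix r t and ks :: "'n list" and x :: "real ^ 'n"
  assume r: "r \<le> 2" "r + length ks \<le> L" and t: "t \<in> I"
  have "word I (map Some ks @ replicate r None) (dx j (\<lambda>t x. u t x $ i)) t x
      = word I (map Some ks) (dx j (word I (replicate r None) (\<lambda>t x. u t x $ i))) t x"
    unfolding word_append
    by (rule word_cong[OF word_time_space_comm[OF smooth_field_nth[OF smooth_u]] t])
  also have "\<dots> = word I (map Some (ks @ [j]) @ replicate r None) (\<lambda>t x. u t x $ i) t x"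
    by (simp add: word_append pd_def)
  also have "\<dots> = foldr dx (ks @ [j]) ((dt I ^^ r) u) t x $ i"
    by (simp only: word_nth[OF smooth_u t] word_eq)
  finally have e: "foldr dx ks ((dt I ^^ r) (dx j (\<lambda>t x. u t x $ i))) t x = foldr dx (ks @ [j]) ((dt I ^^ r) u) t x $ i"
    by (simp add: word_eq)
  show "\<bar>foldr dx ks ((dt I ^^ r) (dx j (\<lambda>t x. u t x $ i))) t x\<bar> \<le> \<epsilon> * T ^ r * M ^ length ks"
  \<comment> \<open>With no further derivative the bound on the gradient applies; all other words
    have order at least 2 in \<open>u\<close>, and the exponent of \<open>\<Lambda>\<close> is then
    the number of further derivatives.\<close>
  proof (cases "r + length ks = 0")
    case True
    have "\<bar>(F t x - mat 1) $ i $ j\<bar> \<le> norm (F t x - mat 1)"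
      using component_le_norm_cart[of "(F t x - mat 1) $ i" j] Finite_Cartesian_Product.norm_nth_le[of "F t x - mat 1" i] by linarith
    then show ?thesis using True F_near[OF t, of x] by (simp add: F_def f_def mat_def)
  next
    case False
    have "\<bar>foldr dx (ks @ [j]) ((dt I ^^ r) u) t x $ i\<bar> \<le> norm (foldr dx (ks @ [j]) ((dt I ^^ r) u) t x)"
      by (rule component_le_norm_cart)
    also have "\<dots> \<le> \<epsilon> * \<Lambda> ^ (length (ks @ [j]) + r - 1)"
    proof (rule u_word)
      have "1 \<le> length ks + r" using False by linarith
      then show "2 \<le> length (ks @ [j]) + r" unfolding length_append list.size by linarith
      show "length (ks @ [j]) + r \<le> L + 2" using r(2) unfolding length_append list.size by linarith
    qed (rule t)
    also have "\<dots> \<le> \<epsilon> * T ^ r * M ^ length ks" using power_weights[of "length ks" r] by simp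
    finally show ?thesis unfolding e .
  qed
qed

lemma SB_dtu: "full.B 1 (L - 1) (dt I (\<lambda>t x. u t x $ i)) \<epsilon>"
proof (rule full.SB_from_words)
  show "smooth_field I (dt I (\<lambda>t x. u t x $ i))"
    using smooth_field_pd[OF smooth_field_nth[OF smooth_u], of None] by (simp add: pd_def)
  fix r t and ks :: "'n list" and x :: "real ^ 'n"
  assume r: "r \<le> 1" "r + length ks \<le> L - 1" and t: "t \<in> I"
  have e: "foldr dx ks ((dt I ^^ r) (dt I (\<lambda>t x. u t x $ i))) t x = foldr dx ks ((dt I ^^ Suc r) u) t x $ i"
    using word_nth[OF smooth_u t, of "map Some ks @ replicate (Suc r) None" i x]
    by (simp only: word_eq[symmetric] funpow_dt_Suc)
  have "\<bar>foldr dx ks ((dt I ^^ Suc r) u) t x $ i\<bar> \<le> norm (foldr dx ks ((dt I ^^ Suc r) u) t x)"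
    by (rule component_le_norm_cart)
  also have "\<dots> \<le> \<epsilon> * \<Lambda> ^ (length ks + r)"
  proof (cases "r + length ks = 0")
    case True
    have "norm_CN I 0 (dt I u) \<le> ennreal \<epsilon>" using u_bounds by (simp add: deformation_bounds_def)
    from norm_CN_word[OF this _ _ t, of "[]" x] show ?thesis using True \<epsilon> by simp
  next
    case False
    then have "2 \<le> length ks + Suc r" by linarith
    moreover have "length ks + Suc r \<le> L + 2" using r by linarith
    ultimately show ?thesis using u_word[of ks "Suc r" t x] t by (simp del: funpow.simps)
  qed
  also have "\<dots> \<le> \<epsilon> * T ^ r * M ^ length ks" by (rule power_weights)
  finally show "\<bar>foldr dx ks ((dt I ^^ r) (dt I (\<lambda>t x. u t x $ i))) t x\<bar> \<le> \<epsilon> * T ^ r * M ^ length ks"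
    unfolding e .
qed

lemma SB_f: "full.B 2 L (f i j) 2"
proof -
  have "full.B 2 L (f i j) (1 + \<epsilon>)"
    unfolding f_def[abs_def] by (intro full.SB_add full.SB_const SB_du) auto
  then show ?thesis by (rule full.SB_mono_bound) (use \<epsilon> in simp)
qed

lemma SB_shift: "full.B 2 L h b \<Longrightarrow> B 2 L (\<lambda>t x. h t (x + c)) b"
  using SB_affine[of 1 2 L h b c] by simp

lemma SB_F: "B 2 L (\<lambda>t x. F t x $ i $ j) 2"
  using SB_shift[OF SB_f[of i j], of 0] by (simp add: F_def)

text \<open>Each of the \<open>CARD('n)\<close> summands is at most 4 times 2, from the cube and
  from \<open>SB_f\<close>.\<close>

lemma SB_H:
  assumes "\<kappa> \<in> cube 4"
  shows "B 2 L (\<lambda>t x. H t x s \<kappa> $ i) (8 * real CARD('n))"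
proof -
  have \<kappa>: "\<bar>\<kappa> $ j\<bar> \<le> 4" for j
  proof -
    have b: "axis j 1 \<in> (Basis :: (real ^ 'n) set)" by (auto simp: Basis_vec_def)
    have "\<forall>b\<in>Basis. (- (4 *\<^sub>R One)) \<bullet> b \<le> \<kappa> \<bullet> b \<and> \<kappa> \<bullet> b \<le> (4 *\<^sub>R One) \<bullet> b"
      using assms by (simp only: cube_def mem_box)
    from bspec[OF this b] have "- 4 \<le> \<kappa> \<bullet> axis j 1 \<and> \<kappa> \<bullet> axis j 1 \<le> 4"
      using b by (simp add: inner_sum_left_Basis[where f = "\<lambda>_. 1", simplified])
    then show ?thesis by (simp add: inner_axis abs_le_iff)
  qed
  have "B 2 L (\<lambda>t x. \<Sum>j\<in>UNIV. f i j t (x + (\<theta> * (1 - s) * \<mu>) *\<^sub>R \<kappa>) * \<kappa> $ j) (8 * real CARD('n))" for \<theta>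
  proof -
    have "B 2 L (\<lambda>t x. \<kappa> $ j * f i j t (x + (\<theta> * (1 - s) * \<mu>) *\<^sub>R \<kappa>)) 8" for j
      by (rule SB_mono_bound[OF SB_cmult[OF SB_shift[OF SB_f]]]) (use \<kappa>[of j] in simp)
    from SB_sum[where A = UNIV, OF finite this] show ?thesis by (simp add: mult.commute)
  qed
  from SB_integral[OF psmooth_H this] show ?thesis by (simp add: H_def)
qed

text \<open>The first derivative is computed explicitly: in space it is \<open>f / \<mu>\<close>, in
  time a difference of two values of \<open>dt u\<close> over \<open>\<mu>\<close>, which requires
  \<open>T\<close> to be at least \<open>\<epsilon> / \<mu>\<close>. The value itself is at most 5/4
  times 4.\<close>

lemma SB_w: "B 2 L (\<lambda>t x. (1 / \<mu>) * (y t x $ i - y t x0 $ i)) 5"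
proof -
  let ?w = "\<lambda>t x. (1 / \<mu>) * (y t x $ i - y t x0 $ i)"
  have bd: "\<bar>?w t x\<bar> \<le> 5" if t: "t \<in> I" and x: "x \<in> cball x0 (4 * \<mu>)" for t x
  proof -
    have nx: "norm (x - x0) \<le> 4 * \<mu>" using x by (simp add: dist_norm norm_minus_commute)
    have "y t x - y t x0 = (x - x0) + (u t x - u t x0)" by (simp add: y_def)
    then have "norm (y t x - y t x0) \<le> norm (x - x0) + norm (u t x - u t x0)" by (simp add: norm_triangle_ineq)
    also have "\<dots> \<le> norm (x - x0) + 1 / 4 * norm (x - x0)"
      using u_lipschitz[OF t, of x x0] mult_right_mono[OF \<epsilon>(2), of "norm (x - x0)"] by simp
    finally have "norm (y t x - y t x0) \<le> 5 * \<mu>" using nx by simp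
    then have "\<bar>y t x $ i - y t x0 $ i\<bar> \<le> 5 * \<mu>"
      using component_le_norm_cart[of "y t x - y t x0" i] by simp
    then show ?thesis using \<mu> by (simp add: abs_mult field_simps)
  qed
  have sy: "smooth_field I (\<lambda>t x. y t x $ i)"
    unfolding y_def smooth_field_iff
    using smooth_u by (auto simp: smooth_field_iff intro!: Ck_on_nth Ck_on_add Ck_on_snd Ck_on_ident simp del: vector_add_component)
  have sm: "smooth_field I ?w"
    using smooth_field_add[OF smooth_field_mult[OF smooth_field_const[of "1 / \<mu>"] sy]
        smooth_field_mult[OF smooth_field_const[of "- (1 / \<mu>)"] smooth_field_affine[OF sy, of 0 x0]]]
    by (simp add: algebra_simps diff_divide_distrib)
  show ?thesis
  proof (cases L)
    case 0
    then show ?thesis using bd sm by simp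
  next
    case (Suc L')
    have dw: "pd I k ?w t x = (case k of None \<Rightarrow> (1 / \<mu>) * (dt I (\<lambda>t x. u t x $ i) t x - dt I (\<lambda>t x. u t x $ i) t x0)
        | Some j \<Rightarrow> (1 / \<mu>) * f i j t x)" if t: "t \<in> I" for k t x
    proof (cases k)
      case None
      have "((\<lambda>s. (1 / \<mu>) * ((x $ i + u s x $ i) - (x0 $ i + u s x0 $ i))) has_vector_derivative
          (1 / \<mu>) * ((0 + dt I (\<lambda>t x. u t x $ i) t x) - (0 + dt I (\<lambda>t x. u t x $ i) t x0))) (at t within I)"
        by (intro has_vector_derivative_mult_right has_vector_derivative_diff has_vector_derivative_add has_vector_derivative_const
            dt_along_time[OF smooth_field_nth[OF smooth_u] t])
      then have "dt I ?w t x = (1 / \<mu>) * ((0 + dt I (\<lambda>t x. u t x $ i) t x) - (0 + dt I (\<lambda>t x. u t x $ i) t x0))"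
        using t by (intro dt_eqI) (simp_all add: y_def)
      then show ?thesis by (simp add: None pd_def)
    next
      case (Some j)
      have "(?w t has_derivative (\<lambda>v. (1 / \<mu>) * ((F t x *v v) $ i - 0))) (at x)"
        by (intro has_derivative_mult_right has_derivative_diff has_derivative_const
            bounded_linear.has_derivative[OF bounded_linear_vec_nth der_y[OF t]])
      then have "dx j ?w t x = (1 / \<mu>) * ((F t x *v axis j 1) $ i - 0)"
        by (rule dx_eqI)
      then show ?thesis by (simp add: Some pd_def matrix_vector_mult_basis column_def F_def)
    qed
    show ?thesis unfolding Suc
    proof (rule SB_SucI[OF sm bd])
      fix k :: "'n option" assume "k = None \<longrightarrow> 0 < (2::nat)"
      show "B (after 2 k) L' (pd I k ?w) (5 * cost M T k)"
      proof (cases k)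
        case None
        have du: "full.B 1 L' (dt I (\<lambda>t x. u t x $ i)) \<epsilon>" using SB_dtu[of i] by (simp add: Suc)
        have "B 1 L' (\<lambda>t x. (1 / \<mu>) * (dt I (\<lambda>t x. u t x $ i) t (1 *\<^sub>R x + 0) - dt I (\<lambda>t x. u t x $ i) t (0 *\<^sub>R x + x0))) (\<bar>1 / \<mu>\<bar> * (\<epsilon> + \<epsilon>))"
          by (intro SB_cmult SB_diff SB_affine[OF _ du]) auto
        moreover have "\<bar>1 / \<mu>\<bar> * (\<epsilon> + \<epsilon>) \<le> 5 * T" using T_ge(1) T \<mu> by simp
        ultimately have "B 1 L' (\<lambda>t x. (1 / \<mu>) * (dt I (\<lambda>t x. u t x $ i) t (1 *\<^sub>R x + 0) - dt I (\<lambda>t x. u t x $ i) t (0 *\<^sub>R x + x0))) (5 * T)"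
          by (rule SB_mono_bound)
        then have "B 1 L' (pd I k ?w) (5 * T)" by (rule SB_cong) (subst dw, assumption, simp add: None)
        then show ?thesis by (simp add: None after_def cost_def)
      next
        case (Some j)
        have "B 0 L' (\<lambda>t x. f i j t (x + 0)) 2"
          by (rule SB_mono[OF SB_shift[OF SB_f]]) (auto simp: Suc)
        then have "B 0 L' (\<lambda>t x. (1 / \<mu>) * f i j t (x + 0)) (\<bar>1 / \<mu>\<bar> * 2)" by (rule SB_cmult)
        moreover have "\<bar>1 / \<mu>\<bar> * 2 \<le> 5 * M" using M_ge(1) M \<mu> by simp
        ultimately have "B 0 L' (\<lambda>t x. (1 / \<mu>) * f i j t (x + 0)) (5 * M)" by (rule SB_mono_bound)
        then have "B 0 L' (pd I k ?w) (5 * M)" by (rule SB_cong) (subst dw, assumption, simp add: Some)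
        then show ?thesis by (simp add: Some after_def cost_def)
      qed
    qed
  qed
qed

lemma SB_inner:
  assumes "\<And>i. B r k (\<lambda>t x. v t x $ i) a" "\<And>i. B r k (\<lambda>t x. w t x $ i) b" "0 \<le> a" "0 \<le> b"
  shows "B r k (\<lambda>t x. (v t x :: real ^ 'n) \<bullet> w t x) (real CARD('n) * (2 ^ k * a * b))"
proof -
  have "B r k (\<lambda>t x. \<Sum>i\<in>UNIV. v t x $ i * w t x $ i) (\<Sum>i\<in>(UNIV :: 'n set). 2 ^ k * a * b)"
    by (intro SB_sum SB_mult assms) simp
  then show ?thesis by (simp add: inner_vec_def)
qed

context
  fixes s :: real and \<kappa> :: "real ^ 'n"
  assumes s: "s \<in> cbox 0 1" and \<kappa>: "\<kappa> \<in> cube 4"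
begin

lemma SB_Z: "B 2 L (\<lambda>t x. Z t x s \<kappa> $ i) (c_Z (real CARD('n)))"
proof -
  have base: "B 2 L (\<lambda>t x. (1 / \<mu>) * (y t x $ i - y t x0 $ i) - s * H t x s \<kappa> $ i) (5 + \<bar>s\<bar> * (8 * real CARD('n)))"
    by (intro SB_diff SB_w SB_cmult SB_H \<kappa>)
  have "5 + \<bar>s\<bar> * (8 * real CARD('n)) \<le> c_Z (real CARD('n))"
    using s mult_right_mono[of "\<bar>s\<bar>" 1 "8 * real CARD('n)"] by (simp add: c_Z_def)
  from SB_mono_bound[OF base this] show ?thesis by (simp add: Z_def)
qed

lemma SB_bump:
  assumes "m \<le> 1"
  shows "B 2 L (\<lambda>t x. bump m (1 - 4 * (Z t x s \<kappa> \<bullet> Z t x s \<kappa>))) (c_b (real CARD('n)) L G)"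
  unfolding c_b_def
proof (rule SB_tower[where A = UNIV and g = bump and f = "\<lambda>t x. 1 - 4 * (Z t x s \<kappa> \<bullet> Z t x s \<kappa>)"])
  have "B 2 L (\<lambda>t x. 1 - 4 * (Z t x s \<kappa> \<bullet> Z t x s \<kappa>)) (1 + \<bar>4\<bar> * (real CARD('n) * (2 ^ L * c_Z (real CARD('n)) * c_Z (real CARD('n)))))"
    by (intro SB_diff SB_const SB_cmult SB_inner SB_Z) (auto simp: c_Z_def)
  then show "B 2 L (\<lambda>t x. 1 - 4 * (Z t x s \<kappa> \<bullet> Z t x s \<kappa>)) (c_q (real CARD('n)) L)" by (simp add: c_q_def)
  show "\<bar>bump k (1 - 4 * (Z t x s \<kappa> \<bullet> Z t x s \<kappa>))\<bar> \<le> G" if "k \<le> m + L" for k t x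
    by (rule G(2)) (use that assms in auto)
qed (auto intro: bump_derivative G(1) simp: c_q_def c_Z_def)

lemma SB_grad: "B 2 L (\<lambda>t x. bump_grad (Z t x s \<kappa>) $ i) (c_g (real CARD('n)) L G (bump_mass TYPE('n)))"
proof -
  have "B 2 L (\<lambda>t x. (- 8 / bump_mass TYPE('n)) * (bump 1 (1 - 4 * (Z t x s \<kappa> \<bullet> Z t x s \<kappa>)) * Z t x s \<kappa> $ i))
      (\<bar>- 8 / bump_mass TYPE('n)\<bar> * (2 ^ L * c_b (real CARD('n)) L G * c_Z (real CARD('n))))"
    by (intro SB_cmult SB_mult SB_bump SB_Z c_nonneg[OF of_nat_0_le_iff G(1) bump_mass_pos[where 'n = 'n]]) simp
  then show ?thesis using bump_mass_pos[where 'n = 'n] by (simp add: bump_grad_def c_g_def mult.assoc)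
qed

lemma SB_weight: "B 2 L (\<lambda>t x. bump_weight (Z t x s \<kappa>)) (1 / bump_mass TYPE('n) * c_b (real CARD('n)) L G)"
proof -
  have "B 2 L (\<lambda>t x. (1 / bump_mass TYPE('n)) * bump 0 (1 - 4 * (Z t x s \<kappa> \<bullet> Z t x s \<kappa>))) (\<bar>1 / bump_mass TYPE('n)\<bar> * c_b (real CARD('n)) L G)"
    by (intro SB_cmult SB_bump) simp
  then show ?thesis using bump_mass_pos[where 'n = 'n] by (simp add: bump_weight_def)
qed

lemma SB_K:
  assumes U: "\<And>i. full.B 2 L (\<lambda>t x. U t x $ i) A" and A: "0 \<le> A"
  shows "B 2 L (\<lambda>t x. K U j k t x s \<kappa>) (c_K (real CARD('n)) L G (bump_mass TYPE('n)) * A)"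
proof -
  let ?n = "real CARD('n)" and ?m = "bump_mass TYPE('n)"
  let ?g = "c_g ?n L G ?m" and ?D = "c_D ?n L G ?m"
  let ?\<gamma> = "\<lambda>t x. bump_grad (Z t x s \<kappa>)" and ?\<rho> = "\<lambda>t x. bump_weight (Z t x s \<kappa>)" and ?H = "\<lambda>t x. H t x s \<kappa>"
    and ?U = "\<lambda>t x. U t (x + ((1 - s) * \<mu>) *\<^sub>R \<kappa>)"
  note pos = c_nonneg[OF of_nat_0_le_iff G(1) bump_mass_pos[where 'n = 'n]]
  note g = SB_grad and h = SB_H[OF \<kappa>, of s] and v = SB_shift[OF U, of "((1 - s) * \<mu>) *\<^sub>R \<kappa>"]
  have D: "B 2 L (\<lambda>t x. ?\<gamma> t x \<bullet> ?H t x - ?n * ?\<rho> t x) ?D"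
  proof -
    have "B 2 L (\<lambda>t x. ?\<gamma> t x \<bullet> ?H t x - ?n * ?\<rho> t x) (?n * (2 ^ L * ?g * (8 * ?n)) + \<bar>?n\<bar> * (1 / ?m * c_b ?n L G))"
      by (intro SB_diff SB_inner g h SB_cmult SB_weight pos) simp
    then show ?thesis by (simp add: c_D_def)
  qed
  have sym: "B 2 L (\<lambda>t x. ?U t x $ j * ?H t x $ k + ?U t x $ k * ?H t x $ j) (2 ^ L * A * (8 * ?n) + 2 ^ L * A * (8 * ?n))"
    by (intro SB_add SB_mult v h A) simp_all
  have 1: "B 2 L (\<lambda>t x. (1 / 2) * ((?\<gamma> t x \<bullet> ?H t x - ?n * ?\<rho> t x) * (?U t x $ j * ?H t x $ k + ?U t x $ k * ?H t x $ j)))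
      (\<bar>1 / 2\<bar> * (2 ^ L * ?D * (2 ^ L * A * (8 * ?n) + 2 ^ L * A * (8 * ?n))))"
    by (intro SB_cmult SB_mult D sym pos) (use A in simp)
  have 2: "B 2 L (\<lambda>t x. (?\<gamma> t x \<bullet> ?U t x) * ?H t x $ j * ?H t x $ k)
      (2 ^ L * (2 ^ L * (?n * (2 ^ L * ?g * A)) * (8 * ?n)) * (8 * ?n))"
    by (intro SB_mult SB_inner g v h pos A mult_nonneg_nonneg) simp_all
  have "\<bar>1 / 2\<bar> * (2 ^ L * ?D * (2 ^ L * A * (8 * ?n) + 2 ^ L * A * (8 * ?n)))
      + 2 ^ L * (2 ^ L * (?n * (2 ^ L * ?g * A)) * (8 * ?n)) * (8 * ?n) = c_K ?n L G ?m * A"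
    by (simp add: c_K_def algebra_simps)
  from SB_diff[OF 1 2, unfolded this] show ?thesis by (simp add: K_def kern_def)
qed

end

lemma SB_Sd:
  assumes U: "\<And>i. full.B 2 L (\<lambda>t x. U t x $ i) A" and A: "0 \<le> A" and sm: "smooth_field I U"
  shows "B 2 L (Sd U j k) (measure lborel (cube 4 :: (real ^ 'n) set) * c_K (real CARD('n)) L G (bump_mass TYPE('n)) * A)"
proof -
  let ?C = "c_K (real CARD('n)) L G (bump_mass TYPE('n)) * A"
  have pos: "0 \<le> ?C" using c_nonneg(6)[OF of_nat_0_le_iff G(1) bump_mass_pos[where 'n = 'n]] A by simp
  have "B 2 L (\<lambda>t x. integral (cube 4) (\<lambda>\<kappa>. K U j k t x s \<kappa>)) (measure lborel (cube 4 :: (real ^ 'n) set) * ?C)"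
    if "s \<in> cbox 0 1" for s
    unfolding cube_def
    by (rule SB_integral[OF psmooth_K[OF sm] _ pos]) (use SB_K[OF that _ U A] in \<open>auto simp: cube_def\<close>)
  from SB_integral[OF psmooth_int_K[OF sm] this] pos
  show ?thesis by (simp add: Sd_def[abs_def] mult.assoc)
qed

lemma SB_det:
  fixes A :: "real \<Rightarrow> real ^ 'n \<Rightarrow> real ^ 'n ^ 'n"
  assumes "\<And>i j. B 2 L (\<lambda>t x. A t x $ i $ j) 2"
  shows "B 2 L (\<lambda>t x. det (A t x)) (c_F CARD('n) L)"
proof -
  let ?b = "(2 ^ L * 2) ^ CARD('n) :: real"
  have "B 2 L (\<lambda>t x. of_int (sign p) * (\<Prod>i\<in>UNIV. A t x $ i $ p i)) ?b" for p :: "'n \<Rightarrow> 'n"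
    by (rule SB_mono_bound[OF SB_cmult[OF SB_prod[OF finite assms]]]) (auto simp: sign_def)
  from SB_sum[OF finite_permutations[of "UNIV :: 'n set", OF finite] this]
  show ?thesis by (simp add: det_def c_F_def card_permutations[OF refl finite])
qed

text \<open>The inserted unit row also has entries bounded by 2, so the constant for determinants
  serves again.\<close>

lemma SB_cof: "B 2 L (\<lambda>t x. cof (F t x) i j) (c_F CARD('n) L)"
  unfolding cof_def
proof (rule SB_det)
  fix a b
  show "B 2 L (\<lambda>t x. set_row i (axis j 1) (F t x) $ a $ b) 2"
    using SB_F[of a b] by (cases "a = i") (auto simp: set_row_def axis_nth_if intro: SB_const)
qed

text \<open>On the half-line from 1/2 the \<open>k\<close>-th derivative of the reciprocal is at
  most \<open>fact k * 2 ^ Suc k\<close>.\<close>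

lemma SB_inverse_det: "B 2 L (\<lambda>t x. 1 / det (F t x)) (c_I CARD('n) L)"
proof -
  have "B 2 L (\<lambda>t x. inverse_tower 0 (det (F t x))) (c_I CARD('n) L)"
    unfolding c_I_def
  proof (rule SB_tower[where A = "{1 / 2..}" and g = inverse_tower and f = "\<lambda>t x. det (F t x)"])
    show "(inverse_tower m has_real_derivative inverse_tower (Suc m) x) (at x within {1 / 2..})" if "x \<in> {1 / 2..}" for m x
      by (rule inverse_tower_derivative) (use that in auto)
    show "det (F t x) \<in> {1 / 2..}" if "t \<in> I" for t x using det_F[OF that] by simp
    show "B 2 L (\<lambda>t x. det (F t x)) (c_F CARD('n) L)" by (rule SB_det[OF SB_F])
    show "\<bar>inverse_tower k (det (F t x))\<bar> \<le> fact L * 2 ^ Suc L" if k: "k \<le> 0 + L" and t: "t \<in> I" for k t x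
    proof -
      have d: "1 / 2 \<le> det (F t x)" by (rule det_F[OF t])
      have "1 / det (F t x) ^ Suc k = (1 / det (F t x)) ^ Suc k" by (simp add: power_divide)
      also have "\<dots> \<le> 2 ^ Suc k" using d by (intro power_mono) (auto simp: field_simps)
      also have "\<dots> \<le> 2 ^ Suc L" using k by (intro power_increasing) auto
      finally have 1: "1 / det (F t x) ^ Suc k \<le> 2 ^ Suc L" .
      have 2: "fact k \<le> (fact L :: real)" using k by (intro fact_mono) simp
      have "\<bar>inverse_tower k (det (F t x))\<bar> = fact k * (1 / det (F t x) ^ Suc k)"
        using d by (simp add: inverse_tower_def abs_mult power_abs)
      also have "\<dots> \<le> fact L * 2 ^ Suc L" using 1 2 d by (intro mult_mono) auto
      finally show ?thesis .
    qed
  qed (auto simp: c_F_def)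
  then show ?thesis by (simp add: inverse_tower_0)
qed

lemma SB_Rd:
  assumes U: "\<And>i. full.B 2 L (\<lambda>t x. U t x $ i) A" and A: "0 \<le> A" and sm: "smooth_field I U"
  shows "B 2 L (\<lambda>t x. Rd U t x $ a $ b)
    (c_R CARD('n) L G (bump_mass TYPE('n)) (measure lborel (cube 4 :: (real ^ 'n) set)) * A * \<mu>)"
proof -
  let ?n = "real CARD('n)" and ?m = "bump_mass TYPE('n)" and ?v = "measure lborel (cube 4 :: (real ^ 'n) set)"
  let ?F = "c_F CARD('n) L" and ?K = "c_K ?n L G ?m" and ?I = "c_I CARD('n) L"
  note pos = c_nonneg[OF of_nat_0_le_iff G(1) bump_mass_pos[where 'n = 'n]]
  have "B 2 L (\<lambda>t x. \<Sum>i\<in>UNIV. \<Sum>k\<in>UNIV. cof (F t x) i a * Sd U i k t x * cof (F t x) k b)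
      (\<Sum>i\<in>(UNIV :: 'n set). \<Sum>k\<in>(UNIV :: 'n set). 2 ^ L * (2 ^ L * ?F * (?v * ?K * A)) * ?F)"
    by (intro SB_sum finite SB_mult SB_cof SB_Sd[OF U A sm] pos mult_nonneg_nonneg A) simp_all
  then have bound: "B 2 L (\<lambda>t x. \<mu> * (1 / det (F t x) * (\<Sum>i\<in>UNIV. \<Sum>k\<in>UNIV. cof (F t x) i a * Sd U i k t x * cof (F t x) k b)))
      (\<bar>\<mu>\<bar> * (2 ^ L * ?I * (\<Sum>i\<in>(UNIV :: 'n set). \<Sum>k\<in>(UNIV :: 'n set). 2 ^ L * (2 ^ L * ?F * (?v * ?K * A)) * ?F)))"
    by (intro SB_cmult SB_mult SB_inverse_det pos sum_nonneg mult_nonneg_nonneg A) simp_all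
  have e: "\<bar>\<mu>\<bar> * (2 ^ L * ?I * (\<Sum>i\<in>(UNIV :: 'n set). \<Sum>k\<in>(UNIV :: 'n set). 2 ^ L * (2 ^ L * ?F * (?v * ?K * A)) * ?F))
      = c_R CARD('n) L G ?m ?v * A * \<mu>"
    using \<mu> by (simp add: c_R_def mult_ac)
  show ?thesis using bound unfolding e Rd_def vec_lambda_beta by (simp only: mult.assoc)
qed

end

lemma c_R_nonneg:
  assumes "0 \<le> G" "0 < m" "0 \<le> v"
  shows "0 \<le> c_R n L G m v"
proof -
  have "0 \<le> c_K (real n) L G m" by (rule c_nonneg(6)[OF of_nat_0_le_iff assms(1,2)])
  moreover have "0 \<le> c_F n L" "0 \<le> c_I n L"
    by (rule c_nonneg(7)[OF zero_le_one order_refl zero_less_one], rule c_nonneg(8)[OF zero_le_one order_refl zero_less_one])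
  ultimately show ?thesis using assms(3) by (simp add: c_R_def)
qed

context deformation
begin

text \<open>Inside the ball of radius \<open>4 * \<mu>\<close> this is \<open>SB_Rd\<close>; on its
  open complement \<open>Rd U\<close> vanishes, together with all derivatives.\<close>

lemma Rd_estimate:
  fixes A \<Lambda>U :: real
  assumes U: "adm U" and A: "0 < A" and \<Lambda>U: "0 < \<Lambda>U"
    and Ub: "\<And>r N. r \<le> 2 \<Longrightarrow> N + r \<le> L \<Longrightarrow> norm_CN I N ((dt I ^^ r) U) \<le> ennreal (A * \<Lambda>U ^ (N + r))"
    and G: "0 \<le> G" "\<And>k x. k \<le> L + 1 \<Longrightarrow> x \<le> 1 \<Longrightarrow> \<bar>bump k x\<bar> \<le> G"
    and r: "r \<le> 2" "N + r \<le> L"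
    and M: "M = Max {1 / \<mu>, \<Lambda>U, \<Lambda>}" and T: "T = Max {\<epsilon> / \<mu>, \<Lambda>U, \<Lambda>}"
  shows "norm_CN I N ((dt I ^^ r) (\<lambda>t x. Rd U t x $ l $ j))
    \<le> ennreal (real (Suc L) * (c_R CARD('n) L G (bump_mass TYPE('n)) (measure lborel (cube 4 :: (real ^ 'n) set)) * A * \<mu> * T ^ r * M ^ N))"
proof -
  let ?c = "c_R CARD('n) L G (bump_mass TYPE('n)) (measure lborel (cube 4 :: (real ^ 'n) set))"
  have MU: "1 / \<mu> \<le> M" "\<Lambda>U \<le> M" "\<Lambda> \<le> M" and TU: "\<epsilon> / \<mu> \<le> T" "\<Lambda>U \<le> T" "\<Lambda> \<le> T"
    unfolding M T by auto
  \<comment> \<open>\<open>\<Lambda> \<ge> 1\<close> enters here: it lets \<open>M ^ N\<close>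
    dominate the bounds for lower orders in the norm.\<close>
  have MT: "1 \<le> M" "1 \<le> T" using \<Lambda> MU(3) TU(3) by linarith+
  interpret estimates I u L \<epsilon> \<Lambda> \<mu> x0 M T G
    by unfold_locales (use MT MU TU G in auto)
  have smU: "smooth_field I U" using U by (simp add: admissible_def)
  have SBU: "full.B 2 L (\<lambda>t x. U t x $ i) A" for i
  proof (rule full.SB_from_words[OF smooth_field_nth[OF smU]])
    fix r t and ks :: "'n list" and x :: "real ^ 'n"
    assume r: "r \<le> 2" "r + length ks \<le> L" and t: "t \<in> I"
    have "\<bar>foldr dx ks ((dt I ^^ r) (\<lambda>t x. U t x $ i)) t x\<bar> = \<bar>foldr dx ks ((dt I ^^ r) U) t x $ i\<bar>"
      by (simp only: word_eq word_nth[OF smU t])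
    also have "\<dots> \<le> norm (foldr dx ks ((dt I ^^ r) U) t x)" by (rule component_le_norm_cart)
    also have "\<dots> \<le> A * \<Lambda>U ^ (length ks + r)"
      by (rule norm_CN_word[OF Ub _ order_refl t]) (use r A \<Lambda>U in auto)
    also have "\<dots> \<le> A * (T ^ r * M ^ length ks)"
      using A \<Lambda>U MU TU MT unfolding power_add mult.commute[of "\<Lambda>U ^ length ks"]
      by (intro mult_left_mono mult_mono power_mono) auto
    finally show "\<bar>foldr dx ks ((dt I ^^ r) (\<lambda>t x. U t x $ i)) t x\<bar> \<le> A * T ^ r * M ^ length ks"
      by (simp add: mult.assoc)
  qed
  have c: "0 \<le> ?c" by (rule c_R_nonneg[OF G(1) bump_mass_pos measure_nonneg])
  let ?b = "?c * A * \<mu> * T ^ r * M ^ N"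
  have b: "0 \<le> ?b" using c A \<mu> MT by simp
  have "norm_CN I N ((dt I ^^ r) (\<lambda>t x. Rd U t x $ l $ j)) \<le> ennreal (real (Suc N) * ?b)"
  proof (rule norm_CN_le[OF _ b])
    fix ks :: "'n list" and t x
    assume ks: "length ks \<le> N" and t: "t \<in> I"
    show "norm (foldr dx ks ((dt I ^^ r) (\<lambda>t x. Rd U t x $ l $ j)) t x) \<le> ?b"
    proof (cases "x \<in> cball x0 (4 * \<mu>)")
      case True
      have "\<bar>foldr dx ks ((dt I ^^ r) (\<lambda>t x. Rd U t x $ l $ j)) t x\<bar> \<le> ?c * A * \<mu> * T ^ r * M ^ length ks"
        by (rule SB_words[OF SB_Rd[OF SBU _ smU]]) (use A r ks t True in auto)
      also have "\<dots> \<le> ?b"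
        using c A \<mu> MT ks by (intro mult_left_mono power_increasing) auto
      finally show ?thesis by simp
    next
      case False
      have "Rd U s z $ l $ j = 0" if s: "s \<in> I" and z: "z \<in> - cball x0 (4 * \<mu>)" for s z
      proof -
        obtain \<rho> where \<rho>: "\<rho> < (1 + 4 * \<epsilon>) * \<mu>" "\<forall>x. \<rho> < dist x0 x \<longrightarrow> Rd U s x = 0"
          using Rd_support[OF U s] by blast
        have "(1 + 4 * \<epsilon>) * \<mu> \<le> 4 * \<mu>" using \<epsilon> \<mu> by (intro mult_right_mono) auto
        then have "\<rho> < dist x0 z" using \<rho>(1) z by simp
        then show ?thesis using \<rho>(2) by simp
      qed
      then have "word I (map Some ks @ replicate r None) (\<lambda>t x. Rd U t x $ l $ j) t x = 0"
        by (intro word_vanishes[of "- cball x0 (4 * \<mu>)"]) (use False t in auto)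
      then show ?thesis using b by (simp add: word_eq)
    qed
  qed
  also have "\<dots> \<le> ennreal (real (Suc L) * ?b)"
    using r b by (intro ennreal_leI mult_right_mono) auto
  finally show ?thesis .
qed

lemma Rd_supp_x:
  assumes U: "adm U" and t: "t \<in> I"
  shows "supp_x (\<lambda>x. Rd U t x $ l $ j) \<subseteq> ball x0 ((1 + 4 * \<epsilon>) * \<mu>)"
proof -
  obtain r where r: "r < (1 + 4 * \<epsilon>) * \<mu>" "\<forall>x. r < dist x0 x \<longrightarrow> Rd U t x = 0"
    using Rd_support[OF U t] by blast
  have "{x. Rd U t x $ l $ j \<noteq> 0} \<subseteq> cball x0 r"
    using r(2) by (auto simp: not_le[symmetric])
  then have "supp_x (\<lambda>x. Rd U t x $ l $ j) \<subseteq> cball x0 r"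
    unfolding supp_x_def by (rule closure_minimal) simp
  then show ?thesis using r(1) by auto
qed

lemma Rd_supp_t: "supp_t I (\<lambda>t x. Rd U t x $ l $ j) \<subseteq> supp_t I U"
  unfolding supp_t_def
proof (rule closure_mono, safe)
  fix t x assume "Rd U t x $ l $ j \<noteq> 0"
  moreover have "Rd U t x = 0" if "\<nexists>x. U t x \<noteq> 0"
    by (rule Rd_zero) (use that in blast)
  ultimately show "\<exists>x. U t x \<noteq> 0" by fastforce
qed

lemma linear_on_admissible_Rd: "linear_on_admissible I y x0 \<mu> Rd"
  unfolding linear_on_admissible_def admissible_def using Rd_linear by blast

lemma ex_solution:
  assumes G: "0 \<le> G" "\<forall>k\<le>L + 1. \<forall>x\<le>1. \<bar>bump k x\<bar> \<le> G"
    and C: "real (Suc L) * c_R CARD('n) L G (bump_mass TYPE('n)) (measure lborel (cube 4 :: (real ^ 'n) set)) \<le> C"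
  shows "\<exists>R. linear_on_admissible I y x0 \<mu> R \<and> (\<forall>A \<Lambda>U U. A > 0 \<and> \<Lambda>U > 0 \<and> adm U \<and>
      (\<forall>r N. r \<le> 2 \<and> N + r \<le> L \<longrightarrow>
         norm_CN I N ((dt I ^^ r) U) \<le> ennreal (A * \<Lambda>U ^ (N + r))) \<longrightarrow>
      smooth_field I (R U) \<and>
      (\<forall>t\<in>I. \<forall>x. transpose (R U t x) = R U t x) \<and>
      (\<forall>t\<in>I. \<forall>x. divergence (\<lambda>t x. grad y t x ** R U t x) t x = U t x) \<and>
      (\<forall>l j. \<forall>t\<in>I. supp_x (\<lambda>x. R U t x $ l $ j) \<subseteq> ball x0 ((1 + 4 * \<epsilon>) * \<mu>)) \<and>
      (\<forall>l j. supp_t I (\<lambda>t x. R U t x $ l $ j) \<subseteq> supp_t I U) \<and>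
      (\<forall>l j r N. r \<le> 2 \<and> N + r \<le> L \<longrightarrow>
         norm_CN I N ((dt I ^^ r) (\<lambda>t x. R U t x $ l $ j))
           \<le> ennreal (C * A * \<mu> * Max {\<epsilon> / \<mu>, \<Lambda>U, \<Lambda>} ^ r * Max {1 / \<mu>, \<Lambda>U, \<Lambda>} ^ N)))"
proof (rule exI[of _ Rd], rule conjI[OF linear_on_admissible_Rd], intro allI impI)
  let ?c = "c_R CARD('n) L G (bump_mass TYPE('n)) (measure lborel (cube 4 :: (real ^ 'n) set))"
  fix A \<Lambda>U :: real and U :: "real \<Rightarrow> real ^ 'n \<Rightarrow> real ^ 'n"
  assume "0 < A \<and> 0 < \<Lambda>U \<and> adm U \<and>
    (\<forall>r N. r \<le> 2 \<and> N + r \<le> L \<longrightarrow> norm_CN I N ((dt I ^^ r) U) \<le> ennreal (A * \<Lambda>U ^ (N + r)))"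
  then have A: "0 < A" and \<Lambda>U: "0 < \<Lambda>U" and U: "adm U"
    and Ub: "\<And>r N. r \<le> 2 \<Longrightarrow> N + r \<le> L \<Longrightarrow> norm_CN I N ((dt I ^^ r) U) \<le> ennreal (A * \<Lambda>U ^ (N + r))"
    by blast+
  let ?T = "Max {\<epsilon> / \<mu>, \<Lambda>U, \<Lambda>}" and ?M = "Max {1 / \<mu>, \<Lambda>U, \<Lambda>}"
  have "norm_CN I N ((dt I ^^ r) (\<lambda>t x. Rd U t x $ l $ j)) \<le> ennreal (C * A * \<mu> * ?T ^ r * ?M ^ N)"
    if r: "r \<le> 2" "N + r \<le> L" for l j r N
  proof -
    have pos: "0 \<le> ?T" "0 \<le> ?M" using \<Lambda> by (auto simp: le_max_iff_disj)
    have "norm_CN I N ((dt I ^^ r) (\<lambda>t x. Rd U t x $ l $ j)) \<le> ennreal (real (Suc L) * (?c * A * \<mu> * ?T ^ r * ?M ^ N))"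
      by (rule Rd_estimate[OF U A \<Lambda>U Ub G(1) _ r refl refl]) (use G(2) in auto)
    also have "real (Suc L) * (?c * A * \<mu> * ?T ^ r * ?M ^ N) = (real (Suc L) * ?c) * (A * \<mu> * ?T ^ r * ?M ^ N)"
      by (simp only: mult.assoc)
    also have "ennreal ((real (Suc L) * ?c) * (A * \<mu> * ?T ^ r * ?M ^ N)) \<le> ennreal (C * (A * \<mu> * ?T ^ r * ?M ^ N))"
      by (intro ennreal_leI mult_right_mono C mult_nonneg_nonneg zero_le_power pos less_imp_le[OF A] less_imp_le[OF \<mu>])
    also have "C * (A * \<mu> * ?T ^ r * ?M ^ N) = C * A * \<mu> * ?T ^ r * ?M ^ N" by (simp only: mult.assoc)
    finally show ?thesis .
  qed
  moreover have "smooth_field I U" using U by (simp add: admissible_def)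
  ultimately show "smooth_field I (Rd U) \<and>
      (\<forall>t\<in>I. \<forall>x. transpose (Rd U t x) = Rd U t x) \<and>
      (\<forall>t\<in>I. \<forall>x. divergence (\<lambda>t x. grad y t x ** Rd U t x) t x = U t x) \<and>
      (\<forall>l j. \<forall>t\<in>I. supp_x (\<lambda>x. Rd U t x $ l $ j) \<subseteq> ball x0 ((1 + 4 * \<epsilon>) * \<mu>)) \<and>
      (\<forall>l j. supp_t I (\<lambda>t x. Rd U t x $ l $ j) \<subseteq> supp_t I U) \<and>
      (\<forall>l j r N. r \<le> 2 \<and> N + r \<le> L \<longrightarrow>
         norm_CN I N ((dt I ^^ r) (\<lambda>t x. Rd U t x $ l $ j))
           \<le> ennreal (C * A * \<mu> * Max {\<epsilon> / \<mu>, \<Lambda>U, \<Lambda>} ^ r * Max {1 / \<mu>, \<Lambda>U, \<Lambda>} ^ N))"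
    using smooth_Rd Rd_sym divergence_Rd[OF U] Rd_supp_x[OF U] Rd_supp_t[of U] by blast
qed

end

section \<open>Choice of the constants and conclusion\<close>

lemma time_range_time_interval:
  assumes "0 < T" "0 < \<epsilon>s"
  shows "time_range (time_interval T b \<epsilon>s q i)"
proof
  have freq: "0 < freq b \<epsilon>s q" for q
  proof -
    have "0 < \<epsilon>s powr (- b * (real q + 3)\<^sup>2 / 3)" using assms by simp
    then have "0 < \<lceil>\<epsilon>s powr (- b * (real q + 3)\<^sup>2 / 3)\<rceil>" by (simp only: zero_less_ceiling)
    then show ?thesis unfolding freq_def by (intro zero_less_power) simp
  qed
  have "0 < freq_sub b \<epsilon>s q i" for i using freq[of q] freq[of "q + 1"] by (simp add: freq_sub_def)
  then have "0 < time_margin b \<epsilon>s q i"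
    using assms(2) by (simp add: time_margin_def amp_def less_imp_neq[symmetric] del: add_Suc_right Suc_eq_plus1 One_nat_def)
  then show "\<exists>a c. a < c \<and> time_interval T b \<epsilon>s q i = {a..c}"
    using assms unfolding time_interval_def
    by (intro exI[of _ "- time_margin b \<epsilon>s q i"] exI[of _ "T + time_margin b \<epsilon>s q i"]) simp
qed

text \<open>Continuity of \<open>det\<close> at the identity; \<open>\<delta>\<close> depends on the
  dimension only, and so will \<open>\<epsilon>0\<close>.\<close>

lemma det_near_1:
  obtains \<delta> where "0 < \<delta>" "\<And>A :: real ^ 'n ^ 'n::finite. norm (A - mat 1) < \<delta> \<Longrightarrow> 1 / 2 \<le> det A"
proof -
  have "continuous_on UNIV (det :: real ^ 'n ^ 'n \<Rightarrow> real)"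
    by (rule Ck_on_continuous[of 0]) (intro Ck_on_det Ck_on_nth Ck_on_ident)
  then obtain \<delta> where \<delta>: "0 < \<delta>" "\<forall>A. dist A (mat 1 :: real ^ 'n ^ 'n) < \<delta> \<longrightarrow> dist (det A) (det (mat 1 :: real ^ 'n ^ 'n)) < 1 / 2"
    unfolding continuous_on_iff by (metis UNIV_I half_gt_zero zero_less_one)
  have "1 / 2 \<le> det A" if A: "norm (A - mat 1) < \<delta>" for A :: "real ^ 'n ^ 'n"
  proof -
    have "dist (det A) (det (mat 1 :: real ^ 'n ^ 'n)) < 1 / 2" using \<delta>(2) A by (simp add: dist_norm)
    then show ?thesis unfolding dist_real_def det_I by linarith
  qed
  then show ?thesis using \<delta>(1) that by blast
qed

theorem proposition4p10:
  assumes "CARD('n::finite) \<ge> 2"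
  shows "\<exists>\<epsilon>0. 0 < \<epsilon>0 \<and> \<epsilon>0 < 1 / 2 \<and>
    (\<exists>Cd > 0. \<forall>L::nat. L \<ge> 1 \<longrightarrow> (\<exists>C > 0.
      \<forall>T b \<epsilon>s q i I. T > 0 \<and> b > 0 \<and> 0 < \<epsilon>s \<and> \<epsilon>s < 1 \<and> i \<le> 2 \<and> I = time_interval T b \<epsilon>s q i \<longrightarrow>
      (\<forall>\<epsilon> \<Lambda>u \<mu> (x0 :: real ^ 'n) u y.
         0 < \<epsilon> \<and> \<epsilon> \<le> \<epsilon>0 \<and> \<Lambda>u \<ge> 1 \<and> \<mu> > 0 \<and>
         smooth_field I u \<and> y = (\<lambda>t x. x + u t x) \<and> deformation_bounds I L \<epsilon> \<Lambda>u u \<longrightarrow>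
         (\<exists>R. linear_on_admissible I y x0 \<mu> R \<and>
           (\<forall>A \<Lambda>U U. A > 0 \<and> \<Lambda>U > 0 \<and> admissible I y x0 \<mu> U \<and>
              (\<forall>r N. r \<le> 2 \<and> N + r \<le> L \<longrightarrow>
                 norm_CN I N ((dt I ^^ r) U) \<le> ennreal (A * \<Lambda>U ^ (N + r))) \<longrightarrow>
              smooth_field I (R U) \<and>
              (\<forall>t\<in>I. \<forall>x. transpose (R U t x) = R U t x) \<and>
              (\<forall>t\<in>I. \<forall>x. divergence (\<lambda>t x. grad y t x ** R U t x) t x = U t x) \<and>
              (\<forall>l j. \<forall>t\<in>I. supp_x (\<lambda>x. R U t x $ l $ j) \<subseteq> ball x0 ((1 + Cd * \<epsilon>) * \<mu>)) \<and>
              (\<forall>l j. supp_t I (\<lambda>t x. R U t x $ l $ j) \<subseteq> supp_t I U) \<and>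
              (\<forall>l j r N. r \<le> 2 \<and> N + r \<le> L \<longrightarrow>
                 norm_CN I N ((dt I ^^ r) (\<lambda>t x. R U t x $ l $ j))
                   \<le> ennreal (C * A * \<mu> * Max {\<epsilon> / \<mu>, \<Lambda>U, \<Lambda>u} ^ r
                                * Max {1 / \<mu>, \<Lambda>U, \<Lambda>u} ^ N)))))))"
proof -
  obtain \<delta> where \<delta>: "0 < \<delta>" "\<And>A :: real ^ 'n ^ 'n. norm (A - mat 1) < \<delta> \<Longrightarrow> 1 / 2 \<le> det A"
    by (rule det_near_1) (rule that)
  \<comment> \<open>Halving \<open>\<delta>\<close> turns its strict inequality into the non-strict
    one of \<open>det_near\<close>.\<close>
  define \<epsilon>0 where "\<epsilon>0 = min (1 / 4) (\<delta> / 2)"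
  have \<epsilon>0: "0 < \<epsilon>0" "\<epsilon>0 \<le> 1 / 4" "\<epsilon>0 < \<delta>" using \<delta>(1) by (auto simp: \<epsilon>0_def)
  show ?thesis
  proof (rule exI[of _ \<epsilon>0], intro conjI, goal_cases)
    case 3
    show ?case
    \<comment> \<open>The value of \<open>Cd\<close> found in \<open>Rd_support\<close>.\<close>
    proof (rule exI[of _ "4::real"], rule conjI[OF zero_less_numeral], intro allI impI, goal_cases)
      case (1 L)
      obtain G where G: "0 \<le> G" "\<forall>k\<le>L + 1. \<forall>x\<le>1. \<bar>bump k x\<bar> \<le> G" using bump_bounded by blast
      let ?c = "real (Suc L) * c_R CARD('n) L G (bump_mass TYPE('n)) (measure lborel (cube 4 :: (real ^ 'n) set))"
      have "0 \<le> ?c" by (intro mult_nonneg_nonneg of_nat_0_le_iff c_R_nonneg[OF G(1) bump_mass_pos measure_nonneg])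
      then have C: "0 < ?c + 1" "?c \<le> ?c + 1" by linarith+
      show ?case
      \<comment> \<open>\<open>?c\<close> is only known to be nonnegative; adding 1 makes the
        constant positive.\<close>
      proof (rule exI[of _ "?c + 1"], rule conjI[OF C(1)], intro allI impI, elim conjE, goal_cases)
        case (1 T b \<epsilon>s q i I \<epsilon> \<Lambda>u \<mu> x0 u y)
        interpret time_range I unfolding \<open>I = _\<close> by (rule time_range_time_interval) fact+
        interpret deformation I u L \<epsilon> \<Lambda>u \<mu> x0
          by unfold_locales (use 1 \<epsilon>0 \<delta>(2) in auto)
        have "y = deformation.y u" using \<open>y = _\<close> by (simp add: y_def fun_eq_iff)
        then show ?case using ex_solution[OF G C(2)] by simp
      qed
    qed
  qed (use \<epsilon>0 in auto)
qed

end
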